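(* The tree-independence number of any $K_5^-$-induced-minor-free graph is at most $4$.
   Context: All graphs are finite, simple and undirected. $K_5^-$ is the complete graph $K_5$ minus one edge. A graph $G$ is $H$-induced-minor-free if no graph isomorphic to $H$ can be obtained from $G$ by a sequence of vertex deletions and edge contractions. A tree decomposition of $G$ is a pair $(T,\{X_t\}_{t\in V(T)})$ with $T$ a tree and bags $X_t\subseteq V(G)$ such that every vertex is in some bag, both endpoints of every edge are in a common bag, and for every vertex $u$ the set $\{t:u\in X_t\}$ induces a connected subgraph of $T$. The independence number of a tree decomposition is $\max_t\alpha(G[X_t])$, where $\alpha$ is the maximum size of an independent set. The tree-independence number of $G$ is the minimum independence number over all tree decompositions of $G$. *)

theory Defs
  imports "Graph_Theory.Graph_Theory"
begin

text \<open>
  A finite simple undirected graph is a \<^locale>\<open>pair_graph\<close>: a finite vertex set with a finite,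
  symmetric, irreflexive adjacency relation. The edge \<open>uv\<close> is the pair of arcs \<open>(u, v)\<close>, \<open>(v, u)\<close>.
\<close>

subsection \<open>Induced minors\<close>

definition delete_vertex :: "'a pair_pre_digraph \<Rightarrow> 'a \<Rightarrow> 'a pair_pre_digraph" where
  "delete_vertex G v =
     \<lparr> pverts = pverts G - {v}, parcs = {(x, y) \<in> parcs G. x \<noteq> v \<and> y \<noteq> v} \<rparr>"

text \<open>
  The vertex obtained by contracting the edge \<open>uv\<close> keeps the name \<open>u\<close>. Removing the diagonal
  discards the loop arising from \<open>uv\<close> itself; parallel edges are merged by the set representation.
\<close>
definition contract_edge :: "'a pair_pre_digraph \<Rightarrow> 'a \<Rightarrow> 'a \<Rightarrow> 'a pair_pre_digraph" where
  "contract_edge G u v =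
     \<lparr> pverts = pverts G - {v},
       parcs = (\<lambda>(x, y). (if x = v then u else x, if y = v then u else y)) ` parcs G - Id \<rparr>"

inductive induced_minor_step :: "'a pair_pre_digraph \<Rightarrow> 'a pair_pre_digraph \<Rightarrow> bool" where
  delete: "v \<in> pverts G \<Longrightarrow> induced_minor_step G (delete_vertex G v)"
| contract: "(u, v) \<in> parcs G \<Longrightarrow> induced_minor_step G (contract_edge G u v)"

definition induced_minor_free :: "'b pair_pre_digraph \<Rightarrow> 'a pair_pre_digraph \<Rightarrow> bool" where
  "induced_minor_free H G \<longleftrightarrow>
     \<not> (\<exists>G'. induced_minor_step\<^sup>*\<^sup>* G G' \<and> digraph_iso (with_proj G') (with_proj H))"

definition K5_minus :: "nat pair_pre_digraph" where
  "K5_minus =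
     \<lparr> pverts = {0..<5},
       parcs = {(i, j). i \<in> {0..<5} \<and> j \<in> {0..<5} \<and> i \<noteq> j} - {(0, 1), (1, 0)} \<rparr>"

subsection \<open>Independence number\<close>

definition independent_set :: "('a, 'b) pre_digraph \<Rightarrow> 'a set \<Rightarrow> bool" where
  "independent_set G S \<longleftrightarrow> S \<subseteq> verts G \<and> (\<forall>u \<in> S. \<forall>v \<in> S. (u, v) \<notin> arcs_ends G)"

definition independence_number :: "('a, 'b) pre_digraph \<Rightarrow> nat" where
  "independence_number G = Max (card ` {S. independent_set G S})"

subsection \<open>Tree decompositions\<close>

text \<open>
  The library's \<^const>\<open>tree\<close> does not fit here: in a symmetric digraph the closed walk \<open>a, b, a\<close>
  already counts as a \<^const>\<open>pre_digraph.cycle\<close>. The cycles of length at least 3 are exactly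
  the cycles of the underlying undirected graph.
\<close>
definition undirected_tree :: "'t pair_pre_digraph \<Rightarrow> bool" where
  "undirected_tree T \<longleftrightarrow>
     pair_graph T \<and> connected (with_proj T) \<and>
     \<not> (\<exists>p. pre_digraph.cycle (with_proj T) p \<and> 3 \<le> length p)"

definition tree_decomposition ::
    "'a pair_pre_digraph \<Rightarrow> 't pair_pre_digraph \<Rightarrow> ('t \<Rightarrow> 'a set) \<Rightarrow> bool" where
  "tree_decomposition G T X \<longleftrightarrow>
     undirected_tree T \<and>
     (\<forall>t \<in> pverts T. X t \<subseteq> pverts G) \<and>
     (\<forall>u \<in> pverts G. \<exists>t \<in> pverts T. u \<in> X t) \<and>
     (\<forall>(u, v) \<in> parcs G. \<exists>t \<in> pverts T. u \<in> X t \<and> v \<in> X t) \<and>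
     (\<forall>u \<in> pverts G. connected (with_proj T \<restriction> {t \<in> pverts T. u \<in> X t}))"

definition decomposition_independence_number ::
    "'a pair_pre_digraph \<Rightarrow> 't pair_pre_digraph \<Rightarrow> ('t \<Rightarrow> 'a set) \<Rightarrow> nat" where
  "decomposition_independence_number G T X =
     Max ((\<lambda>t. independence_number (with_proj G \<restriction> X t)) ` pverts T)"

text \<open>
  Trees are finite, so up to isomorphism every tree decomposition has natural numbers as nodes.
\<close>
definition tree_independence_number :: "'a pair_pre_digraph \<Rightarrow> nat" where
  "tree_independence_number G =
     (LEAST k. \<exists>(T :: nat pair_pre_digraph) X.
        tree_decomposition G T X \<and> decomposition_independence_number G T X = k)"

text \<open>The minimum is taken over a nonempty set: one bag containing all vertices is possible.\<close>
lemma tree_decomposition_single_bag: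
  assumes "pair_graph G"
  shows "tree_decomposition G \<lparr> pverts = {0 :: nat}, parcs = {} \<rparr> (\<lambda>_. pverts G)"
proof -
  interpret pair_graph G by fact
  let ?T = "\<lparr> pverts = {0 :: nat}, parcs = {} \<rparr>"
  have graph: "pair_graph ?T"
    by unfold_locales (auto simp: symmetric_def sym_def)
  have conn: "connected G'" if "verts G' = {0 :: nat}" for G' :: "(nat, nat \<times> nat) pre_digraph"
    using that by (auto simp: connected_def strongly_connected_def mk_symmetric_def reachable_def
        intro: rtrancl_on_refl)
  have "\<not> pre_digraph.cycle (with_proj ?T) p" for p
    by (cases p) (auto simp: pre_digraph.cycle_def pre_digraph.awalk_def)
  then show ?thesis
    using graph conn by (auto simp: tree_decomposition_def undirected_tree_def dest: wellformed')
qed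

end

theory Submission
  imports Defs
begin

text \<open>
  It suffices to find a chordal supergraph \<open>F\<close> of \<open>G\<close> on the same vertices each of whose cliques has
  at most four vertices or is a clique of \<open>G\<close>: the bags of a clique tree of \<open>F\<close> then have
  independence number at most \<open>4\<close>. Consider a smallest graph without induced minor \<open>K\<^sub>5\<^sup>-\<close> that
  has no such \<open>F\<close>. Contracting one side of a small separator into one of its vertices completes the
  separator to a clique, and supergraphs for both sides can be glued along this clique; so the
  graph is 3-connected and its separators of size three are independent. Simplicial vertices of the
  supergraphs belonging to the contractions of single edges give a vertex \<open>u\<close> of degree three, with
  independent neighbourhood \<open>{a, b, c}\<close>. Let \<open>D\<close> be a maximal connected set containing \<open>c\<close> such that
  \<open>a\<close> and \<open>b\<close> lie in one component of \<open>G - u - D\<close>. Then \<open>G - u - D\<close> is an induced path from \<open>a\<close> to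
  \<open>b\<close>, and a path of length at least three would allow to split \<open>D\<close> into two connected sets that
  span a \<open>K\<^sub>5\<^sup>-\<close> together with the cycle through \<open>u\<close>. So any two of \<open>a, b, c\<close> have a
  common neighbour besides \<open>u\<close>, and the few graphs left are excluded directly.
\<close>

section \<open>Connected sets and cliques\<close>

text \<open>Bounding the cliques of the supergraph, rather than independence numbers, gives a
  condition that gluing along a clique preserves. The threshold five comes from
  \<open>K5_minus\<close>: if completing a separator \<open>S\<close> of at most three vertices puts
  a nonadjacent pair of \<open>S\<close> into a clique of at least five vertices, three further
  members exist, at most one of them in \<open>S\<close>. A connected set behind \<open>S\<close>,
  contracted into that one, supplies its missing edges, and the five form a \<open>K5_minus\<close>.
  So every large clique of the completed graph was a clique before. One contraction adds edges at a
  single vertex of \<open>S\<close> only, so the other vertices of \<open>S\<close> must be pairwise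
  adjacent beforehand. This is the obstacle: independent separators of size three cannot be
  completed in this way. They leave a rigid structure instead, in which any edge inside a separator
  of size three is a contradiction, and the remaining configurations are excluded by explicit branch
  sets. Induced minors are handled as families of branch sets, which compose; sequences of deletions
  and contractions enter only when the hypothesis on \<open>G\<close> is translated.\<close>

definition touch :: "'a rel \<Rightarrow> 'a set \<Rightarrow> 'a set \<Rightarrow> bool" where
  "touch E X Y \<longleftrightarrow> (\<exists>x\<in>X. \<exists>y\<in>Y. (x, y) \<in> E)"

text \<open>Connectedness through cuts instead of paths: every splitting into two nonempty sides is
  crossed. Bipartitions restrict to subsets and pull back along maps, which is how unions, blow-ups
  and images are treated.\<close>

definition conn :: "'a rel \<Rightarrow> 'a set \<Rightarrow> bool" where
  "conn E X \<longleftrightarrow> X \<noteq> {} \<and> (\<forall>A. A \<noteq> {} \<and> A \<subset> X \<longrightarrow> touch E A (X - A))"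

definition clique :: "'a rel \<Rightarrow> 'a set \<Rightarrow> bool" where
  "clique E K \<longleftrightarrow> (\<forall>x\<in>K. \<forall>y\<in>K. x \<noteq> y \<longrightarrow> (x, y) \<in> E)"

definition nbrs :: "'a rel \<Rightarrow> 'a set \<Rightarrow> 'a set" where
  "nbrs E X = E `` X - X"

lemma touchI: "x \<in> X \<Longrightarrow> y \<in> Y \<Longrightarrow> (x, y) \<in> E \<Longrightarrow> touch E X Y"
  unfolding touch_def by blast

lemma touchE:
  assumes "touch E X Y"
  obtains x y where "x \<in> X" "y \<in> Y" "(x, y) \<in> E"
  using assms unfolding touch_def by blast

lemma touch_sym: "sym E \<Longrightarrow> touch E X Y \<longleftrightarrow> touch E Y X"
  unfolding touch_def by (meson symD)

lemma touch_superset: "touch E X Y \<Longrightarrow> X \<subseteq> X' \<Longrightarrow> Y \<subseteq> Y' \<Longrightarrow> touch E X' Y'"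
  unfolding touch_def by blast

lemma touch_Un [simp]:
  "touch E (X \<union> X') Y \<longleftrightarrow> touch E X Y \<or> touch E X' Y"
  "touch E Y (X \<union> X') \<longleftrightarrow> touch E Y X \<or> touch E Y X'"
  unfolding touch_def by blast+

lemma touch_pair:
  "touch E X {x, y} \<longleftrightarrow> touch E X {x} \<or> touch E X {y}"
  "touch E {x, y} X \<longleftrightarrow> touch E {x} X \<or> touch E {y} X"
  unfolding touch_def by blast+

lemma touch_singletons [simp]: "touch E {x} {y} \<longleftrightarrow> (x, y) \<in> E"
  by (simp add: touch_def)

lemma clique_mono: "clique E K \<Longrightarrow> L \<subseteq> K \<Longrightarrow> E \<subseteq> E' \<Longrightarrow> clique E' L"
  unfolding clique_def by blast

lemma clique_insert:
  "clique F K \<Longrightarrow> (\<And>x. x \<in> K \<Longrightarrow> (t, x) \<in> F \<and> (x, t) \<in> F) \<Longrightarrow> clique F (insert t K)"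
  by (auto simp: clique_def)

lemma clique_subset_nbrs: "clique F K \<Longrightarrow> w \<in> K \<Longrightarrow> K \<subseteq> insert w (F `` {w})"
  by (auto simp: clique_def)

lemma three_distinct:
  assumes "3 \<le> card X"
  obtains a b c where "a \<in> X" "b \<in> X" "c \<in> X" "a \<noteq> b" "a \<noteq> c" "b \<noteq> c"
proof -
  obtain Y where "Y \<subseteq> X" "card Y = 3" using obtain_subset_with_card_n[OF assms] by auto
  then show thesis using that by (auto simp: card_3_iff)
qed

lemma nbrsI: "x \<in> X \<Longrightarrow> (x, y) \<in> E \<Longrightarrow> y \<notin> X \<Longrightarrow> y \<in> nbrs E X"
  unfolding nbrs_def by blast

lemma no_touch_outside: "Y \<inter> X = {} \<Longrightarrow> Y \<inter> nbrs E X = {} \<Longrightarrow> \<not> touch E X Y"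
  unfolding nbrs_def touch_def by blast

lemma conn_nonempty: "conn E X \<Longrightarrow> X \<noteq> {}"
  unfolding conn_def by blast

lemma conn_singleton [simp]: "conn E {x}"
  unfolding conn_def by (auto simp: psubset_eq subset_singleton_iff)

lemma connI:
  assumes "X \<noteq> {}"
    and "\<And>A B. A \<union> B = X \<Longrightarrow> A \<inter> B = {} \<Longrightarrow> A \<noteq> {} \<Longrightarrow> B \<noteq> {} \<Longrightarrow> touch E A B"
  shows "conn E X"
  unfolding conn_def
proof (intro conjI allI impI)
  fix A assume "A \<noteq> {} \<and> A \<subset> X"
  then show "touch E A (X - A)" by (intro assms(2)) auto
qed (fact assms(1))

lemma conn_cut:
  assumes "conn E X" "A \<union> B = X" "A \<inter> B = {}" "A \<noteq> {}" "B \<noteq> {}"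
  shows "touch E A B"
proof -
  have "A \<subset> X" "X - A = B" using assms by auto
  then show ?thesis using assms(1,4) unfolding conn_def by metis
qed

lemma conn_cut_subset:
  assumes "conn E X" "X \<subseteq> A \<union> B" "A \<inter> B = {}" "A \<inter> X \<noteq> {}" "B \<inter> X \<noteq> {}"
  shows "touch E (A \<inter> X) (B \<inter> X)"
  by (rule conn_cut[OF assms(1)]) (use assms in auto)

lemma conn_Un:
  assumes X: "conn E X" and Y: "conn E Y" and "sym E" and XY: "touch E X Y \<or> X \<inter> Y \<noteq> {}"
  shows "conn E (X \<union> Y)"
proof (rule connI)
  show "X \<union> Y \<noteq> {}" using conn_nonempty[OF X] by blast
  fix A B assume AB: "A \<union> B = X \<union> Y" "A \<inter> B = {}" "A \<noteq> {}" "B \<noteq> {}"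
  have side: "touch E A B \<or> Z \<subseteq> A \<or> Z \<subseteq> B" if "conn E Z" "Z \<subseteq> X \<union> Y" for Z
  proof (cases "A \<inter> Z \<noteq> {} \<and> B \<inter> Z \<noteq> {}")
    case True
    then have "touch E (A \<inter> Z) (B \<inter> Z)"
      using that AB by (intro conn_cut_subset) auto
    then have "touch E A B" by (rule touch_superset) auto
    then show ?thesis by blast
  next
    case False
    then show ?thesis using that(2) AB(1) by blast
  qed
  consider "touch E A B" | "X \<subseteq> A" "Y \<subseteq> B" | "X \<subseteq> B" "Y \<subseteq> A"
    using side[OF X] side[OF Y] AB by blast
  then show "touch E A B"
  proof cases
    case 2
    then have "touch E X Y" using XY AB(2) by blast
    then show ?thesis using 2 by (rule touch_superset)
  next
    case 3
    then have "touch E Y X" using XY AB(2) touch_sym[OF \<open>sym E\<close>] by blast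
    then show ?thesis using 3(2,1) by (rule touch_superset)
  qed
qed

lemma conn_insert:
  assumes "conn E X" "sym E" "y \<in> E `` X"
  shows "conn E (insert y X)"
  using conn_Un[OF conn_singleton assms(1,2), of y] assms(2,3)
  by (auto simp: touch_def dest: symD)

lemma conn_insert_touch:
  assumes "conn E X" "sym E" "touch E {y} X"
  shows "conn E (insert y X)"
  using conn_Un[OF conn_singleton assms(1,2), of y] assms(3) by simp

text \<open>A bipartition of the union either splits one branch set, and is crossed inside it, or
  sorts whole branch sets and so comes from a bipartition of \<open>X\<close>.\<close>

lemma conn_blowup:
  assumes X: "conn E' X"
    and c: "\<And>x. x \<in> X \<Longrightarrow> conn E (\<phi> x)"
    and t: "\<And>x y. x \<in> X \<Longrightarrow> y \<in> X \<Longrightarrow> x \<noteq> y \<Longrightarrow> (x, y) \<in> E' \<Longrightarrow> touch E (\<phi> x) (\<phi> y)"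
  shows "conn E (\<Union>(\<phi> ` X))"
proof (rule connI)
  show "\<Union>(\<phi> ` X) \<noteq> {}" using conn_nonempty[OF X] c conn_nonempty by fastforce
  fix A B assume AB: "A \<union> B = \<Union>(\<phi> ` X)" "A \<inter> B = {}" "A \<noteq> {}" "B \<noteq> {}"
  show "touch E A B"
  proof (cases "\<exists>x\<in>X. A \<inter> \<phi> x \<noteq> {} \<and> B \<inter> \<phi> x \<noteq> {}")
    case True
    then obtain x where x: "x \<in> X" "A \<inter> \<phi> x \<noteq> {}" "B \<inter> \<phi> x \<noteq> {}" by blast
    have "touch E (A \<inter> \<phi> x) (B \<inter> \<phi> x)"
      by (rule conn_cut_subset[OF c[OF x(1)]]) (use x AB in auto)
    then show ?thesis by (rule touch_superset) auto
  next
    case False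
    let ?A = "{x \<in> X. \<phi> x \<subseteq> A}" and ?B = "{x \<in> X. \<phi> x \<subseteq> B}"
    have cov: "\<phi> x \<subseteq> A \<or> \<phi> x \<subseteq> B" if "x \<in> X" for x
    proof -
      have "\<phi> x \<subseteq> A \<union> B" using that AB(1) by blast
      then show ?thesis using False that by blast
    qed
    have ne: "\<phi> x \<noteq> {}" if "x \<in> X" for x using c[OF that] by (rule conn_nonempty)
    obtain a b where ab: "a \<in> A" "b \<in> B" using AB(3,4) by blast
    obtain x y where "x \<in> X" "a \<in> \<phi> x" "y \<in> X" "b \<in> \<phi> y" using AB(1) ab by blast
    then have xy: "x \<in> ?A" "y \<in> ?B" using cov[of x] cov[of y] ab AB(2) by blast+
    have "touch E' ?A ?B"
    proof (rule conn_cut[OF X])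
      show "?A \<union> ?B = X" using cov by blast
      show "?A \<inter> ?B = {}" using ne AB(2) by fast
      show "?A \<noteq> {}" "?B \<noteq> {}" using xy by blast+
    qed
    then obtain x y where xy: "x \<in> ?A" "y \<in> ?B" "(x, y) \<in> E'" unfolding touch_def by blast
    have "x \<noteq> y" using xy AB(2) ne[of x] by blast
    then have "touch E (\<phi> x) (\<phi> y)" using t xy by blast
    then show ?thesis using xy by (elim touch_superset) auto
  qed
qed

lemma conn_mono:
  assumes "conn E X" "E \<inter> X \<times> X \<subseteq> E'"
  shows "conn E' X"
proof (rule connI)
  show "X \<noteq> {}" by (rule conn_nonempty[OF assms(1)])
  fix A B assume AB: "A \<union> B = X" "A \<inter> B = {}" "A \<noteq> {}" "B \<noteq> {}"
  then obtain x y where "x \<in> A" "y \<in> B" "(x, y) \<in> E"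
    using conn_cut[OF assms(1)] unfolding touch_def by blast
  then show "touch E' A B" using AB(1) assms(2) by (intro touchI) auto
qed

lemma maximal_subset_exists:
  assumes "finite W" "P X" "\<And>C. P C \<Longrightarrow> C \<subseteq> W"
  obtains C where "P C" "X \<subseteq> C" "\<And>C'. P C' \<Longrightarrow> C \<subseteq> C' \<Longrightarrow> C' = C"
proof -
  have "finite {C. P C}" using assms(1,3) by (auto intro: finite_subset[of _ "Pow W"])
  then show thesis using finite_has_maximal2[of "{C. P C}" X] assms(2) that by auto
qed

text \<open>\<open>C\<close> is a component of the graph induced on \<open>W\<close>: having no
  neighbour in \<open>W\<close> encodes maximality, since such a neighbour could be added.\<close>

lemma component_exists:
  assumes "finite W" "conn E X" "X \<subseteq> W" "sym E"
  obtains C where "conn E C" "X \<subseteq> C" "C \<subseteq> W" "nbrs E C \<inter> W = {}"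
proof -
  let ?P = "\<lambda>C. conn E C \<and> X \<subseteq> C \<and> C \<subseteq> W"
  obtain C where C: "?P C" and mx: "\<And>C'. ?P C' \<Longrightarrow> C \<subseteq> C' \<Longrightarrow> C' = C"
    using assms by (elim maximal_subset_exists[of W ?P X]) auto
  have "nbrs E C \<inter> W = {}"
  proof (rule ccontr)
    assume "nbrs E C \<inter> W \<noteq> {}"
    then obtain y where y: "y \<in> E `` C" "y \<notin> C" "y \<in> W" unfolding nbrs_def by blast
    have "?P (insert y C)" using C y assms(4) by (auto intro: conn_insert)
    then show False using mx y(2) by blast
  qed
  then show thesis using that C by blast
qed

lemma conn_grow:
  assumes "conn E D" "Y \<subset> D" "Y \<noteq> {}"
  obtains x where "x \<in> D - Y" "x \<in> E `` Y"
  using assms unfolding conn_def touch_def by blast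

text \<open>A maximal proper connected subset of \<open>D\<close> misses only one vertex, because
  adding an adjacent vertex keeps it connected and hence must produce all of
  \<open>D\<close>.\<close>

lemma noncut_vertex:
  assumes "finite D" "conn E D" "sym E" "2 \<le> card D"
  obtains d where "d \<in> D" "conn E (D - {d})"
proof -
  obtain y where y: "y \<in> D" using conn_nonempty[OF assms(2)] by blast
  let ?P = "\<lambda>C. conn E C \<and> C \<subset> D"
  have "D \<noteq> {y}" using assms(4) by auto
  then obtain C where C: "?P C" and mx: "\<And>C'. ?P C' \<Longrightarrow> C \<subseteq> C' \<Longrightarrow> C' = C"
    using y assms(1) by (elim maximal_subset_exists[of D ?P "{y}"]) auto
  obtain d where d: "d \<in> D - C" "d \<in> E `` C"
    using conn_grow[OF assms(2), of C] C conn_nonempty[of E C] by metis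
  have "conn E (insert d C)" using C d(2) assms(3) by (intro conn_insert) auto
  then have "\<not> insert d C \<subset> D" using mx[of "insert d C"] d(1) by blast
  then have "D - {d} = C" using C d(1) by blast
  then show thesis using that d C by blast
qed

text \<open>Edges from \<open>Z\<close> to the rest of \<open>X\<close> can only end in
  \<open>x\<close>. So \<open>Z\<close> may be added to the side of a bipartition that contains
  \<open>x\<close>, and an edge then crossing it does not start in \<open>Z\<close>.\<close>

lemma conn_remove_component:
  assumes X: "conn E X" "sym E" and x: "x \<in> X" "x \<notin> Z" and Z: "nbrs E Z \<inter> (X - {x}) = {}"
  shows "conn E (X - Z)"
proof (rule connI)
  show "X - Z \<noteq> {}" using x by blast
  fix A B assume AB: "A \<union> B = X - Z" "A \<inter> B = {}" "A \<noteq> {}" "B \<noteq> {}"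
  have *: "touch E A' B'" if A'B': "A' \<union> B' = X - Z" "A' \<inter> B' = {}" "B' \<noteq> {}" "x \<in> A'" for A' B'
  proof -
    have "touch E (X - B') B'"
      by (rule conn_cut[OF X(1)]) (use A'B' x in auto)
    then obtain v w where vw: "v \<in> X" "v \<notin> B'" "w \<in> B'" "(v, w) \<in> E" unfolding touch_def by blast
    have "w \<in> X - {x}" "w \<notin> Z" using vw(3) A'B' by auto
    then have "v \<notin> Z" using Z vw(4) unfolding nbrs_def by blast
    then have "v \<in> A'" using vw(1,2) A'B'(1) by blast
    then show ?thesis using vw(3,4) by (intro touchI)
  qed
  show "touch E A B"
  proof (cases "x \<in> A")
    case True
    then show ?thesis using *[of A B] AB by blast
  next
    case False
    then have "x \<in> B" using AB(1) x by blast
    then show ?thesis using *[of B A] AB touch_sym[OF X(2), of A B] by (simp add: Un_commute Int_commute)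
  qed
qed

lemma conn_path_image:
  assumes "sym E" "\<And>k. i \<le> k \<Longrightarrow> k < j \<Longrightarrow> (p k, p (Suc k)) \<in> E" "i \<le> j"
  shows "conn E (p ` {i..j})"
  using assms(3,2)
proof (induction j rule: dec_induct)
  case base
  then show ?case by simp
next
  case (step n)
  have "p ` {i..Suc n} = insert (p (Suc n)) (p ` {i..n})"
    using step.hyps by (auto simp: le_Suc_eq)
  moreover have "conn E (insert (p (Suc n)) (p ` {i..n}))"
  proof (rule conn_insert)
    show "conn E (p ` {i..n})" using step by simp
    show "p (Suc n) \<in> E `` (p ` {i..n})" using step.prems[of n] step.hyps by auto
  qed (fact assms(1))
  ultimately show ?case by simp
qed

lemma conn_image:
  assumes "conn E X"
  shows "conn (map_prod f f ` E - Id) (f ` X)"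
proof (rule connI)
  show "f ` X \<noteq> {}" using conn_nonempty[OF assms] by simp
  fix A B assume AB: "A \<union> B = f ` X" "A \<inter> B = {}" "A \<noteq> {}" "B \<noteq> {}"
  have "touch E {x \<in> X. f x \<in> A} {x \<in> X. f x \<in> B}"
  proof (rule conn_cut[OF assms])
    show "{x \<in> X. f x \<in> A} \<union> {x \<in> X. f x \<in> B} = X" using AB(1) by blast
    show "{x \<in> X. f x \<in> A} \<inter> {x \<in> X. f x \<in> B} = {}" using AB(2) by blast
    obtain a b where "a \<in> A" "b \<in> B" using AB(3,4) by blast
    moreover from this obtain x y where "x \<in> X" "y \<in> X" "a = f x" "b = f y" using AB(1) by blast
    ultimately show "{x \<in> X. f x \<in> A} \<noteq> {}" "{x \<in> X. f x \<in> B} \<noteq> {}" by blast+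
  qed
  then obtain x y where xy: "f x \<in> A" "f y \<in> B" "(x, y) \<in> E" unfolding touch_def by blast
  have "f x \<noteq> f y" using xy(1,2) AB(2) by (metis disjoint_iff)
  then have "(f x, f y) \<in> map_prod f f ` E - Id" using xy(3) by force
  then show "touch (map_prod f f ` E - Id) A B" by (rule touchI[OF xy(1,2)])
qed

section \<open>Minor models\<close>

text \<open>Branch sets of an induced minor: the equivalence makes the minor induced, and vertices
  of \<open>V\<close> in no branch set count as deleted.\<close>

definition minor_model :: "'b set \<Rightarrow> 'b rel \<Rightarrow> 'a set \<Rightarrow> 'a rel \<Rightarrow> ('b \<Rightarrow> 'a set) \<Rightarrow> bool" where
  "minor_model W H V E M \<longleftrightarrow>
     (\<forall>i\<in>W. M i \<subseteq> V \<and> conn E (M i)) \<and>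
     (\<forall>i\<in>W. \<forall>j\<in>W. i \<noteq> j \<longrightarrow> M i \<inter> M j = {} \<and> (touch E (M i) (M j) \<longleftrightarrow> (i, j) \<in> H))"

text \<open>Each vertex of the middle graph is blown up to its branch set. Through this, freeness
  from \<open>K5_minus\<close> passes to the contracted graphs used below.\<close>

lemma minor_model_trans:
  assumes M: "minor_model W H V' E' M" and \<phi>: "minor_model V' E' V E \<phi>"
  shows "minor_model W H V E (\<lambda>i. \<Union>(\<phi> ` M i))"
  unfolding minor_model_def
proof (intro conjI ballI impI)
  fix i assume i: "i \<in> W"
  then have sub: "M i \<subseteq> V'" and c: "conn E' (M i)" using M unfolding minor_model_def by auto
  show "\<Union>(\<phi> ` M i) \<subseteq> V" using sub \<phi> unfolding minor_model_def by blast
  show "conn E (\<Union>(\<phi> ` M i))"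
    by (rule conn_blowup[OF c]) (use sub \<phi> in \<open>auto simp: minor_model_def subset_iff\<close>)
next
  fix i j assume ij: "i \<in> W" "j \<in> W" "i \<noteq> j"
  then have sub: "M i \<subseteq> V'" "M j \<subseteq> V'" and dis: "M i \<inter> M j = {}"
    and t: "touch E' (M i) (M j) \<longleftrightarrow> (i, j) \<in> H" using M unfolding minor_model_def by auto
  have ne: "x \<noteq> y" if "x \<in> M i" "y \<in> M j" for x y using that dis by blast
  have *: "\<phi> x \<inter> \<phi> y = {}" "touch E (\<phi> x) (\<phi> y) \<longleftrightarrow> (x, y) \<in> E'"
    if "x \<in> M i" "y \<in> M j" for x y
  proof -
    have "x \<in> V'" "y \<in> V'" using that sub by auto
    then show "\<phi> x \<inter> \<phi> y = {}" "touch E (\<phi> x) (\<phi> y) \<longleftrightarrow> (x, y) \<in> E'"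
      using \<phi> ne[OF that] unfolding minor_model_def by auto
  qed
  show "\<Union>(\<phi> ` M i) \<inter> \<Union>(\<phi> ` M j) = {}" using *(1) by fast
  have "touch E (\<Union>(\<phi> ` M i)) (\<Union>(\<phi> ` M j)) \<longleftrightarrow> (\<exists>x\<in>M i. \<exists>y\<in>M j. touch E (\<phi> x) (\<phi> y))"
    unfolding touch_def by blast
  also have "\<dots> \<longleftrightarrow> touch E' (M i) (M j)" unfolding touch_def[of E'] using *(2) by blast
  finally show "touch E (\<Union>(\<phi> ` M i)) (\<Union>(\<phi> ` M j)) \<longleftrightarrow> (i, j) \<in> H" using t by blast
qed

definition model_free :: "'a set \<Rightarrow> 'a rel \<Rightarrow> bool" where
  "model_free V E \<longleftrightarrow> \<not> (\<exists>M. minor_model (pverts K5_minus) (parcs K5_minus) V E M)"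

lemma model_free_minor: "model_free V E \<Longrightarrow> minor_model V' E' V E \<phi> \<Longrightarrow> model_free V' E'"
  unfolding model_free_def using minor_model_trans by blast

text \<open>\<open>A\<close> and \<open>B\<close> stand for the ends of the missing edge,
  \<open>P\<close>, \<open>Q\<close>, \<open>R\<close> for the triangle joined to both. Every use of
  \<open>no_model\<close> below keeps this order.\<close>

lemma model_freeD:
  assumes "model_free V E" "sym E"
    and "A \<subseteq> V" "B \<subseteq> V" "P \<subseteq> V" "Q \<subseteq> V" "R \<subseteq> V"
    and "conn E A" "conn E B" "conn E P" "conn E Q" "conn E R"
    and "A \<inter> B = {}" "A \<inter> P = {}" "A \<inter> Q = {}" "A \<inter> R = {}" "B \<inter> P = {}" "B \<inter> Q = {}"
      "B \<inter> R = {}" "P \<inter> Q = {}" "P \<inter> R = {}" "Q \<inter> R = {}"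
    and "\<not> touch E A B" "touch E A P" "touch E A Q" "touch E A R" "touch E B P" "touch E B Q"
      "touch E B R" "touch E P Q" "touch E P R" "touch E Q R"
  shows False
proof -
  let ?M = "\<lambda>i::nat. [A, B, P, Q, R] ! i"
  have I: "{0..<5::nat} = {0, 1, 2, 3, 4}" by auto
  have s: "touch E B A \<longleftrightarrow> touch E A B" "touch E P A \<longleftrightarrow> touch E A P" "touch E Q A \<longleftrightarrow> touch E A Q"
    "touch E R A \<longleftrightarrow> touch E A R" "touch E P B \<longleftrightarrow> touch E B P" "touch E Q B \<longleftrightarrow> touch E B Q"
    "touch E R B \<longleftrightarrow> touch E B R" "touch E Q P \<longleftrightarrow> touch E P Q" "touch E R P \<longleftrightarrow> touch E P R"
    "touch E R Q \<longleftrightarrow> touch E Q R"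
    by (rule touch_sym[OF assms(2)])+
  have "minor_model (pverts K5_minus) (parcs K5_minus) V E ?M"
    unfolding minor_model_def K5_minus_def pair_pre_digraph.simps I
    using assms by (simp add: s Int_commute)
  then show False using assms(1) unfolding model_free_def by blast
qed

section \<open>Chordal graphs\<close>

text \<open>A perfect elimination ordering read backwards: each new vertex is simplicial when it
  arrives. The clique tree later grows along the same ordering.\<close>

inductive chordal :: "'a set \<Rightarrow> 'a rel \<Rightarrow> bool" where
  empty: "chordal {} {}"
| add: "chordal V F \<Longrightarrow> v \<notin> V \<Longrightarrow> S \<subseteq> V \<Longrightarrow> clique F S \<Longrightarrow>
    chordal (insert v V) (F \<union> {v} \<times> S \<union> S \<times> {v})"

definition good :: "'a set \<Rightarrow> 'a rel \<Rightarrow> bool" where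
  "good V E \<longleftrightarrow> (\<exists>F. chordal V F \<and> E \<subseteq> F \<and>
     (\<forall>K. K \<subseteq> V \<and> clique F K \<longrightarrow> card K \<le> 4 \<or> clique E K))"

lemma goodE:
  assumes "good V E"
  obtains F where "chordal V F" "E \<subseteq> F"
    "\<And>K. K \<subseteq> V \<Longrightarrow> clique F K \<Longrightarrow> card K \<le> 4 \<or> clique E K"
  using assms unfolding good_def by blast

locale fgraph =
  fixes V :: "'a set" and E :: "'a rel"
  assumes fin: "finite V" and sub: "E \<subseteq> V \<times> V" and symE: "sym E" and irr: "\<And>x. (x, x) \<notin> E"
begin

lemma edge_sym: "(x, y) \<in> E \<Longrightarrow> (y, x) \<in> E"
  using symE by (rule symD)

lemma edge_commute: "(x, y) \<in> E \<longleftrightarrow> (y, x) \<in> E"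
  using edge_sym by blast

lemma nbrs_singleton: "y \<in> nbrs E {x} \<longleftrightarrow> (x, y) \<in> E"
  using irr unfolding nbrs_def by auto

lemma nbrs_subset: "nbrs E X \<subseteq> V"
  using sub unfolding nbrs_def by blast

lemma finite_nbrs: "finite (nbrs E X)"
  by (rule finite_subset[OF nbrs_subset fin])

lemma touch_nbrs: "s \<in> nbrs E X \<Longrightarrow> touch E {s} X"
  unfolding nbrs_def touch_def using edge_sym by blast

lemma component_in:
  assumes "X \<noteq> {}" "X \<subseteq> V"
  obtains C where "conn E C" "C \<subseteq> X" "nbrs E C \<inter> X = {}"
proof -
  obtain x where x: "x \<in> X" using assms(1) by blast
  obtain C where "conn E C" "{x} \<subseteq> C" "C \<subseteq> X" "nbrs E C \<inter> X = {}"
    by (rule component_exists[of X E "{x}"]) (use x finite_subset[OF assms(2) fin] symE in auto)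
  then show thesis using that by blast
qed

end

lemma chordal_fgraph: "chordal V F \<Longrightarrow> fgraph V F"
proof (induction rule: chordal.induct)
  case empty
  show ?case by unfold_locales (auto simp: sym_def)
next
  case (add V F v S)
  interpret fgraph V F by fact
  show ?case
    using fin sub irr add.hyps edge_sym by unfold_locales (auto simp: sym_def)
qed

lemma chordal_restrict: "chordal V F \<Longrightarrow> chordal (V \<inter> U) (F \<inter> U \<times> U)"
proof (induction rule: chordal.induct)
  case empty
  show ?case by (simp add: chordal.empty)
next
  case (add V F v S)
  show ?case
  proof (cases "v \<in> U")
    case True
    have "chordal (insert v (V \<inter> U)) (F \<inter> U \<times> U \<union> {v} \<times> (S \<inter> U) \<union> (S \<inter> U) \<times> {v})"
      using add by (intro chordal.add) (auto simp: clique_def)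
    moreover have "insert v (V \<inter> U) = insert v V \<inter> U"
      "F \<inter> U \<times> U \<union> {v} \<times> (S \<inter> U) \<union> (S \<inter> U) \<times> {v} = (F \<union> {v} \<times> S \<union> S \<times> {v}) \<inter> U \<times> U"
      using True by auto
    ultimately show ?thesis by simp
  next
    case False
    then have "insert v V \<inter> U = V \<inter> U" "(F \<union> {v} \<times> S \<union> S \<times> {v}) \<inter> U \<times> U = F \<inter> U \<times> U" by auto
    then show ?thesis using add.IH by simp
  qed
qed

lemma chordal_complete: "finite V \<Longrightarrow> chordal V (V \<times> V - Id)"
proof (induction rule: finite_induct)
  case empty
  show ?case by (simp add: chordal.empty)
next
  case (insert v V)
  have "chordal (insert v V) ((V \<times> V - Id) \<union> {v} \<times> V \<union> V \<times> {v})"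
    using insert by (intro chordal.add) (auto simp: clique_def)
  moreover have "(V \<times> V - Id) \<union> {v} \<times> V \<union> V \<times> {v} = insert v V \<times> insert v V - Id"
    using insert.hyps by auto
  ultimately show ?case by simp
qed

text \<open>Dirac's theorem. The last added vertex is simplicial. Of two nonadjacent simplicial
  vertices of the rest, one lies outside the clique \<open>S\<close>, so its neighbourhood does not
  change; if the rest is complete, any vertex outside \<open>S\<close> will do.\<close>

lemma chordal_two_simplicial:
  "chordal V F \<Longrightarrow> \<not> clique F V \<Longrightarrow>
    \<exists>s\<in>V. \<exists>t\<in>V. s \<noteq> t \<and> (s, t) \<notin> F \<and> clique F (F `` {s}) \<and> clique F (F `` {t})"
proof (induction rule: chordal.induct)
  case empty
  then show ?case by (simp add: clique_def)
next
  case (add V F v S)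
  interpret fgraph V F by (rule chordal_fgraph) fact
  let ?F = "F \<union> {v} \<times> S \<union> S \<times> {v}"
  have "?F `` {v} = S" using sub add.hyps by auto
  then have v: "clique ?F (?F `` {v})" using add.hyps(4) by (simp add: clique_def)
  have old: "?F `` {t} = F `` {t}" if "t \<in> V - S" for t using that add.hyps(2) by auto
  obtain t where t: "t \<in> V" "t \<notin> S" "clique F (F `` {t})"
  proof (cases "clique F V")
    case True
    then obtain t where "t \<in> V" "t \<notin> S"
      using add.prems add.hyps(3) by (auto simp: clique_def)
    moreover have "clique F (F `` {t})" using True sub by (auto simp: clique_def)
    ultimately show thesis using that by blast
  next
    case False
    then obtain s t where st: "s \<in> V" "t \<in> V" "s \<noteq> t" "(s, t) \<notin> F"
      "clique F (F `` {s})" "clique F (F `` {t})"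
      using add.IH by blast
    then have "s \<notin> S \<or> t \<notin> S" using add.hyps(4) unfolding clique_def by blast
    then show thesis using that st by blast
  qed
  then have "clique ?F (?F `` {t})" using old[of t] by (simp add: clique_def)
  moreover have "t \<noteq> v" "(v, t) \<notin> ?F" using t add.hyps sub by auto
  ultimately show ?case using v t(1) by (intro bexI[of _ v] bexI[of _ t]) auto
qed

lemma chordal_simplicial_outside:
  assumes "chordal V F" "S \<subset> V" "clique F S"
  obtains v where "v \<in> V - S" "clique F (F `` {v})"
proof (cases "clique F V")
  case True
  obtain v where "v \<in> V - S" using assms(2) by blast
  moreover have "clique F (F `` {v})"
    using True fgraph.sub[OF chordal_fgraph[OF assms(1)]] by (auto simp: clique_def)
  ultimately show thesis using that by blast
next
  case False
  then obtain s t where st: "s \<in> V" "t \<in> V" "s \<noteq> t" "(s, t) \<notin> F" "clique F (F `` {s})" "clique F (F `` {t})"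
    using chordal_two_simplicial[OF assms(1)] by blast
  then have "s \<notin> S \<or> t \<notin> S" using assms(3) unfolding clique_def by blast
  then show thesis using st that by blast
qed

text \<open>The common part is a clique, so \<open>V2\<close> can be peeled down to it by simplicial
  vertices outside \<open>V1\<close>. Put back in reverse order, they keep their clique
  neighbourhoods in the glued graph.\<close>

lemma chordal_glue:
  assumes "chordal V1 F1" "chordal V2 F2" "clique F1 (V1 \<inter> V2)" "clique F2 (V1 \<inter> V2)"
  shows "chordal (V1 \<union> V2) (F1 \<union> F2)"
  using assms(2,3,4)
proof (induction "card (V2 - V1)" arbitrary: V2 F2)
  case 0
  interpret G1: fgraph V1 F1 by (rule chordal_fgraph) fact
  interpret G2: fgraph V2 F2 by (rule chordal_fgraph) fact
  have "V2 \<subseteq> V1" using 0 G2.fin by auto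
  moreover have "(x, y) \<in> F1" if "(x, y) \<in> F2" for x y
  proof -
    have "x \<in> V1 \<inter> V2" "y \<in> V1 \<inter> V2" "x \<noteq> y" using that G2.sub G2.irr \<open>V2 \<subseteq> V1\<close> by auto
    then show ?thesis using 0 by (auto simp: clique_def)
  qed
  ultimately have "V1 \<union> V2 = V1" "F1 \<union> F2 = F1" by auto
  then show ?case using assms(1) by simp
next
  case (Suc n)
  interpret G1: fgraph V1 F1 by (rule chordal_fgraph) fact
  interpret G2: fgraph V2 F2 by (rule chordal_fgraph) fact
  have "V2 - V1 \<noteq> {}" using Suc.hyps(2) by (metis card.empty nat.distinct(1))
  then have "V1 \<inter> V2 \<subset> V2" by blast
  then obtain v where v: "v \<in> V2 - V1" "clique F2 (F2 `` {v})"
    using chordal_simplicial_outside[OF Suc.prems(1) _ Suc.prems(3)] by blast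
  let ?U = "V2 - {v}"
  let ?F = "F2 \<inter> ?U \<times> ?U"
  have ch: "chordal ?U ?F"
    using chordal_restrict[OF Suc.prems(1), of ?U] by (simp add: Int_absorb1)
  have "V2 - V1 = insert v (?U - V1)" using v by auto
  moreover have "finite (?U - V1)" using G2.fin by auto
  ultimately have "n = card (?U - V1)" using Suc.hyps(2) by simp
  moreover have "V1 \<inter> ?U = V1 \<inter> V2" using v by auto
  moreover have "clique ?F (V1 \<inter> V2)" using Suc.prems(3) v by (auto simp: clique_def)
  ultimately have "chordal (V1 \<union> ?U) (F1 \<union> ?F)" using Suc.hyps(1)[OF _ ch] Suc.prems(2) by simp
  moreover have "clique (F1 \<union> ?F) (F2 `` {v})"
    using v(2) G2.sub G2.irr by (auto simp: clique_def)
  moreover have "F2 `` {v} \<subseteq> V1 \<union> ?U" using G2.sub G2.irr by auto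
  ultimately have "chordal (insert v (V1 \<union> ?U)) ((F1 \<union> ?F) \<union> {v} \<times> F2 `` {v} \<union> F2 `` {v} \<times> {v})"
    using v(1) by (intro chordal.add) auto
  moreover have "insert v (V1 \<union> ?U) = V1 \<union> V2" using v by auto
  moreover have "(F1 \<union> ?F) \<union> {v} \<times> F2 `` {v} \<union> F2 `` {v} \<times> {v} = F1 \<union> F2"
    using v(1) G2.sub G2.irr by (auto dest: G2.edge_sym)
  ultimately show ?case by simp
qed

section \<open>Minimal counterexamples\<close>

text \<open>Minimality refers to all graphs with fewer vertices on the same type, not to subgraphs:
  the smaller graphs in question carry edges that are new.\<close>

locale critical = fgraph V E for V :: "'a set" and E +
  assumes model_free: "model_free V E"
    and smaller: "\<And>(V' :: 'a set) E'. fgraph V' E' \<Longrightarrow> model_free V' E' \<Longrightarrow> card V' < card V \<Longrightarrow> good V' E'"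
    and not_good: "\<not> good V E"
begin

lemma no_model:
  assumes "A \<subseteq> V" "B \<subseteq> V" "P \<subseteq> V" "Q \<subseteq> V" "R \<subseteq> V"
    and "conn E A" "conn E B" "conn E P" "conn E Q" "conn E R"
    and "A \<inter> B = {}" "A \<inter> P = {}" "A \<inter> Q = {}" "A \<inter> R = {}" "B \<inter> P = {}" "B \<inter> Q = {}"
      "B \<inter> R = {}" "P \<inter> Q = {}" "P \<inter> R = {}" "Q \<inter> R = {}"
    and "\<not> touch E A B" "touch E A P" "touch E A Q" "touch E A R" "touch E B P" "touch E B Q"
      "touch E B R" "touch E P Q" "touch E P R" "touch E Q R"
  shows False
  using assms by (rule model_freeD[OF model_free symE])

text \<open>The complete graph on \<open>V\<close> is a chordal supergraph; it would witness
  \<open>good\<close> if \<open>E\<close> were complete or \<open>V\<close> had at most four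
  vertices.\<close>

lemma not_clique: "\<not> clique E V" and card_V: "5 \<le> card V"
proof -
  have "chordal V (V \<times> V - Id)" "E \<subseteq> V \<times> V - Id" using chordal_complete[OF fin] sub irr by auto
  then have *: "\<not> (\<forall>K. K \<subseteq> V \<and> clique (V \<times> V - Id) K \<longrightarrow> card K \<le> 4 \<or> clique E K)"
    using not_good unfolding good_def by blast
  then show "\<not> clique E V" using clique_mono[of E V] by blast
  obtain K where "K \<subseteq> V" "\<not> card K \<le> 4" using * by blast
  then show "5 \<le> card V" using card_mono[OF fin, of K] by simp
qed

text \<open>A pair of non-adjacent vertices of \<open>K\<close> lies in \<open>S\<close>; with three further vertices of \<open>K\<close> it is a
  \<open>K\<^sub>5\<^sup>-\<close>, where \<open>T\<close> is contracted into the third vertex of \<open>S\<close> if that one is among them.\<close>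

lemma completed_clique:
  assumes S: "finite S" "card S \<le> 3" and K: "K \<subseteq> V" "5 \<le> card K" "clique (E \<union> S \<times> S) K"
    and T: "T \<subseteq> V" "conn E T" "T \<inter> K = {}" "\<And>s. s \<in> S \<Longrightarrow> touch E {s} T" "\<not> touch E (K - S) T"
  shows "clique E K"
proof (rule ccontr)
  assume "\<not> clique E K"
  then obtain p q where pq: "p \<in> K" "q \<in> K" "p \<noteq> q" "(p, q) \<notin> E" unfolding clique_def by blast
  then have pqS: "p \<in> S" "q \<in> S" using K(3) unfolding clique_def by blast+
  have "card (K - {p, q}) = card K - 2" using pq by (simp add: card_Diff_subset)
  then have three: "3 \<le> card (K - {p, q})" using K(2) by simp
  obtain r1 r2 r3 where r: "r1 \<in> K - {p, q}" "r2 \<in> K - {p, q}" "r3 \<in> K - {p, q}"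
    "r1 \<noteq> r2" "r1 \<noteq> r3" "r2 \<noteq> r3"
    and rS: "r2 \<notin> S" "r3 \<notin> S"
  proof -
    obtain r1 r2 r3 where r: "r1 \<in> K - {p, q}" "r2 \<in> K - {p, q}" "r3 \<in> K - {p, q}"
      "r1 \<noteq> r2" "r1 \<noteq> r3" "r2 \<noteq> r3"
      by (rule three_distinct[OF three]) (rule that)
    have two: "x = y" if "x \<in> S" "y \<in> S" "x \<notin> {p, q}" "y \<notin> {p, q}" for x y
    proof (rule ccontr)
      assume "x \<noteq> y"
      then have "card {p, q, x, y} = 4" using that pq(3) by auto
      moreover have "card {p, q, x, y} \<le> card S" using that pqS S(1) by (intro card_mono) auto
      ultimately show False using S(2) by simp
    qed
    consider "r2 \<notin> S" "r3 \<notin> S" | "r1 \<notin> S" "r3 \<notin> S" | "r1 \<notin> S" "r2 \<notin> S"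
      using two r by blast
    then show thesis using that r by cases metis+
  qed
  have e: "(x, y) \<in> E" if "x \<in> K" "y \<in> K" "x \<noteq> y" "x \<notin> S \<or> y \<notin> S" for x y
    using that K(3) unfolding clique_def by blast
  let ?R = "if r1 \<in> S then insert r1 T else {r1}"
  have dis: "x \<notin> T" if "x \<in> K" for x using that T(3) by blast
  have R: "conn E ?R"
    using conn_insert_touch[OF T(2) symE T(4)[of r1]] by simp
  have tR: "touch E {x} ?R" if "x \<in> {p, q}" for x
    using that pq r T(4)[of x] pqS e[of x r1] by (auto simp: touch_def)
  have tR': "touch E ?R {x}" if "x \<in> {r2, r3}" for x
    using that r rS e[of r1 x] by (auto simp: touch_def)
  show False
  proof (rule no_model[of "{p}" "{q}" ?R "{r2}" "{r3}"])
    show "touch E {p} ?R" "touch E {q} ?R" "touch E ?R {r2}" "touch E ?R {r3}" "conn E ?R"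
      using tR tR' R by blast+
    show "\<not> touch E {p} {q}" "touch E {p} {r2}" "touch E {p} {r3}" "touch E {q} {r2}"
      "touch E {q} {r3}" "touch E {r2} {r3}"
      using pq r rS e by (auto simp: touch_def)
    show "{p} \<subseteq> V" "{q} \<subseteq> V" "{r2} \<subseteq> V" "{r3} \<subseteq> V" "?R \<subseteq> V" using pq r K(1) T(1) by auto
    show "{p} \<inter> {q} = {}" "{p} \<inter> {r2} = {}" "{p} \<inter> {r3} = {}" "{q} \<inter> {r2} = {}"
      "{q} \<inter> {r3} = {}" "{r2} \<inter> {r3} = {}" using pq r by auto
    show "{p} \<inter> ?R = {}" "{q} \<inter> ?R = {}" "?R \<inter> {r2} = {}" "?R \<inter> {r3} = {}"
      using pq r dis by auto
  qed simp_all
qed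

text \<open>Contracting \<open>T\<close> into \<open>z\<close> makes \<open>S\<close> a clique.\<close>

lemma side_completion:
  assumes S: "card S \<le> 3" "S \<subseteq> X" and X: "X \<subseteq> V"
    and T: "T \<subseteq> V - X" "conn E T" "\<And>s. s \<in> S \<Longrightarrow> touch E {s} T" "\<not> touch E (X - S) T"
    and z: "clique E (S - {z})"
  obtains F where "chordal X F" "E \<inter> X \<times> X \<subseteq> F" "clique F S"
    "\<And>K. K \<subseteq> X \<Longrightarrow> clique F K \<Longrightarrow> card K \<le> 4 \<or> clique E K"
proof -
  let ?E = "E \<inter> X \<times> X \<union> (S \<times> S - Id)"
  \<comment> \<open>If \<open>z\<close> is not in \<open>S\<close>, nothing is contracted:
    \<open>S\<close> is then a clique of \<open>E\<close> already.\<close>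
  let ?\<phi> = "\<lambda>x. if x = z \<and> x \<in> S then insert x T else {x}"
  have finS: "finite S" by (rule finite_subset[OF S(2) finite_subset[OF X fin]])
  have noT: "\<not> touch E {x} T" if "x \<in> X - S" for x
    using that T(4) touch_superset[of E "{x}" T "X - S" T] by auto
  have conn_T: "conn E (insert s T)" if "s \<in> S" for s
    by (rule conn_insert_touch[OF T(2) symE T(3)[OF that]])
  have "minor_model X ?E V E ?\<phi>"
    unfolding minor_model_def
  proof (intro conjI ballI impI)
    fix x assume "x \<in> X"
    then show "?\<phi> x \<subseteq> V" using X T(1) by auto
    show "conn E (?\<phi> x)" using conn_T[of x] by auto
  next
    fix x y assume xy: "x \<in> X" "y \<in> X" "x \<noteq> y"
    then show "?\<phi> x \<inter> ?\<phi> y = {}" using T(1) by auto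
    have 2: "touch E {w} T \<longleftrightarrow> w \<in> S" if "w \<in> X" for w
      using that noT[of w] T(3)[of w] by auto
    then have 1: "touch E T {w} \<longleftrightarrow> w \<in> S" if "w \<in> X" for w
      using that touch_sym[OF symE, of T] by simp
    have 3: "touch E {v} {w} \<longleftrightarrow> (v, w) \<in> E" for v w by (simp add: touch_def)
    have 4: "touch E (insert z T) {w} \<longleftrightarrow> (z, w) \<in> E \<or> touch E T {w}" for w
      by (auto simp: touch_def)
    have 5: "touch E {w} (insert z T) \<longleftrightarrow> (w, z) \<in> E \<or> touch E {w} T" for w
      by (auto simp: touch_def)
    show "touch E (?\<phi> x) (?\<phi> y) \<longleftrightarrow> (x, y) \<in> ?E"
      using xy z by (auto simp: 1 2 3 4 5 clique_def)
  qed
  then have freeX: "model_free X ?E" by (rule model_free_minor[OF model_free])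
  have graphX: "fgraph X ?E"
    using finite_subset[OF X fin] S(2) irr edge_sym by unfold_locales (auto simp: sym_def)
  have cardX: "card X < card V"
    using conn_nonempty[OF T(2)] T(1) X fin by (intro psubset_card_mono) auto
  obtain F where F: "chordal X F" "?E \<subseteq> F"
    and K: "\<And>K. K \<subseteq> X \<Longrightarrow> clique F K \<Longrightarrow> card K \<le> 4 \<or> clique ?E K"
    by (rule goodE[OF smaller[OF graphX freeX cardX]]) (rule that)
  show thesis
  proof (rule that[OF F(1)])
    show "E \<inter> X \<times> X \<subseteq> F" using F(2) by blast
    show "clique F S" using F(2) unfolding clique_def by blast
    fix K assume "K \<subseteq> X" "clique F K"
    then consider "card K \<le> 4" | "5 \<le> card K" "clique ?E K" using K[of K] by linarith
    then show "card K \<le> 4 \<or> clique E K"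
    proof cases
      case 2
      \<comment> \<open>Minimality only yields a clique of the completed graph \<open>?E\<close>;
        \<open>completed_clique\<close> shows that none of its edges is an added one.\<close>
      have "clique (E \<union> S \<times> S) K" by (rule clique_mono[OF 2(2)]) auto
      moreover have "\<not> touch E (K - S) T"
        using T(4) touch_superset[of E "K - S" T "X - S" T] \<open>K \<subseteq> X\<close> by blast
      ultimately have "clique E K"
        using \<open>K \<subseteq> X\<close> X T by (intro completed_clique[OF finS S(1) _ 2(1), of T]) auto
      then show ?thesis ..
    qed simp
  qed
qed

text \<open>Neither \<open>F\<close> nor \<open>H\<close> has an edge between \<open>A\<close> and
  \<open>B\<close>, so a clique of the union lies on one side. There the other supergraph
  contributes only pairs inside \<open>S\<close>, which are present anyway as \<open>S\<close> is a
  clique in both.\<close>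

lemma glue_sides:
  assumes V: "V = A \<union> S \<union> B" "A \<inter> S = {}" "A \<inter> B = {}" "S \<inter> B = {}"
    and F: "chordal (A \<union> S) F" "E \<inter> (A \<union> S) \<times> (A \<union> S) \<subseteq> F" "clique F S"
      "\<And>K. K \<subseteq> A \<union> S \<Longrightarrow> clique F K \<Longrightarrow> card K \<le> 4 \<or> clique E K"
    and H: "chordal (B \<union> S) H" "E \<inter> (B \<union> S) \<times> (B \<union> S) \<subseteq> H" "clique H S"
      "\<And>K. K \<subseteq> B \<union> S \<Longrightarrow> clique H K \<Longrightarrow> card K \<le> 4 \<or> clique E K"
    and AB: "\<not> touch E A B"
  shows False
proof -
  interpret F: fgraph "A \<union> S" F by (rule chordal_fgraph) fact
  interpret H: fgraph "B \<union> S" H by (rule chordal_fgraph) fact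
  have cap: "(A \<union> S) \<inter> (B \<union> S) = S" using V by auto
  have "good V E"
    unfolding good_def
  proof (intro exI conjI allI impI)
    have "chordal ((A \<union> S) \<union> (B \<union> S)) (F \<union> H)"
      by (rule chordal_glue) (use F H cap in auto)
    moreover have "(A \<union> S) \<union> (B \<union> S) = V" using V(1) by blast
    ultimately show "chordal V (F \<union> H)" by simp
    show "E \<subseteq> F \<union> H"
    proof (rule subrelI)
      fix x y assume xy: "(x, y) \<in> E"
      then have "x \<in> A \<union> S \<union> B" "y \<in> A \<union> S \<union> B" using sub V(1) by blast+
      moreover have "\<not> (x \<in> A \<and> y \<in> B)" "\<not> (y \<in> A \<and> x \<in> B)"
        using AB xy edge_sym[OF xy] unfolding touch_def by blast+
      ultimately have "(x, y) \<in> E \<inter> (A \<union> S) \<times> (A \<union> S) \<or> (x, y) \<in> E \<inter> (B \<union> S) \<times> (B \<union> S)"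
        using xy by auto
      then show "(x, y) \<in> F \<union> H" using F(2) H(2) by blast
    qed
    fix K assume K: "K \<subseteq> V \<and> clique (F \<union> H) K"
    then have KFH: "clique (F \<union> H) K" ..
    have "\<not> (x \<in> A \<and> y \<in> B)" if "x \<in> K" "y \<in> K" for x y
    proof
      assume xy: "x \<in> A \<and> y \<in> B"
      then have ne: "x \<noteq> y" "x \<notin> B \<union> S" "y \<notin> A \<union> S" using V by auto
      have "(x, y) \<in> F \<or> (x, y) \<in> H" using that ne(1) KFH unfolding clique_def by blast
      then show False using ne(2,3) F.sub H.sub by blast
    qed
    then consider "K \<subseteq> A \<union> S" | "K \<subseteq> B \<union> S" using K V(1) by blast
    then show "card K \<le> 4 \<or> clique E K"
    proof cases
      case 1
      have "clique F K"
        unfolding clique_def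
      proof (intro ballI impI)
        fix x y assume xy: "x \<in> K" "y \<in> K" "x \<noteq> y"
        then have "(x, y) \<in> F \<or> (x, y) \<in> H" using KFH unfolding clique_def by blast
        moreover have "x \<in> S \<and> y \<in> S" if "(x, y) \<in> H" using that H.sub xy 1 cap by blast
        ultimately show "(x, y) \<in> F" using F(3) xy unfolding clique_def by blast
      qed
      then show ?thesis using F(4)[OF 1] by blast
    next
      case 2
      have "clique H K"
        unfolding clique_def
      proof (intro ballI impI)
        fix x y assume xy: "x \<in> K" "y \<in> K" "x \<noteq> y"
        then have "(x, y) \<in> F \<or> (x, y) \<in> H" using KFH unfolding clique_def by blast
        moreover have "x \<in> S \<and> y \<in> S" if "(x, y) \<in> F" using that F.sub xy 2 cap by blast
        ultimately show "(x, y) \<in> H" using H(3) xy unfolding clique_def by blast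
      qed
      then show ?thesis using H(4)[OF 2] by blast
    qed
  qed
  then show False using not_good by blast
qed

text \<open>Each side is completed by contracting a connected set of the opposite side.
  \<open>B\<close> may be disconnected, so a connected part \<open>C\<close> that touches all of
  \<open>S\<close> takes its role.\<close>

lemma no_separation:
  assumes V: "V = A \<union> S \<union> B" "A \<inter> S = {}" "A \<inter> B = {}" "S \<inter> B = {}"
    and A: "conn E A" "\<And>s. s \<in> S \<Longrightarrow> touch E {s} A"
    and B: "C \<subseteq> B" "conn E C" "\<And>s. s \<in> S \<Longrightarrow> touch E {s} C"
    and AB: "\<not> touch E A B" and S: "card S \<le> 3" "clique E (S - {z})"
  shows False
proof -
  have BA: "\<not> touch E (B \<union> S - S) A" "\<not> touch E (A \<union> S - S) C"
    using AB touch_superset[of E "B \<union> S - S" A B A] touch_superset[of E "A \<union> S - S" C A B] B(1)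
      touch_sym[OF symE, of A B] by blast+
  obtain F where F: "chordal (A \<union> S) F" "E \<inter> (A \<union> S) \<times> (A \<union> S) \<subseteq> F" "clique F S"
      "\<And>K. K \<subseteq> A \<union> S \<Longrightarrow> clique F K \<Longrightarrow> card K \<le> 4 \<or> clique E K"
    by (rule side_completion[of S "A \<union> S" C z]) (use V A B BA S in auto)
  obtain H where H: "chordal (B \<union> S) H" "E \<inter> (B \<union> S) \<times> (B \<union> S) \<subseteq> H" "clique H S"
      "\<And>K. K \<subseteq> B \<union> S \<Longrightarrow> clique H K \<Longrightarrow> card K \<le> 4 \<or> clique E K"
    by (rule side_completion[of S "B \<union> S" A z]) (use V A B BA S in auto)
  show False by (rule glue_sides[OF V F H AB])
qed

section \<open>Connectivity of a minimal counterexample\<close>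

lemma minimal_separator_not_small:
  assumes X: "X \<noteq> {}" "X \<subseteq> V" "X \<union> nbrs E X \<noteq> V"
    and mn: "\<And>Y. Y \<noteq> {} \<Longrightarrow> Y \<subseteq> V \<Longrightarrow> Y \<union> nbrs E Y \<noteq> V \<Longrightarrow> card (nbrs E X) \<le> card (nbrs E Y)"
    and S: "card (nbrs E X) \<le> 3" "clique E (nbrs E X - {z})"
  shows False
proof -
  let ?S = "nbrs E X"
  \<comment> \<open>By minimality, a neighbourhood that separates cannot lie properly inside
    \<open>?S\<close>. Hence the components \<open>A\<close> within \<open>X\<close> and
    \<open>C\<close> beyond \<open>?S\<close> are both attached to all of \<open>?S\<close>.\<close>
  have full: "nbrs E Y = ?S" if "Y \<noteq> {}" "Y \<subseteq> V" "Y \<union> nbrs E Y \<noteq> V" "nbrs E Y \<subseteq> ?S" for Y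
    using mn[OF that(1,2,3)] that(4) finite_nbrs by (intro card_seteq) auto
  obtain A where A: "conn E A" "A \<subseteq> X" "nbrs E A \<inter> X = {}"
    using component_in X by blast
  have AS: "nbrs E A \<subseteq> ?S" using A(2,3) unfolding nbrs_def by blast
  have SX: "?S \<inter> X = {}" unfolding nbrs_def by blast
  have "A \<union> nbrs E A \<noteq> V" using A(2) AS X nbrs_subset[of X] by blast
  then have nA: "nbrs E A = ?S" using full[of A] conn_nonempty[OF A(1)] A(2) X(2) AS by blast
  let ?B = "V - A - ?S"
  have "?B \<noteq> {}" using X A(2) nbrs_subset[of X] by blast
  then obtain C where C: "conn E C" "C \<subseteq> ?B" "nbrs E C \<inter> ?B = {}"
    using component_in[of ?B] by blast
  have AB: "\<not> touch E A ?B" by (rule no_touch_outside) (auto simp: nA)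
  have "nbrs E C \<inter> A = {}"
  proof (rule ccontr)
    assume "nbrs E C \<inter> A \<noteq> {}"
    then obtain a where "a \<in> A" "touch E {a} C" using touch_nbrs by blast
    then have "touch E A ?B" using C(2) touch_superset[of E "{a}" C A ?B] by blast
    then show False using AB by blast
  qed
  then have "nbrs E C \<subseteq> ?S" using C(3) nbrs_subset[of C] by blast
  moreover have "C \<union> nbrs E C \<noteq> V"
    using conn_nonempty[OF A(1)] C(2) \<open>nbrs E C \<inter> A = {}\<close> A(2) X(2) by blast
  ultimately have nC: "nbrs E C = ?S" using full[of C] conn_nonempty[OF C(1)] C(2) by blast
  show False
  proof (rule no_separation[of A ?S ?B C z])
    show "V = A \<union> ?S \<union> ?B" using A(2) X(2) nbrs_subset[of X] by blast
    show "A \<inter> ?S = {}" using A(2) SX by blast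
    show "touch E {s} A" if "s \<in> ?S" for s using touch_nbrs[of s A] nA that by simp
    show "touch E {s} C" if "s \<in> ?S" for s using touch_nbrs[of s C] nC that by simp
  qed (use A C AB S in auto)
qed

text \<open>A separator is encoded as the neighbourhood of a set that together with it does not
  exhaust \<open>V\<close>. If one of minimum size has at most two vertices, removing one leaves at
  most a single vertex, trivially a clique.\<close>

lemma three_connected:
  assumes "X \<noteq> {}" "X \<subseteq> V" "X \<union> nbrs E X \<noteq> V"
  shows "3 \<le> card (nbrs E X)"
proof (rule ccontr)
  let ?P = "\<lambda>Y. Y \<noteq> {} \<and> Y \<subseteq> V \<and> Y \<union> nbrs E Y \<noteq> V"
  assume neg: "\<not> 3 \<le> card (nbrs E X)"
  obtain Y where Y: "?P Y" and mn: "\<And>Z. ?P Z \<Longrightarrow> card (nbrs E Y) \<le> card (nbrs E Z)"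
    using ex_has_least_nat[of ?P X "\<lambda>Y. card (nbrs E Y)"] assms by auto
  have le: "card (nbrs E Y) \<le> 2" using mn[of X] assms neg by auto
  obtain z where z: "nbrs E Y = {} \<or> z \<in> nbrs E Y" by blast
  have "card (nbrs E Y - {z}) \<le> 1"
    using z le finite_nbrs[of Y] by (auto simp: card_Diff_singleton)
  then have "clique E (nbrs E Y - {z})"
    using finite_nbrs[of Y] unfolding clique_def by (metis card_le_Suc0_iff_eq finite_Diff One_nat_def)
  then show False
    using minimal_separator_not_small[of Y z] Y mn le by auto
qed

text \<open>An edge \<open>pq\<close> is a clique that remains after removing the third vertex
  \<open>z\<close>, and \<open>three_connected\<close> makes size three the minimum, so the
  separator could be completed.\<close>

lemma independent_separator:
  assumes "X \<noteq> {}" "X \<subseteq> V" "X \<union> nbrs E X \<noteq> V" "card (nbrs E X) = 3"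
    and pq: "p \<in> nbrs E X" "q \<in> nbrs E X"
  shows "(p, q) \<notin> E"
proof
  assume e: "(p, q) \<in> E"
  have "p \<noteq> q" using e irr by auto
  then have "card (nbrs E X - {p, q}) = 1"
    using assms(4) pq finite_nbrs[of X] by (simp add: card_Diff_subset)
  then obtain z where z: "nbrs E X - {p, q} = {z}" by (meson card_1_singletonE)
  then have "nbrs E X - {z} = {p, q}" using pq by blast
  moreover have "clique E {p, q}" using e edge_sym[OF e] by (simp add: clique_def)
  ultimately have "clique E (nbrs E X - {z})" by simp
  then show False
    using minimal_separator_not_small[of X z] three_connected assms by simp
qed

text \<open>Contracting \<open>u\<close> and \<open>z\<close> into different vertices of \<open>S\<close> makes \<open>S\<close> a clique.\<close>

lemma no_twins:
  assumes uz: "u \<in> V" "z \<in> V" "u \<noteq> z" and N: "nbrs E {u} = S" "nbrs E {z} = S" "card S = 3"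
  shows False
proof -
  obtain a b c where S: "S = {a, b, c}" "a \<noteq> b" "a \<noteq> c" "b \<noteq> c"
    using N(3) by (auto simp: card_3_iff)
  let ?X = "V - {u, z}"
  let ?E = "E \<inter> ?X \<times> ?X \<union> (S \<times> S - Id)"
  let ?\<phi> = "\<lambda>x. if x = a then {a, u} else if x = b then {b, z} else {x}"
  have u: "(u, w) \<in> E \<longleftrightarrow> w \<in> S" "(w, u) \<in> E \<longleftrightarrow> w \<in> S" for w
    using N(1) nbrs_singleton[of w u] edge_commute[of w u] by auto
  have z: "(z, w) \<in> E \<longleftrightarrow> w \<in> S" "(w, z) \<in> E \<longleftrightarrow> w \<in> S" for w
    using N(2) nbrs_singleton[of w z] edge_commute[of w z] by auto
  have uzS: "u \<notin> S" "z \<notin> S" using u z irr by blast+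
  have SX: "S \<subseteq> ?X" using nbrs_subset[of "{u}"] N(1) uzS by auto
  have model: "minor_model ?X ?E V E ?\<phi>"
    unfolding minor_model_def
  proof (intro conjI ballI impI)
    fix x assume x: "x \<in> ?X"
    then show "?\<phi> x \<subseteq> V" using uz by auto
    have "conn E {a, u}" "conn E {b, z}"
      using u z S by (intro conn_insert_touch[OF conn_singleton symE]; simp)+
    then show "conn E (?\<phi> x)" by simp
  next
    fix x y assume xy: "x \<in> ?X" "y \<in> ?X" "x \<noteq> y"
    then show "?\<phi> x \<inter> ?\<phi> y = {}" using uz uzS S by auto
    have "touch E (?\<phi> x) (?\<phi> y) \<longleftrightarrow>
        (x, y) \<in> E \<or> x \<in> {a, b} \<and> y \<in> S \<or> y \<in> {a, b} \<and> x \<in> S"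
      using xy uz uzS S(2) by (auto simp: touch_def u z)
    then show "touch E (?\<phi> x) (?\<phi> y) \<longleftrightarrow> (x, y) \<in> ?E"
      using xy S by auto
  qed
  have "fgraph ?X ?E"
    using fin SX irr edge_sym by unfold_locales (auto simp: sym_def)
  moreover have "card ?X < card V" using fin uz by (intro psubset_card_mono) auto
  ultimately have "good ?X ?E" using model_free_minor[OF model_free model] by (intro smaller)
  then obtain F where F: "chordal ?X F" "?E \<subseteq> F"
    and K: "\<And>K. K \<subseteq> ?X \<Longrightarrow> clique F K \<Longrightarrow> card K \<le> 4 \<or> clique ?E K"
    by (rule goodE) (rule that)
  interpret F: fgraph ?X F by (rule chordal_fgraph) fact
  \<comment> \<open>The contracted vertices come back as simplicial vertices attached to the clique
    \<open>S\<close>, so cliques through them have at most four vertices.\<close>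
  let ?F = "(F \<union> {z} \<times> S \<union> S \<times> {z}) \<union> {u} \<times> S \<union> S \<times> {u}"
  have FS: "clique F S" using F(2) unfolding clique_def by blast
  have z_added: "chordal (insert z ?X) (F \<union> {z} \<times> S \<union> S \<times> {z})"
    by (rule chordal.add[OF F(1)]) (use SX FS in auto)
  have "clique (F \<union> {z} \<times> S \<union> S \<times> {z}) S" by (rule clique_mono[OF FS]) auto
  then have "chordal (insert u (insert z ?X)) ?F"
    by (rule chordal.add[OF z_added, rotated 2]) (use SX uz in auto)
  moreover have "insert u (insert z ?X) = V" using uz by blast
  ultimately have ch: "chordal V ?F" by simp
  have "good V E"
    unfolding good_def
  proof (intro exI conjI allI impI)
    show "chordal V ?F" by fact
    show "E \<subseteq> ?F"
    proof (rule subrelI)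
      fix x y assume xy: "(x, y) \<in> E"
      then have "x \<in> V" "y \<in> V" using sub by auto
      show "(x, y) \<in> ?F"
      proof (cases "x \<in> {u, z} \<or> y \<in> {u, z}")
        case True
        then show ?thesis using xy by (auto simp: u z)
      next
        case False
        then have "(x, y) \<in> ?E" using xy \<open>x \<in> V\<close> \<open>y \<in> V\<close> by blast
        then show ?thesis using F(2) by blast
      qed
    qed
    fix K assume KV: "K \<subseteq> V \<and> clique ?F K"
    have Fu: "?F `` {u} \<subseteq> S" "?F `` {z} \<subseteq> S" using F.sub uz uzS by auto
    have small: "card K \<le> 4" if "w \<in> K" "?F `` {w} \<subseteq> S" for w
    proof -
      have "K \<subseteq> insert w (?F `` {w})" by (rule clique_subset_nbrs) (use KV that in auto)
      then have "K \<subseteq> insert w S" using that(2) by auto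
      then have "card K \<le> card (insert w S)" using S(1) by (intro card_mono) auto
      also have "\<dots> \<le> 4" using N(3) S(1) by (simp add: card_insert_if)
      finally show ?thesis .
    qed
    show "card K \<le> 4 \<or> clique E K"
    proof (cases "u \<in> K \<or> z \<in> K")
      case True
      then show ?thesis using small Fu by blast
    next
      case False
      then have KX: "K \<subseteq> ?X" using KV by blast
      have "clique F K"
        unfolding clique_def
      proof (intro ballI impI)
        fix x y assume "x \<in> K" "y \<in> K" "x \<noteq> y"
        then have "(x, y) \<in> ?F" using KV by (auto simp: clique_def)
        then show "(x, y) \<in> F" using \<open>x \<in> K\<close> \<open>y \<in> K\<close> False by auto
      qed
      then consider "card K \<le> 4" | "5 \<le> card K" "clique ?E K" using K[OF KX] by linarith
      then show ?thesis
      proof cases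
        case 2
        have "clique (E \<union> S \<times> S) K" by (rule clique_mono[OF 2(2)]) auto
        moreover have "\<not> touch E (K - S) {u}" using u unfolding touch_def by blast
        ultimately have "clique E K"
          using S(1) N(3) KX 2(1) uz u False
          by (intro completed_clique[of S K "{u}"]) auto
        then show ?thesis ..
      qed simp
    qed
  qed
  then show False using not_good by blast
qed

section \<open>Clique number and minimum degree\<close>

lemma clique_le_4:
  assumes "K \<subseteq> V" "clique E K"
  shows "card K \<le> 4"
proof (rule ccontr)
  assume neg: "\<not> card K \<le> 4"
  obtain L where L: "L \<subseteq> V \<and> clique E L" "K \<subseteq> L"
    and mx: "\<And>L'. L' \<subseteq> V \<and> clique E L' \<Longrightarrow> L \<subseteq> L' \<Longrightarrow> L' = L"
    by (rule maximal_subset_exists[OF fin, of "\<lambda>L. L \<subseteq> V \<and> clique E L" K])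
      (simp add: assms, blast, rule that)
  have finL: "finite L" by (rule finite_subset[OF _ fin]) (use L(1) in blast)
  have cardL: "5 \<le> card L" using card_mono[OF finL L(2)] neg by simp
  let ?X = "V - L"
  have "?X \<noteq> {}" using not_clique L(1) by (metis Diff_eq_empty_iff subset_antisym)
  then obtain C where C: "conn E C" "C \<subseteq> ?X" "nbrs E C \<inter> ?X = {}"
    using component_in[of ?X] by blast
  have "3 \<le> card (nbrs E C \<inter> L)"
  proof (cases "C \<union> nbrs E C = V")
    case True
    then have "L \<subseteq> nbrs E C \<inter> L" using C(2) L(1) by blast
    then have "card L \<le> card (nbrs E C \<inter> L)" using finL by (intro card_mono) auto
    then show ?thesis using cardL by simp
  next
    case False
    have "nbrs E C \<inter> L = nbrs E C" using C(3) nbrs_subset[of C] by blast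
    then show ?thesis
      using three_connected[OF conn_nonempty[OF C(1)] _ False] C(2) by auto
  qed
  then have P: "conn E C \<and> C \<subseteq> ?X \<and> 3 \<le> card (nbrs E C \<inter> L)" using C by blast
  \<comment> \<open>\<open>D\<close> is a smallest connected set outside the maximal clique
    \<open>L\<close> that sees three vertices of \<open>L\<close>. It cannot miss any
    \<open>k\<close> of \<open>L\<close>, since \<open>D\<close>, \<open>k\<close> and three seen
    vertices would form a \<open>K5_minus\<close>. If it is a single vertex seeing all of
    \<open>L\<close>, then \<open>L\<close> was not maximal.\<close>
  obtain D where D: "conn E D" "D \<subseteq> ?X" "3 \<le> card (nbrs E D \<inter> L)"
    and mn: "\<And>C. conn E C \<Longrightarrow> C \<subseteq> ?X \<Longrightarrow> 3 \<le> card (nbrs E C \<inter> L) \<Longrightarrow> card D \<le> card C"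
    using ex_has_least_nat[of "\<lambda>C. conn E C \<and> C \<subseteq> ?X \<and> 3 \<le> card (nbrs E C \<inter> L)" C card] P by blast
  have finD: "finite D" using finite_subset[OF D(2)] fin by simp
  show False
  proof (cases "L \<subseteq> nbrs E D")
    case True
    show False
    proof (cases "2 \<le> card D")
      case False
      then have "card D = 1"
        using conn_nonempty[OF D(1)] finD card_gt_0_iff[of D] by linarith
      then obtain d where d: "D = {d}" by (meson card_1_singletonE)
      have "clique E (insert d L)"
        using True L(1) edge_sym unfolding d clique_def by (auto simp: subset_iff nbrs_singleton)
      then have "insert d L = L" using mx[of "insert d L"] L(1) D(2) d by auto
      then show False using D(2) d by auto
    next
      case 2: True
      \<comment> \<open>Both parts of \<open>D\<close> are connected and smaller, so each sees at
        most two vertices of \<open>L\<close>; but together they see all of its at least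
        five.\<close>
      obtain d where d: "d \<in> D" "conn E (D - {d})" by (rule noncut_vertex[OF finD D(1) symE 2])
      have lt: "card (D - {d}) < card D" "card {d} < card D"
        using d(1) finD 2 by (auto simp: card_Diff_singleton)
      have 1: "card (nbrs E (D - {d}) \<inter> L) \<le> 2"
        using mn[OF d(2)] D(2) lt(1) by force
      have 2: "card (nbrs E {d} \<inter> L) \<le> 2"
        using mn[OF conn_singleton, of d] D(2) d(1) lt(2) by force
      have "L \<subseteq> (nbrs E (D - {d}) \<inter> L) \<union> (nbrs E {d} \<inter> L)"
        using True D(2) unfolding nbrs_def by blast
      then have "card L \<le> card ((nbrs E (D - {d}) \<inter> L) \<union> (nbrs E {d} \<inter> L))"
        using finL by (intro card_mono) auto
      also have "\<dots> \<le> card (nbrs E (D - {d}) \<inter> L) + card (nbrs E {d} \<inter> L)" by (rule card_Un_le)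
      finally show False using 1 2 cardL by simp
    qed
  next
    case False
    then obtain k where k: "k \<in> L" "k \<notin> nbrs E D" by blast
    obtain r1 r2 r3 where r: "r1 \<in> nbrs E D \<inter> L" "r2 \<in> nbrs E D \<inter> L" "r3 \<in> nbrs E D \<inter> L"
      "r1 \<noteq> r2" "r1 \<noteq> r3" "r2 \<noteq> r3" by (rule three_distinct[OF D(3)]) (rule that)
    have kr: "k \<noteq> r1" "k \<noteq> r2" "k \<noteq> r3" using k(2) r by auto
    have e: "(x, y) \<in> E" if "x \<in> L" "y \<in> L" "x \<noteq> y" for x y
      using L(1) that unfolding clique_def by blast
    have t: "touch E D {x}" if "x \<in> nbrs E D \<inter> L" for x
      using touch_nbrs[of x D] that touch_sym[OF symE] by blast
    have "\<not> touch E D {k}"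
      by (rule no_touch_outside) (use k D(2) in auto)
    then show False
      by (intro no_model[of D "{k}" "{r1}" "{r2}" "{r3}"]) (use D k r kr e t L(1) in auto)
  qed
qed

lemma deg_ge_3: "v \<in> V \<Longrightarrow> 3 \<le> card (nbrs E {v})"
proof (cases "{v} \<union> nbrs E {v} = V")
  case True
  have "card V \<le> Suc (card (nbrs E {v}))"
    using arg_cong[OF True, of card] finite_nbrs[of "{v}"] by (simp add: card_insert_if split: if_splits)
  then show ?thesis using card_V by simp
qed (auto intro: three_connected)

text \<open>With at least five vertices in total, a neighbourhood of size three is a
  separator.\<close>

lemma deg3_independent:
  assumes "v \<in> V" "card (nbrs E {v}) = 3" "p \<in> nbrs E {v}" "q \<in> nbrs E {v}"
  shows "(p, q) \<notin> E"
proof -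
  have "card ({v} \<union> nbrs E {v}) \<le> 4" using card_Un_le[of "{v}" "nbrs E {v}"] assms(2) by simp
  then have "card ({v} \<union> nbrs E {v}) \<noteq> card V" using card_V by linarith
  then have "{v} \<union> nbrs E {v} \<noteq> V" by metis
  then show ?thesis using independent_separator[of "{v}"] assms by auto
qed

end

section \<open>A vertex of degree three\<close>

context critical
begin

definition contracted :: "'a \<Rightarrow> 'a \<Rightarrow> 'a rel" where
  "contracted x y = {(p, q). p \<in> V - {y} \<and> q \<in> V - {y} \<and> p \<noteq> q \<and>
     ((p, q) \<in> E \<or> p = x \<and> (y, q) \<in> E \<or> q = x \<and> (y, p) \<in> E)}"

lemma contracted_good:
  assumes "(x, y) \<in> E"
  shows "good (V - {y}) (contracted x y)"
proof (rule smaller)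
  have xy: "x \<in> V" "y \<in> V" "x \<noteq> y" using assms sub irr by auto
  show "fgraph (V - {y}) (contracted x y)"
    using fin by unfold_locales (auto simp: contracted_def sym_def edge_commute)
  show "card (V - {y}) < card V" using fin xy by (intro psubset_card_mono) auto
  have "minor_model (V - {y}) (contracted x y) V E (\<lambda>p. if p = x then {x, y} else {p})"
    unfolding minor_model_def
  proof (intro conjI ballI impI)
    fix p assume p: "p \<in> V - {y}"
    then show "(if p = x then {x, y} else {p}) \<subseteq> V" using xy by auto
    have "conn E {x, y}" using assms by (intro conn_insert_touch[OF conn_singleton symE]) simp
    then show "conn E (if p = x then {x, y} else {p})" by simp
  next
    fix p q assume pq: "p \<in> V - {y}" "q \<in> V - {y}" "p \<noteq> q"
    then show "(if p = x then {x, y} else {p}) \<inter> (if q = x then {x, y} else {q}) = {}" by auto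
    show "touch E (if p = x then {x, y} else {p}) (if q = x then {x, y} else {q}) \<longleftrightarrow>
        (p, q) \<in> contracted x y"
      using pq edge_commute[of p y] by (auto simp: touch_def contracted_def)
  qed
  then show "model_free (V - {y}) (contracted x y)" by (rule model_free_minor[OF model_free])
qed

text \<open>A vertex seeing all of \<open>R\<close> would extend it to a clique of size five. One
  that sees three vertices of \<open>R\<close> but misses a fourth forms a \<open>K5_minus\<close>
  with these four.\<close>

lemma clique_extension_bound:
  assumes R: "R \<subseteq> V" "clique E R" "4 \<le> card R" and v: "v \<in> V" "v \<notin> R"
  shows "card {r \<in> R. (v, r) \<in> E} \<le> 2"
proof (rule ccontr)
  assume neg: "\<not> card {r \<in> R. (v, r) \<in> E} \<le> 2"
  have finR: "finite R" by (rule finite_subset[OF R(1) fin])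
  show False
  proof (cases "\<forall>r\<in>R. (v, r) \<in> E")
    case True
    moreover from this have "\<forall>r\<in>R. (r, v) \<in> E" using edge_sym by blast
    ultimately have "clique E (insert v R)" using R(2) by (auto simp: clique_def)
    then have "card (insert v R) \<le> 4" using clique_le_4[of "insert v R"] R(1) v by auto
    then show False using R(3) v(2) finR by simp
  next
    case False
    then obtain k where k: "k \<in> R" "(v, k) \<notin> E" by blast
    have three: "3 \<le> card {r \<in> R. (v, r) \<in> E}" using neg by simp
    obtain a b c where abc: "a \<in> {r \<in> R. (v, r) \<in> E}" "b \<in> {r \<in> R. (v, r) \<in> E}"
      "c \<in> {r \<in> R. (v, r) \<in> E}" "a \<noteq> b" "a \<noteq> c" "b \<noteq> c"
      by (rule three_distinct[OF three]) (rule that)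
    have e: "(x, y) \<in> E" if "x \<in> R" "y \<in> R" "x \<noteq> y" for x y
      using R(2) that unfolding clique_def by blast
    have "k \<noteq> a" "k \<noteq> b" "k \<noteq> c" using k abc by auto
    then show False
      using k abc e v R(1) by (intro no_model[of "{v}" "{k}" "{a}" "{b}" "{c}"]) auto
  qed
qed

text \<open>In a clique of size five through the contracted vertex, \<open>x\<close> and
  \<open>y\<close> each see at most two of the other vertices, hence exactly two, disjointly:
  \<open>p\<close>, \<open>q\<close> and \<open>r\<close>, \<open>s\<close>. Then \<open>x\<close>
  and \<open>r\<close> are the nonadjacent pair of a \<open>K5_minus\<close> with \<open>p\<close>,
  \<open>q\<close> and \<open>{y, s}\<close>.\<close>

lemma contracted_clique_le_4:
  assumes xy: "(x, y) \<in> E" and K: "K \<subseteq> V - {y}" "clique (contracted x y) K"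
  shows "card K \<le> 4"
proof (rule ccontr)
  assume neg: "\<not> card K \<le> 4"
  have V: "x \<in> V" "y \<in> V" "x \<noteq> y" using xy sub irr by auto
  have e: "(p, q) \<in> contracted x y" if "p \<in> K" "q \<in> K" "p \<noteq> q" for p q
    using K(2) that unfolding clique_def by blast
  show False
  proof (cases "x \<in> K")
    case False
    then have "clique E K" using e by (auto simp: clique_def contracted_def)
    then show False using clique_le_4[of K] K(1) neg by auto
  next
    case True
    let ?R = "K - {x}"
    have finK: "finite K" using finite_subset[OF K(1)] fin by simp
    have R: "?R \<subseteq> V" "4 \<le> card ?R" "x \<notin> ?R" "y \<notin> ?R"
      using K(1) neg True finK by (auto simp: card_Diff_singleton)
    have cR: "clique E ?R"
      unfolding clique_def
    proof (intro ballI impI)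
      fix p q assume "p \<in> ?R" "q \<in> ?R" "p \<noteq> q"
      then show "(p, q) \<in> E" using e[of p q] by (auto simp: contracted_def)
    qed
    have eR: "(p, q) \<in> E" if "p \<in> ?R" "q \<in> ?R" "p \<noteq> q" for p q
      using cR that unfolding clique_def by blast
    define X Y where XY: "X = {r \<in> ?R. (x, r) \<in> E}" "Y = {r \<in> ?R. (y, r) \<in> E}"
    have le: "card X \<le> 2" "card Y \<le> 2"
      using clique_extension_bound[OF R(1) cR R(2)] V R(3,4) by (auto simp: XY)
    have RXY: "?R \<subseteq> X \<union> Y"
    proof
      fix r assume r: "r \<in> ?R"
      then have "(x, r) \<in> contracted x y" using e[of x r] True by auto
      then show "r \<in> X \<union> Y" using r by (auto simp: contracted_def XY)
    qed
    have fR: "finite X" "finite Y" using finK by (auto simp: XY)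
    have "card ?R \<le> card (X \<union> Y)" using RXY fR by (intro card_mono) auto
    moreover have "card (X \<union> Y) + card (X \<inter> Y) = card X + card Y"
      using card_Un_Int[OF fR] by simp
    ultimately have 2: "card X = 2" "card Y = 2" "card (X \<inter> Y) = 0"
      using le R(2) by linarith+
    obtain p q where pq: "X = {p, q}" "p \<noteq> q" using 2(1) by (auto simp: card_2_iff)
    obtain r s where rs: "Y = {r, s}" "r \<noteq> s" using 2(2) by (auto simp: card_2_iff)
    have dis: "X \<inter> Y = {}" using 2(3) fR(1) by (metis card_0_eq finite_Int)
    have ne: "p \<noteq> r" "p \<noteq> s" "q \<noteq> r" "q \<noteq> s" using dis unfolding pq(1) rs(1) by auto
    have "p \<in> X" "q \<in> X" "r \<in> Y" "s \<in> Y" unfolding pq(1) rs(1) by auto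
    then have pR: "p \<in> ?R" "(x, p) \<in> E" "q \<in> ?R" "(x, q) \<in> E"
      and rR: "r \<in> ?R" "(y, r) \<in> E" "s \<in> ?R" "(y, s) \<in> E" by (simp_all add: XY)
    have xr: "(x, r) \<notin> E"
    proof
      assume "(x, r) \<in> E"
      then have "r \<in> X \<inter> Y" using rR by (simp add: XY)
      then show False using dis by simp
    qed
    have "conn E {y, s}" using rR by (intro conn_insert_touch[OF conn_singleton symE]) simp
    moreover have "touch E {x} {y, s}" "touch E {r} {y, s}" "touch E {p} {y, s}" "touch E {q} {y, s}"
      using xy rR pR ne rs(2) eR edge_sym[OF rR(2)] by (auto simp: touch_def)
    ultimately show False
      using xr pR rR ne rs(2) pq(2) eR V R
      by (intro no_model[of "{x}" "{r}" "{p}" "{q}" "{y, s}"]) (auto simp: edge_commute)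
  qed
qed

text \<open>\<open>W\<close> shields \<open>X\<close> from \<open>C\<close>, so the neighbourhood of
  \<open>C\<close> separates and three-connectivity applies to it.\<close>

lemma component_outside:
  assumes X: "X \<subseteq> V" "X \<noteq> {}" and W: "X \<union> W \<noteq> V" "W \<subseteq> V" "nbrs E X \<subseteq> W"
  obtains C where "conn E C" "C \<subseteq> V - X - W" "nbrs E C \<subseteq> W" "3 \<le> card (nbrs E C)"
proof -
  have "V - X - W \<noteq> {}" using X W by blast
  then obtain C where C: "conn E C" "C \<subseteq> V - X - W" "nbrs E C \<inter> (V - X - W) = {}"
    using component_in[of "V - X - W"] by blast
  have "nbrs E C \<inter> X = {}"
  proof (rule ccontr)
    assume "nbrs E C \<inter> X \<noteq> {}"
    then obtain x c where "x \<in> X" "c \<in> C" "(x, c) \<in> E"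
      using edge_sym unfolding nbrs_def by blast
    then have "c \<in> nbrs E X" using C(2) by (intro nbrsI[of x]) auto
    then show False using \<open>c \<in> C\<close> C(2) W(3) by blast
  qed
  moreover have "C \<union> nbrs E C \<noteq> V" using calculation C(2) X by blast
  ultimately show thesis
    using that C three_connected[of C] conn_nonempty[OF C(1)] nbrs_subset[of C] by blast
qed

section \<open>Excluding minimum degree four\<close>

lemma card_ge_6:
  assumes "\<forall>v\<in>V. 4 \<le> card (nbrs E {v})"
  shows "6 \<le> card V"
proof (rule ccontr)
  assume "\<not> 6 \<le> card V"
  then have 5: "card V = 5" using card_V by simp
  have "nbrs E {v} = V - {v}" if "v \<in> V" for v
  proof (rule card_seteq)
    show "nbrs E {v} \<subseteq> V - {v}" using nbrs_subset[of "{v}"] by (auto simp: nbrs_def)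
    show "card (V - {v}) \<le> card (nbrs E {v})" using assms 5 fin that by simp
  qed (use fin in simp)
  then have "clique E V" by (auto simp: clique_def nbrs_singleton[symmetric])
  then show False using not_clique by simp
qed

text \<open>Contracting \<open>xy\<close> creates no clique of size five, so the chordal supergraph
  of the contraction has clique number at most four and its simplicial vertices have degree at most
  three there. Two of them exist, and in \<open>E\<close> each had degree at least four.\<close>

lemma adjacent_common_nbrs:
  assumes deg_all: "\<forall>v\<in>V. 4 \<le> card (nbrs E {v})" and xy: "(x, y) \<in> E"
  obtains s t where "s \<noteq> t" "(x, s) \<in> E" "(y, s) \<in> E" "(x, t) \<in> E" "(y, t) \<in> E"
    "card (nbrs E {s}) = 4" "card (nbrs E {t}) = 4"
proof -
  have deg: "4 \<le> card (nbrs E {v})" if "v \<in> V" for v using deg_all that by blast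
  have V: "x \<in> V" "y \<in> V" "x \<noteq> y" using xy sub irr by auto
  have card6: "6 \<le> card V" by (rule card_ge_6[OF deg_all])
  let ?X = "V - {y}" and ?E = "contracted x y"
  obtain F where F: "chordal ?X F" "?E \<subseteq> F"
    and K: "\<And>K. K \<subseteq> ?X \<Longrightarrow> clique F K \<Longrightarrow> card K \<le> 4 \<or> clique ?E K"
    by (rule goodE[OF contracted_good[OF xy]]) (rule that)
  interpret F: fgraph ?X F by (rule chordal_fgraph) fact
  have K4: "card K \<le> 4" if "K \<subseteq> ?X" "clique F K" for K
    using K[OF that] contracted_clique_le_4[OF xy that(1)] by blast
  have "\<not> clique F ?X" using K4[of ?X] card6 V(2) fin by auto
  then obtain s t where st: "s \<in> ?X" "t \<in> ?X" "s \<noteq> t"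
    "clique F (F `` {s})" "clique F (F `` {t})"
    using chordal_two_simplicial[OF F(1)] by blast
  have deg3: "card (?E `` {t}) \<le> 3" if t: "t \<in> ?X" "clique F (F `` {t})" for t
  proof -
    have "F `` {t} \<subseteq> ?X" using F.sub by auto
    then have finF: "finite (F `` {t})" using F.fin by (rule finite_subset)
    have "insert t (F `` {t}) \<subseteq> ?X" using \<open>F `` {t} \<subseteq> ?X\<close> t(1) by simp
    moreover have "clique F (insert t (F `` {t}))"
      using t(2) by (rule clique_insert) (blast intro: F.edge_sym)
    ultimately have "card (insert t (F `` {t})) \<le> 4" by (rule K4)
    then have "card (F `` {t}) \<le> 3" using finF F.irr[of t] by simp
    moreover have "card (?E `` {t}) \<le> card (F `` {t})"
      using F(2) finF by (intro card_mono) auto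
    ultimately show ?thesis by simp
  qed
  have main: "(x, t) \<in> E \<and> (y, t) \<in> E \<and> card (nbrs E {t}) = 4"
    if t: "t \<in> ?X" "clique F (F `` {t})" for t
  proof (cases "t = x")
    \<comment> \<open>\<open>t\<close> is the contracted vertex: then \<open>x\<close> and
      \<open>y\<close> have the same three further neighbours \<open>a\<close>, \<open>b\<close>,
      \<open>c\<close>. Here \<open>b\<close> and \<open>c\<close> are the nonadjacent pair, and
      \<open>a\<close> is joined to a component \<open>C\<close> behind the separator.\<close>
    case True
    let ?S = "nbrs E {x, y}"
    have "?E `` {x} = ?S"
      using V sub irr by (auto simp: contracted_def nbrs_def edge_commute)
    then have S3: "card ?S \<le> 3" using deg3[OF t] True by simp
    have "nbrs E {x} \<subseteq> insert y ?S" "nbrs E {y} \<subseteq> insert x ?S" unfolding nbrs_def by auto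
    moreover have "card (insert y ?S) \<le> 4" "card (insert x ?S) \<le> 4"
      using S3 finite_nbrs[of "{x, y}"] by (auto simp: card_insert_if)
    ultimately have eq: "nbrs E {x} = insert y ?S" "nbrs E {y} = insert x ?S"
      using deg[OF V(1)] deg[OF V(2)] finite_nbrs[of "{x, y}"] by (intro card_seteq; simp)+
    have "y \<notin> ?S" "x \<notin> ?S" unfolding nbrs_def by auto
    then have "card ?S = 3"
      using deg[OF V(1)] S3 eq(1) finite_nbrs[of "{x, y}"] by simp
    then obtain a b c where S: "?S = {a, b, c}" "a \<noteq> b" "a \<noteq> c" "b \<noteq> c"
      by (auto simp: card_3_iff)
    have "card ({x, y} \<union> ?S) \<le> 5"
      using card_Un_le[of "{x, y}" ?S] \<open>card ?S = 3\<close> V(3) by simp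
    then have "card ({x, y} \<union> ?S) \<noteq> card V" using card6 by linarith
    then have neV: "{x, y} \<union> ?S \<noteq> V" by metis
    obtain C where C: "conn E C" "C \<subseteq> V - {x, y} - ?S" "nbrs E C \<subseteq> ?S" "3 \<le> card (nbrs E C)"
      by (rule component_outside[of "{x, y}" ?S]) (use V neV nbrs_subset that in auto)
    have "nbrs E C = ?S"
      using C(3,4) \<open>card ?S = 3\<close> finite_nbrs by (intro card_seteq) auto
    then have tC: "touch E {s} C" if "s \<in> ?S" for s using touch_nbrs[of s C] that by simp
    have ex: "(x, s) \<in> E" "(y, s) \<in> E" if "s \<in> ?S" for s
      using eq that nbrs_singleton[of s x] nbrs_singleton[of s y] by auto
    have "(b, c) \<notin> E"
      by (rule independent_separator[of "{x, y}"]) (use V neV \<open>card ?S = 3\<close> S in auto)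
    have aC: "conn E (insert a C)" using S(1) by (intro conn_insert_touch[OF C(1) symE] tC) simp
    have tt: "touch E {b} (insert a C)" "touch E {c} (insert a C)"
      "touch E {x} (insert a C)" "touch E {y} (insert a C)"
      using tC[of b] tC[of c] ex[of a] S(1) by (auto simp: touch_def)
    have SV: "a \<in> V" "b \<in> V" "c \<in> V" "x \<notin> {a, b, c}" "y \<notin> {a, b, c}"
      using S(1) nbrs_subset[of "{x, y}"] by (auto simp: nbrs_def)
    have CV: "x \<notin> C" "y \<notin> C" "a \<notin> C" "b \<notin> C" "c \<notin> C" "C \<subseteq> V" using C(2) S(1) by auto
    have exs: "(b, x) \<in> E" "(b, y) \<in> E" "(c, x) \<in> E" "(c, y) \<in> E"
      using ex[of b] ex[of c] S(1) by (auto intro: edge_sym)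
    have False
      by (rule no_model[of "{b}" "{c}" "{x}" "{y}" "insert a C"])
        (use V S(2-4) SV CV exs tt aC xy \<open>(b, c) \<notin> E\<close> in auto)
    then show ?thesis ..
  next
    \<comment> \<open>The degree of \<open>t\<close> drops from at least four to at most three, so
      the contraction merges two of its neighbours, which can only be \<open>x\<close> and
      \<open>y\<close>; merging costs just one.\<close>
    case False
    have tV: "t \<in> V" "t \<noteq> y" using t(1) by auto
    have fE: "finite (?E `` {t})"
      by (rule finite_subset[of _ V]) (auto simp: contracted_def fin)
    have sub': "nbrs E {t} - {y} \<subseteq> ?E `` {t}"
      using tV sub irr by (auto simp: contracted_def nbrs_def)
    have "y \<in> nbrs E {t}"
    proof (rule ccontr)
      assume "y \<notin> nbrs E {t}"
      then have "card (nbrs E {t}) \<le> card (?E `` {t})" using sub' fE by (intro card_mono) auto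
      then show False using deg[OF tV(1)] deg3[OF t] by linarith
    qed
    then have ty: "(t, y) \<in> E" by (simp add: nbrs_singleton)
    then have xE: "x \<in> ?E `` {t}"
      using False V tV by (auto simp: contracted_def edge_commute)
    have "x \<in> nbrs E {t}"
    proof (rule ccontr)
      assume x: "x \<notin> nbrs E {t}"
      have "insert x (nbrs E {t} - {y}) \<subseteq> ?E `` {t}" using sub' xE by blast
      then have "card (insert x (nbrs E {t} - {y})) \<le> card (?E `` {t})" using fE by (intro card_mono)
      then have "Suc (card (nbrs E {t} - {y})) \<le> 3"
        using x finite_nbrs[of "{t}"] deg3[OF t] by simp
      then show False
        using deg[OF tV(1)] \<open>y \<in> nbrs E {t}\<close> finite_nbrs[of "{t}"] by (simp add: card_Diff_singleton)
    qed
    moreover have "card (nbrs E {t} - {y}) \<le> 3"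
      using card_mono[OF fE sub'] deg3[OF t] by linarith
    then have "card (nbrs E {t}) = 4"
      using deg[OF tV(1)] \<open>y \<in> nbrs E {t}\<close> finite_nbrs[of "{t}"] by (simp add: card_Diff_singleton)
    ultimately show ?thesis using ty by (simp add: nbrs_singleton edge_commute)
  qed
  show thesis using that[of s t] main[of s] main[of t] st by blast
qed

text \<open>Otherwise a vertex \<open>u\<close> of degree four exists, and every vertex of its
  neighbourhood has two neighbours inside that neighbourhood. A component \<open>C\<close> behind it
  has three attachments; if they form a triangle, they give a \<open>K5_minus\<close> with
  \<open>u\<close> and \<open>C\<close>.\<close>

lemma deg3_exists: "\<exists>u\<in>V. card (nbrs E {u}) = 3"
proof (rule ccontr)
  assume neg: "\<not> ?thesis"
  have deg: "4 \<le> card (nbrs E {v})" if "v \<in> V" for v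
    using deg_ge_3[OF that] neg that by force
  then have deg_all: "\<forall>v\<in>V. 4 \<le> card (nbrs E {v})" by blast
  have "V \<noteq> {}" using card_V by auto
  then obtain v where v: "v \<in> V" by blast
  have "nbrs E {v} \<noteq> {}" using deg[OF v] by auto
  then obtain w where vw: "(v, w) \<in> E" using nbrs_singleton by blast
  obtain u where u: "(v, u) \<in> E" "card (nbrs E {u}) = 4"
    by (rule adjacent_common_nbrs[OF deg_all vw]) (rule that)
  then have uV: "u \<in> V" using sub by auto
  let ?N = "nbrs E {u}"
  have two: "\<exists>s t. s \<noteq> t \<and> s \<in> ?N \<and> t \<in> ?N \<and> (x, s) \<in> E \<and> (x, t) \<in> E" if "x \<in> ?N" for x
  proof -
    have "(u, x) \<in> E" using that nbrs_singleton by simp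
    then obtain s t where "s \<noteq> t" "(u, s) \<in> E" "(x, s) \<in> E" "(u, t) \<in> E" "(x, t) \<in> E"
      by (rule adjacent_common_nbrs[OF deg_all])
    then show ?thesis using nbrs_singleton by blast
  qed
  have "{u} \<union> ?N \<noteq> V"
  proof
    assume V: "{u} \<union> ?N = V"
    have "card ({u} \<union> ?N) \<le> 5" using card_Un_le[of "{u}" ?N] u(2) by simp
    then show False using V card_ge_6[OF deg_all] by simp
  qed
  then obtain C where C: "conn E C" "C \<subseteq> V - {u} - ?N" "nbrs E C \<subseteq> ?N" "3 \<le> card (nbrs E C)"
    using component_outside[of "{u}" ?N] uV nbrs_subset by blast
  obtain a b c where abc: "a \<in> nbrs E C" "b \<in> nbrs E C" "c \<in> nbrs E C" "a \<noteq> b" "a \<noteq> c" "b \<noteq> c"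
    by (rule three_distinct[OF C(4)]) (rule that)
  have uC: "\<not> touch E {u} C" by (rule no_touch_outside) (use C(2) in auto)
  have tC: "touch E C {s}" if "s \<in> nbrs E C" for s
    using touch_nbrs[OF that] touch_sym[OF symE] by blast
  have inN: "s \<in> V" "s \<noteq> u" "s \<notin> C" "(u, s) \<in> E" if "s \<in> ?N" for s
    using that nbrs_subset[of "{u}"] C(2) nbrs_singleton irr by auto
  \<comment> \<open>Nonadjacent attachments \<open>a\<close>, \<open>b\<close> would both be
    adjacent to the other two vertices \<open>c\<close>, \<open>d\<close> of the neighbourhood of
    \<open>u\<close>; then \<open>{a, d}\<close>, \<open>b\<close>, \<open>c\<close> serve as the
    triangle.\<close>
  have edge: "(a, b) \<in> E"
    if abc: "a \<in> nbrs E C" "b \<in> nbrs E C" "c \<in> nbrs E C" "a \<noteq> b" "a \<noteq> c" "b \<noteq> c" for a b c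
  proof (rule ccontr)
    assume ab: "(a, b) \<notin> E"
    have N: "a \<in> ?N" "b \<in> ?N" "c \<in> ?N" using that C(3) by auto
    have "card (?N - {a, b, c}) = 1"
      using u(2) N abc finite_nbrs[of "{u}"] by (simp add: card_Diff_subset)
    then obtain d where d: "?N - {a, b, c} = {d}" by (meson card_1_singletonE)
    then have N4: "?N = {a, b, c, d}" "d \<notin> {a, b, c}" using N by auto
    have acd: "(a, c) \<in> E" "(a, d) \<in> E"
      using two[OF N(1)] ab irr unfolding N4(1) by auto
    have bcd: "(b, c) \<in> E" "(b, d) \<in> E"
      using two[OF N(2)] ab irr edge_sym[of b a] unfolding N4(1) by auto
    have "conn E {a, d}" using acd by (intro conn_insert_touch[OF conn_singleton symE]) simp
    moreover have "touch E {u} {a, d}" "touch E C {a, d}" "touch E {a, d} {b}" "touch E {a, d} {c}"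
      using inN(4)[of a] tC[OF abc(1)] acd edge_sym[OF bcd(2)] N by (auto simp: touch_def)
    ultimately show False
      using N4(2) inN[of a] inN[of b] inN[of c] inN[of d] N d C(1,2) bcd abc tC uC uV
      by (intro no_model[of "{u}" C "{a, d}" "{b}" "{c}"]) auto
  qed
  have abcN: "a \<in> ?N" "b \<in> ?N" "c \<in> ?N" using abc C(3) by auto
  have "(a, b) \<in> E" "(a, c) \<in> E" "(b, c) \<in> E"
    using edge[of a b c] edge[of a c b] edge[of b c a] abc by auto
  then show False
    using abc inN[OF abcN(1)] inN[OF abcN(2)] inN[OF abcN(3)] C(1,2) tC uC uV
    by (intro no_model[of "{u}" C "{a}" "{b}" "{c}"]) auto
qed

end

section \<open>Splitting the inside of an ear\<close>

text \<open>The vertex \<open>u\<close> closes the induced path \<open>p\<close> to a cycle, \<open>D\<close> consists of all other vertices, and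
  \<open>c\<close> is the only neighbour of \<open>u\<close> in \<open>D\<close>.\<close>

locale ear = critical V E for V :: "'a set" and E +
  fixes u a b c :: 'a and D :: "'a set" and p :: "nat \<Rightarrow> 'a" and m :: nat
  assumes u: "u \<in> V" "nbrs E {u} = {a, b, c}"
    and D: "conn E D" "c \<in> D" "u \<notin> D"
    and V_eq: "V = insert u (D \<union> p ` {..m})"
    and pD: "\<And>i. i \<le> m \<Longrightarrow> p i \<notin> D" and pu: "\<And>i. i \<le> m \<Longrightarrow> p i \<noteq> u"
    and p_inj: "\<And>i j. i \<le> m \<Longrightarrow> j \<le> m \<Longrightarrow> p i = p j \<longleftrightarrow> i = j"
    and p_ends: "p 0 = a" "p m = b" and m: "3 \<le> m"
    and p_edge: "\<And>i j. i \<le> m \<Longrightarrow> j \<le> m \<Longrightarrow> (p i, p j) \<in> E \<longleftrightarrow> j = Suc i \<or> i = Suc j"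
    and D_touch: "\<And>i. i \<le> m \<Longrightarrow> touch E D {p i}"
begin

lemma reversed: "ear V E u b a c D (\<lambda>i. p (m - i)) m"
proof
  show "V = insert u (D \<union> (\<lambda>i. p (m - i)) ` {..m})"
  proof -
    have "(\<lambda>i. p (m - i)) ` {..m} = p ` {..m}"
    proof (intro equalityI subsetI)
      fix x assume "x \<in> p ` {..m}"
      then obtain i where "i \<le> m" "x = p i" by auto
      then show "x \<in> (\<lambda>i. p (m - i)) ` {..m}" by (intro image_eqI[of _ _ "m - i"]) auto
    qed auto
    then show ?thesis using V_eq by simp
  qed
  show "(p (m - i), p (m - j)) \<in> E \<longleftrightarrow> j = Suc i \<or> i = Suc j" if "i \<le> m" "j \<le> m" for i j
    unfolding p_edge[OF diff_le_self diff_le_self] using that by arith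
  show "p (m - i) = p (m - j) \<longleftrightarrow> i = j" if "i \<le> m" "j \<le> m" for i j
    unfolding p_inj[OF diff_le_self diff_le_self] using that by arith
qed (use u D pD pu p_ends m D_touch in auto)

lemma seg_conn: "i \<le> j \<Longrightarrow> j \<le> m \<Longrightarrow> conn E (p ` {i..j})"
  by (rule conn_path_image[OF symE]) (auto simp: p_edge)

lemma u_edge: "(u, x) \<in> E \<longleftrightarrow> x \<in> {a, b, c}"
  using nbrs_singleton[of x u] u(2) by simp

lemma u_ends: "(u, p 0) \<in> E" "(u, p m) \<in> E" "(p 0, u) \<in> E" "(p m, u) \<in> E"
  using u_edge[of a] u_edge[of b] edge_sym[of u a] edge_sym[of u b] by (auto simp: p_ends)

lemma pV: "i \<le> m \<Longrightarrow> p i \<in> V"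
  using V_eq by auto

lemma p_mem: "i \<le> m \<Longrightarrow> I \<subseteq> {..m} \<Longrightarrow> p i \<in> p ` I \<longleftrightarrow> i \<in> I"
  using p_inj by (auto simp: subset_iff)

lemma u_notin_seg: "I \<subseteq> {..m} \<Longrightarrow> u \<notin> p ` I"
  using pu by auto

lemma seg_V: "I \<subseteq> {..m} \<Longrightarrow> p ` I \<subseteq> V"
  using V_eq by blast

lemma seg_disjoint: "I \<subseteq> {..m} \<Longrightarrow> J \<subseteq> {..m} \<Longrightarrow> I \<inter> J = {} \<Longrightarrow> p ` I \<inter> p ` J = {}"
  using p_inj by (auto simp: subset_iff disjoint_iff)

lemma touch_seg: "touch E X {p i} \<Longrightarrow> i \<in> I \<Longrightarrow> touch E X (p ` I)"
  by (erule touch_superset) auto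

lemma consecutive_touch: "i \<in> I \<Longrightarrow> Suc i \<in> J \<Longrightarrow> Suc i \<le> m \<Longrightarrow> touch E (p ` I) (p ` J)"
  by (rule touchI[of "p i" _ "p (Suc i)"]) (auto simp: p_edge)

lemma inner_touch:
  "touch E {p 0} (p ` {1..m - 1})" "touch E (p ` {1..m - 1}) {p m}" "touch E {p m} (p ` {1..m - 1})"
  "touch E (p ` {2..m - 1}) {p m}" "touch E (p ` {2..m - 1}) (p ` {0..1})"
proof -
  have "touch E (p ` {0}) (p ` {1..m - 1})" using m by (intro consecutive_touch[of 0]) auto
  then show "touch E {p 0} (p ` {1..m - 1})" by simp
  have "touch E (p ` {1..m - 1}) (p ` {m})" "touch E (p ` {2..m - 1}) (p ` {m})"
    using m by (intro consecutive_touch[of "m - 1"]; simp)+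
  then show "touch E (p ` {1..m - 1}) {p m}" "touch E (p ` {2..m - 1}) {p m}" by simp_all
  then show "touch E {p m} (p ` {1..m - 1})" using touch_sym[OF symE] by blast
  have "touch E (p ` {0..1}) (p ` {2..m - 1})" using m by (intro consecutive_touch[of 1]) auto
  then show "touch E (p ` {2..m - 1}) (p ` {0..1})" using touch_sym[OF symE] by blast
qed

end

section \<open>Bipartitions of the inside into two connected sets\<close>

locale split_ear = ear V E u a b c D p m
  for V :: "'a set" and E u a b c D p m +
  fixes D1 D2 :: "'a set"
  assumes D12: "conn E D1" "conn E D2" "D1 \<union> D2 = D" "D1 \<inter> D2 = {}" "c \<in> D1"
begin

lemma reversed_split: "split_ear V E u b a c D (\<lambda>i. p (m - i)) m D1 D2"
  using reversed D12 by (simp add: split_ear_def split_ear_axioms_def)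

lemma D12_sub: "D1 \<subseteq> V" "D2 \<subseteq> V" "u \<notin> D1" "u \<notin> D2"
  and pD12: "i \<le> m \<Longrightarrow> p i \<notin> D1" "i \<le> m \<Longrightarrow> p i \<notin> D2"
  using D12(3) V_eq D(3) pD[of i] by auto

lemma seg_D12:
  assumes "I \<subseteq> {..m}"
  shows "D1 \<inter> p ` I = {}" "D2 \<inter> p ` I = {}" "p ` I \<inter> D1 = {}" "p ` I \<inter> D2 = {}"
  using assms pD12 by (auto simp: subset_iff)

lemma D12_touch: "touch E D1 D2" "touch E D2 D1"
proof -
  show "touch E D1 D2" using conn_cut[OF D(1) D12(3,4)] D12(1,2) conn_nonempty by blast
  then show "touch E D2 D1" using touch_sym[OF symE] by blast
qed

text \<open>\<open>c\<close> is the only neighbour of \<open>u\<close> inside \<open>D\<close>, so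
  the part without it is not adjacent to \<open>u\<close>. This is the only asymmetry between the
  two parts.\<close>

lemma u_D12: "touch E {u} D1" "touch E D1 {u}" "\<not> touch E {u} D2"
proof -
  have cu: "(u, c) \<in> E" using u_edge by simp
  then show "touch E {u} D1" "touch E D1 {u}" using D12(5) edge_sym by (auto simp: touch_def)
  have "a \<notin> D" "b \<notin> D" using pD[of 0] pD[of m] by (simp_all add: p_ends)
  then show "\<not> touch E {u} D2" using D12(3-5) by (auto simp: touch_def u_edge)
qed

lemma D12_cover: "i \<le> m \<Longrightarrow> touch E D1 {p i} \<or> touch E D2 {p i}"
  using D_touch[of i] D12(3) touch_Un(1)[of E D1 D2 "{p i}"] by simp

text \<open>Cut before position \<open>j\<close>, the path falls into two segments, each seen by
  \<open>D1\<close>, by \<open>D2\<close> and, at its end, by \<open>u\<close>. The segments and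
  \<open>D1\<close> form the triangle, \<open>u\<close> and \<open>D2\<close> the nonadjacent
  pair.\<close>

lemma no_cut:
  assumes "i1 < j" "j \<le> i2" "k1 < j" "j \<le> k2" "i2 \<le> m" "k2 \<le> m"
    and "touch E D1 {p i1}" "touch E D1 {p i2}" "touch E D2 {p k1}" "touch E D2 {p k2}"
  shows False
proof (rule no_model[of "{u}" D2 D1 "p ` {0..j - 1}" "p ` {j..m}"])
  show "touch E {u} (p ` {0..j - 1})" "touch E {u} (p ` {j..m})"
    using u_ends assms by (auto intro: touch_seg)
  show "p ` {0..j - 1} \<inter> p ` {j..m} = {}" using assms by (intro seg_disjoint) auto
  show "touch E D2 (p ` {0..j - 1})" "touch E D1 (p ` {0..j - 1})"
    using assms by (auto intro: touch_seg[of _ k1] touch_seg[of _ i1])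
  show "touch E D2 (p ` {j..m})" "touch E D1 (p ` {j..m})"
    using assms by (auto intro: touch_seg[of _ k2] touch_seg[of _ i2])
  show "touch E (p ` {0..j - 1}) (p ` {j..m})"
    using assms by (intro consecutive_touch[of "j - 1"]) auto
  show "conn E (p ` {0..j - 1})" "conn E (p ` {j..m})" using assms by (auto intro!: seg_conn)
qed (use assms D12 D12_touch D12_sub u_D12 u in \<open>simp_all add: p_mem u_notin_seg seg_V seg_D12 Int_commute[of D2 D1]\<close>)

text \<open>Here \<open>D2\<close> misses the first vertex of the path and \<open>D1\<close> the
  last. So \<open>D2\<close> and \<open>p 0\<close> are the nonadjacent pair; the triangle is
  \<open>D1\<close>, the inner path and \<open>{p m, u}\<close>. Two attachments on each side
  guarantee that both parts see the inner path.\<close>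

lemma not_ordered:
  assumes ord: "\<And>i k. i \<le> m \<Longrightarrow> k \<le> m \<Longrightarrow> touch E D1 {p i} \<Longrightarrow> touch E D2 {p k} \<Longrightarrow> i \<le> k"
    and "i1 < i2" "i2 \<le> m" "touch E D1 {p i1}" "touch E D1 {p i2}"
    and "k1 < k2" "k2 \<le> m" "touch E D2 {p k1}" "touch E D2 {p k2}"
  shows False
proof -
  have 0: "\<not> touch E D2 {p 0}" using ord[of i2 0] assms by auto
  have M: "\<not> touch E D1 {p m}"
  proof
    assume "touch E D1 {p m}"
    then have "m \<le> k1" using ord[of m k1] assms(6-8) by simp
    then show False using assms(6,7) by simp
  qed
  have first: "touch E D1 {p 0}" using D12_cover[of 0] 0 by simp
  have M': "touch E D2 {p m}" using D12_cover[of m] M by simp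
  have i2: "i2 \<in> {1..m - 1}" using assms M by (cases "i2 = m") auto
  have k1: "k1 \<in> {1..m - 1}" using assms 0 by (cases "k1 = 0") auto
  show False
  proof (rule no_model[of D2 "{p 0}" D1 "p ` {1..m - 1}" "{p m, u}"])
    show "touch E D2 (p ` {1..m - 1})" "touch E D1 (p ` {1..m - 1})"
      using touch_seg assms i2 k1 by blast+
    show "touch E {p 0} (p ` {1..m - 1})" "touch E (p ` {1..m - 1}) {p m, u}"
      using inner_touch by (auto simp: touch_pair)
    show "touch E D2 {p m, u}" "touch E {p 0} {p m, u}" "touch E D1 {p m, u}"
      using M' u_ends u_D12(2) by (auto simp: touch_pair)
    show "touch E {p 0} D1" using first touch_sym[OF symE] by blast
    show "conn E {p m, u}" using u_ends by (intro conn_insert_touch[OF conn_singleton symE]) simp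
    show "conn E (p ` {1..m - 1})" using m by (intro seg_conn) auto
  qed (use 0 m D12 D12_touch D12_sub u pV[of 0] pV[of m] pD12[of 0] pD12[of m] pu[of 0] pu[of m]
      p_inj[of 0 m] in \<open>simp_all add: p_mem u_notin_seg seg_V seg_D12 Int_commute[of D2 D1]\<close>)
qed

text \<open>\<open>D2\<close> sees every path vertex except possibly \<open>p i\<close>.
  \<open>D1\<close> and \<open>p m\<close> are the nonadjacent pair; the triangle is
  \<open>D2\<close>, \<open>{p 0, u}\<close> and the inner path.\<close>

lemma no_inner_single:
  assumes i: "0 < i" "i < m" and single: "\<And>j. j \<le> m \<Longrightarrow> touch E D1 {p j} \<longleftrightarrow> j = i"
  shows False
proof -
  have T2: "touch E D2 {p j}" if "j \<le> m" "j \<noteq> i" for j using D12_cover[of j] single[of j] that by simp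
  show False
  proof (rule no_model[of D1 "{p m}" D2 "{p 0, u}" "p ` {1..m - 1}"])
    \<comment> \<open>As \<open>3 \<le> m\<close>, both \<open>1\<close> and \<open>2\<close> are
      inner positions, and one of them differs from \<open>i\<close>.\<close>
    show "touch E D2 (p ` {1..m - 1})"
      using T2[of 1] T2[of 2] m touch_seg[of D2 1 "{1..m - 1}"] touch_seg[of D2 2 "{1..m - 1}"]
      by (cases "i = 1") auto
    show "touch E D1 (p ` {1..m - 1})"
      using single[of i] i by (intro touch_seg[of D1 i]) auto
    show "touch E {p m} (p ` {1..m - 1})" "touch E {p 0, u} (p ` {1..m - 1})"
      using inner_touch by (auto simp: touch_pair)
    show "touch E D1 {p 0, u}" "touch E D2 {p 0, u}" "touch E {p m} {p 0, u}"
      using u_D12(2) T2[of 0] i u_ends by (auto simp: touch_pair)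
    show "touch E {p m} D2" using T2[of m] i touch_sym[OF symE] by blast
    show "\<not> touch E D1 {p m}" using single[of m] i by simp
    show "conn E {p 0, u}" using u_ends by (intro conn_insert_touch[OF conn_singleton symE]) simp
    show "conn E (p ` {1..m - 1})" using m by (intro seg_conn) auto
  qed (use m D12 D12_touch D12_sub u pV[of 0] pV[of m] pD12[of 0] pD12[of m] pu[of 0] pu[of m]
      p_inj[of 0 m] p_inj[of m 0] in \<open>simp_all add: p_mem u_notin_seg seg_V seg_D12 Int_commute[of D2 D1]\<close>)
qed

text \<open>\<open>D1\<close> is not adjacent to the segment from position \<open>2\<close> to
  \<open>m - 1\<close>, which is nonempty because \<open>3 \<le> m\<close>. The triangle is
  \<open>D2\<close>, \<open>{p 0, p 1}\<close> and \<open>{p m, u}\<close>.\<close>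

lemma no_first_single:
  assumes single: "\<And>j. j \<le> m \<Longrightarrow> touch E D1 {p j} \<longleftrightarrow> j = 0"
  shows False
proof -
  have T2: "touch E D2 {p j}" if "j \<le> m" "j \<noteq> 0" for j using D12_cover[of j] single[of j] that by simp
  show False
  proof (rule no_model[of D1 "p ` {2..m - 1}" D2 "p ` {0..1}" "{p m, u}"])
    show "touch E D2 (p ` {0..1})" using T2[of 1] m by (intro touch_seg[of D2 1]) auto
    show "touch E (p ` {2..m - 1}) D2"
      using T2[of 2] m touch_seg[of D2 2 "{2..m - 1}"] touch_sym[OF symE] by auto
    show "touch E D1 (p ` {0..1})" using single[of 0] by (intro touch_seg[of D1 0]) auto
    show "touch E (p ` {2..m - 1}) (p ` {0..1})" "touch E (p ` {2..m - 1}) {p m, u}"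
      using inner_touch by (auto simp: touch_pair)
    show "touch E D1 {p m, u}" using u_D12(2) by (auto simp: touch_pair)
    show "p ` {2..m - 1} \<inter> p ` {0..1} = {}" using m by (intro seg_disjoint) auto
    show "touch E D2 {p m, u}" using T2[of m] m by (auto simp: touch_pair)
    show "touch E (p ` {0..1}) {p m, u}" using u_ends by (auto intro: touchI[of "p 0" _ u])
    show "\<not> touch E D1 (p ` {2..m - 1})"
    proof
      assume "touch E D1 (p ` {2..m - 1})"
      then obtain j where "j \<in> {2..m - 1}" "touch E D1 {p j}" unfolding touch_def by blast
      moreover from this have "j \<le> m" by auto
      ultimately show False using single[of j] by auto
    qed
    show "conn E {p m, u}" using u_ends by (intro conn_insert_touch[OF conn_singleton symE]) simp
    show "conn E (p ` {2..m - 1})" "conn E (p ` {0..1})" using m by (auto intro!: seg_conn)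
  qed (use m D12 D12_touch D12_sub u pV[of 0] pV[of m] pD12[of 0] pD12[of m] pu[of 0] pu[of m]
      p_inj[of 0 m] p_inj[of m 0] in \<open>simp_all add: p_mem u_notin_seg seg_V seg_D12 Int_commute[of D2 D1]\<close>)
qed

text \<open>If both parts have two attachments on the path, either all those of one part precede
  those of the other, or the two sets interleave and some position cuts both. If \<open>D1\<close>
  has just one, its place decides; reversing the path handles the mirror cases.\<close>

lemma one_side_small:
  assumes "i \<le> m" "touch E D1 {p i}" "k1 < k2" "k2 \<le> m" "touch E D2 {p k1}" "touch E D2 {p k2}"
  shows False
proof (cases "\<exists>j\<le>m. j \<noteq> i \<and> touch E D1 {p j}")
  case True
  then obtain i1 i2 where i12: "i1 < i2" "i2 \<le> m" "touch E D1 {p i1}" "touch E D1 {p i2}"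
    using assms(1,2) by (metis linorder_neqE_nat)
  interpret r: split_ear V E u b a c D "\<lambda>i. p (m - i)" m D1 D2 by (rule reversed_split)
  show False
  proof (cases "\<exists>x y. x \<le> m \<and> y \<le> m \<and> touch E D1 {p x} \<and> touch E D2 {p y} \<and> y < x")
    case False
    then show False using not_ordered[OF _ i12 assms(3-6)] by (meson not_le)
  next
    case 1: True
    show False
    proof (cases "\<exists>x y. x \<le> m \<and> y \<le> m \<and> touch E D1 {p x} \<and> touch E D2 {p y} \<and> x < y")
      case False
      then have le: "y \<le> x" if "x \<le> m" "y \<le> m" "touch E D1 {p x}" "touch E D2 {p y}" for x y
        using that by (meson not_le)
      show False
      proof (rule r.not_ordered[of "m - i2" "m - i1" "m - k2" "m - k1"])
        fix i k assume "i \<le> m" "k \<le> m" "touch E D1 {p (m - i)}" "touch E D2 {p (m - k)}"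
        then show "i \<le> k" using le[of "m - i" "m - k"] by linarith
      qed (use i12 assms(3-6) in auto)
    next
      case 2: True
      define N1 N2 where N: "N1 = {i. i \<le> m \<and> touch E D1 {p i}}" "N2 = {i. i \<le> m \<and> touch E D2 {p i}}"
      have fin: "finite N1" "finite N2" unfolding N by (rule finite_subset[of _ "{..m}"]; auto)+
      have "i1 \<in> N1" "k1 \<in> N2" using i12 assms(3-6) by (auto simp: N)
      then have ne: "N1 \<noteq> {}" "N2 \<noteq> {}" by auto
      have N1: "Min N1 \<in> N1" "Max N1 \<in> N1" and N2: "Min N2 \<in> N2" "Max N2 \<in> N2"
        using fin ne by simp_all
      have le1: "Min N1 \<le> x" "x \<le> Max N1" if "x \<le> m" "touch E D1 {p x}" for x
        using that fin by (auto simp: N)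
      have le2: "Min N2 \<le> x" "x \<le> Max N2" if "x \<le> m" "touch E D2 {p x}" for x
        using that fin by (auto simp: N)
      obtain x y where xy: "x \<le> m" "y \<le> m" "touch E D1 {p x}" "touch E D2 {p y}" "y < x"
        using 1 by blast
      obtain x' y' where xy': "x' \<le> m" "y' \<le> m" "touch E D1 {p x'}" "touch E D2 {p y'}" "x' < y'"
        using 2 by blast
      have "Min N1 \<le> i1" "i2 \<le> Max N1" "Min N1 \<le> x'" "x \<le> Max N1"
        using le1 i12 xy xy' by simp_all
      moreover have "Min N2 \<le> k1" "k2 \<le> Max N2" "Min N2 \<le> y" "y' \<le> Max N2"
        using le2 assms(3-6) xy xy' by simp_all
      ultimately have lt: "Min N1 < Max N1" "Min N2 < Max N2" "Min N1 < Max N2" "Min N2 < Max N1"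
        using i12(1) assms(3) xy(5) xy'(5) by linarith+
      have mem: "i \<in> N1 \<longleftrightarrow> i \<le> m \<and> touch E D1 {p i}" "i \<in> N2 \<longleftrightarrow> i \<le> m \<and> touch E D2 {p i}" for i
        by (simp_all add: N)
      show False
        \<comment> \<open>The cut lies just behind the later of the two first attachments; as each
          first attachment precedes both last ones, the two last attachments are behind the
          cut.\<close>
        by (rule no_cut[of "Min N1" "max (Suc (Min N1)) (Suc (Min N2))" "Max N1" "Min N2" "Max N2"])
          (use lt N1 N2 in \<open>simp_all add: mem\<close>)
    qed
  qed
next
  case False
  then have single: "touch E D1 {p j} \<longleftrightarrow> j = i" if "j \<le> m" for j using that assms(2) by blast
  interpret r: split_ear V E u b a c D "\<lambda>i. p (m - i)" m D1 D2 by (rule reversed_split)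
  consider "0 < i" "i < m" | "i = 0" | "i = m" using assms(1) by linarith
  then show False
  proof cases
    case 1
    then show ?thesis using no_inner_single single by blast
  next
    case 2
    then show ?thesis using no_first_single single by blast
  next
    case 3
    show ?thesis
    proof (rule r.no_first_single)
      fix j assume "j \<le> m"
      then show "touch E D1 {p (m - j)} \<longleftrightarrow> j = 0" using single[of "m - j"] 3 m by auto
    qed
  qed
qed

end

section \<open>How few rim vertices a part of the inside can see\<close>

context ear
begin

definition rim :: "'a set" where
  "rim = insert u (p ` {..m})"

lemma card_rim: "5 \<le> card rim"
proof -
  have "inj_on p {..m}" using p_inj by (auto simp: inj_on_def)
  then have "card (p ` {..m}) = Suc m" by (simp add: card_image)
  moreover have "u \<notin> p ` {..m}" by (rule u_notin_seg) simp
  ultimately show ?thesis using m by (simp add: rim_def)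
qed

lemma rim_D: "V = rim \<union> D" "rim \<inter> D = {}"
  using V_eq D(3) pD by (auto simp: rim_def)

lemma rim_nbrs_D: "rim \<subseteq> nbrs E D"
proof
  fix x assume x: "x \<in> rim"
  then have "x \<notin> D" using rim_D(2) by blast
  moreover have "touch E D {x}"
  proof (cases "x = u")
    case True
    have "(c, u) \<in> E" using u_edge edge_sym by blast
    then show ?thesis using True D(2) by (auto simp: touch_def)
  next
    case False
    then show ?thesis using x D_touch by (auto simp: rim_def)
  qed
  ultimately show "x \<in> nbrs E D" unfolding nbrs_def touch_def by blast
qed

text \<open>If \<open>D1\<close> sees no path vertex, \<open>u\<close> is its only possible rim
  neighbour. Otherwise \<open>one_side_small\<close> leaves \<open>D2\<close> at most one path
  vertex, and \<open>D2\<close> never sees \<open>u\<close>.\<close>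

lemma split_rim_aux:
  assumes "conn E D1" "conn E D2" "D1 \<union> D2 = D" "D1 \<inter> D2 = {}" "c \<in> D1"
  shows "card (nbrs E D1 \<inter> rim) \<le> 1 \<or> card (nbrs E D2 \<inter> rim) \<le> 1"
proof -
  interpret split_ear V E u a b c D p m D1 D2 by unfold_locales (fact assms)+
  have t: "touch E X {x}" if "x \<in> nbrs E X" for X x
    using touch_nbrs[OF that] touch_sym[OF symE] by blast
  show ?thesis
  proof (cases "\<exists>i\<le>m. touch E D1 {p i}")
    case False
    have "nbrs E D1 \<inter> rim \<subseteq> {u}" using False t by (auto simp: rim_def)
    then have "card (nbrs E D1 \<inter> rim) \<le> card {u}" by (intro card_mono) auto
    then show ?thesis by simp
  next
    case True
    then obtain i where i: "i \<le> m" "touch E D1 {p i}" by blast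
    have "u \<notin> nbrs E D2" using touch_nbrs u_D12(3) by blast
    have "x = y" if "x \<in> nbrs E D2 \<inter> rim" "y \<in> nbrs E D2 \<inter> rim" for x y
    proof -
      have "x \<in> p ` {..m}" "y \<in> p ` {..m}"
        using that \<open>u \<notin> nbrs E D2\<close> by (auto simp: rim_def)
      then obtain k l where kl: "k \<le> m" "l \<le> m" "x = p k" "y = p l" by auto
      then have "touch E D2 {p k}" "touch E D2 {p l}" using t that by auto
      then have "\<not> k < l" "\<not> l < k" using one_side_small[OF i] kl(1,2) by blast+
      then show ?thesis using kl by simp
    qed
    moreover have "finite (nbrs E D2 \<inter> rim)" using finite_nbrs by simp
    ultimately have "card (nbrs E D2 \<inter> rim) \<le> 1" by (simp add: card_le_Suc0_iff_eq)
    then show ?thesis ..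
  qed
qed

lemma split_rim:
  assumes "conn E D1" "conn E D2" "D1 \<union> D2 = D" "D1 \<inter> D2 = {}"
  shows "card (nbrs E D1 \<inter> rim) \<le> 1 \<or> card (nbrs E D2 \<inter> rim) \<le> 1"
proof (cases "c \<in> D1")
  case True
  then show ?thesis using split_rim_aux assms by blast
next
  case False
  then have "c \<in> D2" using D(2) assms(3) by blast
  then show ?thesis
    using split_rim_aux[of D2 D1] assms by (auto simp: Un_commute Int_commute)
qed

text \<open>A single vertex \<open>c\<close> would be adjacent to the whole path, so
  \<open>p 0\<close> would have degree three with the adjacent neighbours \<open>c\<close> and
  \<open>p 1\<close>.\<close>

lemma D_not_singleton: "2 \<le> card D"
proof (rule ccontr)
  assume "\<not> 2 \<le> card D"
  have finD: "finite D" using rim_D(1) fin by simp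
  have "D = {c}"
  proof -
    have "card D \<le> 1" using \<open>\<not> 2 \<le> card D\<close> by simp
    then have "\<forall>x\<in>D. \<forall>y\<in>D. x = y" using finD by (simp add: card_le_Suc0_iff_eq)
    then show ?thesis using D(2) by blast
  qed
  have ci: "(c, p i) \<in> E" if "i \<le> m" for i using D_touch[OF that] \<open>D = {c}\<close> by simp
  have "nbrs E {p 0} = {u, p 1, c}"
  proof (intro equalityI subsetI)
    fix x assume "x \<in> nbrs E {p 0}"
    then have x: "(p 0, x) \<in> E" by (simp add: nbrs_singleton)
    then have "x \<in> V" using sub by blast
    then consider "x = u" | "x = c" | j where "j \<le> m" "x = p j" using V_eq \<open>D = {c}\<close> by auto
    then show "x \<in> {u, p 1, c}" using x p_edge[of 0] by cases auto
  next
    fix x assume "x \<in> {u, p 1, c}"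
    moreover have "(p 0, p 1) \<in> E" using p_edge[of 0 1] m by simp
    ultimately show "x \<in> nbrs E {p 0}"
      using u_ends edge_sym[OF ci[of 0]] by (auto simp: nbrs_singleton)
  qed
  moreover have "card {u, p 1, c} = 3"
    using pu[of 1] pD[of 1] D(2,3) m by (auto simp: card_insert_if)
  ultimately have "(c, p 1) \<notin> E"
    using deg3_independent[OF pV[of 0], of c "p 1"] by simp
  then show False using ci[of 1] m by simp
qed

text \<open>For a maximal \<open>Y\<close> as below, the set \<open>D\<close> is partitioned into three parts \<open>Y\<close>, \<open>Z\<close> and
  \<open>D - Y - Z\<close>, each with at most one neighbour on the rim, although all of the at least five
  rim vertices have a neighbour in \<open>D\<close>.\<close>

lemma ear_impossible: False
proof -
  let ?P = "\<lambda>Y. conn E Y \<and> Y \<subset> D \<and> conn E (D - Y) \<and> card (nbrs E Y \<inter> rim) \<le> 1"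
  have finD: "finite D" using rim_D(1) fin by simp
  have DV: "D \<subseteq> V" using rim_D(1) by blast
  obtain d where d: "d \<in> D" "conn E (D - {d})"
    by (rule noncut_vertex[OF finD D(1) symE D_not_singleton])
  have "D - {d} \<noteq> {}" using conn_nonempty[OF d(2)] .
  moreover have "D - (D - {d}) = {d}" using d(1) by blast
  ultimately have "?P {d} \<or> ?P (D - {d})"
    using split_rim[of "{d}" "D - {d}"] d by auto
  then obtain Y0 where Y0: "?P Y0" by blast
  obtain Y where Y: "?P Y" and mx: "\<And>Y'. ?P Y' \<Longrightarrow> Y \<subseteq> Y' \<Longrightarrow> Y' = Y"
    by (rule maximal_subset_exists[OF finD, of ?P Y0]) (rule Y0, blast, rule that)
  let ?X = "D - Y"
  have nbrs_split: "nbrs E Z = (nbrs E Z \<inter> rim) \<union> (nbrs E Z \<inter> (D - Z))" for Z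
    using nbrs_subset[of Z] rim_D(1) unfolding nbrs_def by blast
  \<comment> \<open>A single rim neighbour cannot exhaust the rim, so the neighbourhood of
    \<open>Z\<close> separates; at least two of its vertices then lie in \<open>D\<close>.\<close>
  have three: "3 \<le> card (nbrs E Z)" if "Z \<noteq> {}" "Z \<subseteq> D" "card (nbrs E Z \<inter> rim) \<le> 1" for Z
  proof (rule three_connected)
    show "Z \<union> nbrs E Z \<noteq> V"
    proof
      assume "Z \<union> nbrs E Z = V"
      then have "rim \<subseteq> nbrs E Z \<inter> rim" using rim_D that(2) by blast
      then have "card rim \<le> card (nbrs E Z \<inter> rim)" using finite_nbrs by (intro card_mono) auto
      then show False using that(3) card_rim by simp
    qed
  qed (use that DV in auto)
  have "3 \<le> card (nbrs E Y)" using three[of Y] Y conn_nonempty by blast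
  also have "\<dots> \<le> card (nbrs E Y \<inter> rim) + card (nbrs E Y \<inter> ?X)"
    using nbrs_split[of Y] card_Un_le by metis
  finally have two: "2 \<le> card (nbrs E Y \<inter> ?X)" using Y by linarith
  then have "nbrs E Y \<inter> ?X \<noteq> {}" by auto
  then obtain x where x: "x \<in> nbrs E Y" "x \<in> ?X" by blast
  have "?X - {x} \<noteq> {}"
  proof
    assume "?X - {x} = {}"
    then have "nbrs E Y \<inter> ?X \<subseteq> {x}" by blast
    then have "card (nbrs E Y \<inter> ?X) \<le> card {x}" by (intro card_mono) auto
    then show False using two by simp
  qed
  then obtain Z where Z: "conn E Z" "Z \<subseteq> ?X - {x}" "nbrs E Z \<inter> (?X - {x}) = {}"
    using component_in[of "?X - {x}"] DV by blast
  have XZ: "conn E (?X - Z)"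
    by (rule conn_remove_component[of E ?X x Z]) (use Y symE x Z in auto)
  have "conn E (Y \<union> (?X - Z))"
  proof (rule conn_Un)
    have "touch E {x} Y" by (rule touch_nbrs[OF x(1)])
    then have "touch E Y {x}" using touch_sym[OF symE] by blast
    then have "touch E Y (?X - Z)" by (rule touch_superset) (use x Z(2) in auto)
    then show "touch E Y (?X - Z) \<or> Y \<inter> (?X - Z) \<noteq> {}" ..
  qed (use Y XZ symE in auto)
  moreover have DZ: "Y \<union> (?X - Z) = D - Z" "D - (D - Z) = Z" using Y Z(2) by auto
  ultimately have cDZ: "conn E (D - Z)" by simp
  \<comment> \<open>\<open>D - Z\<close> properly contains \<open>Y\<close> and leaves the connected
    set \<open>Z\<close>. By maximality it sees two rim vertices, so \<open>split_rim\<close> leaves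
    at most one for \<open>Z\<close>.\<close>
  have "D - Z \<noteq> Y" using x Z(2) by blast
  moreover have "Y \<subseteq> D - Z" "D - Z \<subset> D" using DZ conn_nonempty[OF Z(1)] Z(2) by blast+
  ultimately have "\<not> card (nbrs E (D - Z) \<inter> rim) \<le> 1"
    using mx[of "D - Z"] cDZ Z(1) DZ(2) by metis
  then have Z1: "card (nbrs E Z \<inter> rim) \<le> 1"
    using split_rim[of "D - Z" Z] cDZ Z(1,2) by auto
  \<comment> \<open>Otherwise \<open>x\<close> and one rim vertex would be the only neighbours of
    \<open>Z\<close>, against three-connectivity.\<close>
  have "touch E Y Z"
  proof (rule ccontr)
    assume "\<not> touch E Y Z"
    then have "nbrs E Z \<inter> Y = {}"
      using touch_nbrs[of _ Z] touch_superset[of E _ Z Y Z] by blast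
    then have "nbrs E Z \<inter> (D - Z) \<subseteq> {x}" using Z(3) by blast
    then have "card (nbrs E Z \<inter> (D - Z)) \<le> card {x}" by (intro card_mono) auto
    moreover have "card (nbrs E Z) \<le> card (nbrs E Z \<inter> rim) + card (nbrs E Z \<inter> (D - Z))"
      using nbrs_split[of Z] card_Un_le by metis
    moreover have "3 \<le> card (nbrs E Z)"
      by (rule three) (use Z1 Z(2) conn_nonempty[OF Z(1)] in auto)
    ultimately show False using Z1 by simp
  qed
  then have YZ: "conn E (Y \<union> Z)" using Y Z(1) symE by (intro conn_Un) auto
  have DYZ: "D - (Y \<union> Z) = ?X - Z" "D - (?X - Z) = Y \<union> Z" using Y Z(2) by auto
  \<comment> \<open>The same argument for \<open>Y \<union> Z\<close>, now known to be connected,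
    bounds the rim neighbours of the third part.\<close>
  have "Y \<union> Z \<noteq> Y" "Y \<subseteq> Y \<union> Z" "Y \<union> Z \<subset> D" using Y Z(2) conn_nonempty[OF Z(1)] x by blast+
  then have "\<not> card (nbrs E (Y \<union> Z) \<inter> rim) \<le> 1"
    using mx[of "Y \<union> Z"] YZ XZ DYZ(1) by metis
  then have A1: "card (nbrs E (?X - Z) \<inter> rim) \<le> 1"
    using split_rim[of "Y \<union> Z" "?X - Z"] YZ XZ DYZ Y Z(2) by auto
  have "rim \<subseteq> (nbrs E Y \<inter> rim) \<union> (nbrs E Z \<inter> rim) \<union> (nbrs E (?X - Z) \<inter> rim)"
  proof
    fix r assume r: "r \<in> rim"
    then obtain v where v: "v \<in> D" "(v, r) \<in> E" using rim_nbrs_D unfolding nbrs_def by blast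
    have "r \<notin> D" using r rim_D(2) by blast
    then have in_nbrs: "r \<in> nbrs E W" if "v \<in> W" "W \<subseteq> D" for W
      using that v by (intro nbrsI) auto
    consider "v \<in> Y" | "v \<in> Z" | "v \<in> ?X - Z" using v(1) by blast
    then show "r \<in> (nbrs E Y \<inter> rim) \<union> (nbrs E Z \<inter> rim) \<union> (nbrs E (?X - Z) \<inter> rim)"
      by cases (use r Y Z(2) in_nbrs[of Y] in_nbrs[of Z] in_nbrs[of "?X - Z"] in auto)
  qed
  then have "card rim \<le> card ((nbrs E Y \<inter> rim) \<union> (nbrs E Z \<inter> rim) \<union> (nbrs E (?X - Z) \<inter> rim))"
    using finite_nbrs by (intro card_mono) auto
  also have "\<dots> \<le> card (nbrs E Y \<inter> rim) + card (nbrs E Z \<inter> rim) + card (nbrs E (?X - Z) \<inter> rim)"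
    using card_Un_le[of "nbrs E Y \<inter> rim" "nbrs E Z \<inter> rim"]
      card_Un_le[of "(nbrs E Y \<inter> rim) \<union> (nbrs E Z \<inter> rim)" "nbrs E (?X - Z) \<inter> rim"] by linarith
  finally show False using Y Z1 A1 card_rim by linarith
qed

end

section \<open>Common neighbours around a vertex of degree three\<close>

definition walk :: "'a rel \<Rightarrow> 'a set \<Rightarrow> 'a \<Rightarrow> 'a \<Rightarrow> (nat \<Rightarrow> 'a) \<Rightarrow> nat \<Rightarrow> bool" where
  "walk E K a b p m \<longleftrightarrow>
     p 0 = a \<and> p m = b \<and> (\<forall>i\<le>m. p i \<in> K) \<and> (\<forall>i<m. (p i, p (Suc i)) \<in> E)"

lemma conn_walk:
  assumes "conn E K" "a \<in> K" "b \<in> K"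
  shows "\<exists>m p. walk E K a b p m"
proof (rule ccontr)
  assume neg: "\<not> ?thesis"
  let ?S = "{x \<in> K. \<exists>m p. walk E K a x p m}"
  have "walk E K a a (\<lambda>_. a) 0" using assms(2) by (simp add: walk_def)
  then have "a \<in> ?S" using assms(2) by blast
  moreover have "b \<notin> ?S" using neg by blast
  ultimately have "?S \<subset> K" "?S \<noteq> {}" using assms(3) by blast+
  then obtain x where "x \<in> K - ?S" "x \<in> E `` ?S" by (rule conn_grow[OF assms(1)])
  then obtain y p m where y: "(y, x) \<in> E" "walk E K a y p m" "x \<in> K" "x \<notin> ?S" by blast
  have "walk E K a x (p(Suc m := x)) (Suc m)"
    using y unfolding walk_def by (auto simp: less_Suc_eq le_Suc_eq)
  then show False using y(3,4) by blast
qed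

lemma shortest_walk:
  assumes "conn E K" "a \<in> K" "b \<in> K"
  obtains p m where "walk E K a b p m" "\<And>q n. walk E K a b q n \<Longrightarrow> m \<le> n"
proof -
  let ?P = "\<lambda>m. \<exists>p. walk E K a b p m"
  have "\<exists>m. ?P m" by (rule conn_walk[OF assms])
  then have "?P (LEAST m. ?P m)" by (rule LeastI_ex)
  then obtain p where "walk E K a b p (LEAST m. ?P m)" by blast
  moreover have "(LEAST m. ?P m) \<le> n" if "walk E K a b q n" for q n
    using that by (intro Least_le) blast
  ultimately show thesis using that by blast
qed

lemma shortest_walk_inj:
  assumes w: "walk E K a b p m" and mn: "\<And>q n. walk E K a b q n \<Longrightarrow> m \<le> n"
    and ij: "i < j" "j \<le> m"
  shows "p i \<noteq> p j"
proof
  assume eq: "p i = p j"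
  let ?q = "\<lambda>k. if k \<le> i then p k else p (k + (j - i))"
  have "walk E K a b ?q (m - (j - i))"
    unfolding walk_def
  proof (intro conjI allI impI)
    show "?q 0 = a" using w by (simp add: walk_def)
    \<comment> \<open>For \<open>j = m\<close> nothing follows the shortcut: the shortened walk
      stops at \<open>p i\<close>, which equals \<open>b\<close>.\<close>
    show "?q (m - (j - i)) = b"
    proof (cases "j = m")
      case True
      then have "m - (j - i) = i" using ij by simp
      then show ?thesis using w eq True by (simp add: walk_def)
    next
      case False
      then have "\<not> m - (j - i) \<le> i" "m - (j - i) + (j - i) = m" using ij by linarith+
      then show ?thesis using w by (simp add: walk_def)
    qed
    show "?q k \<in> K" if "k \<le> m - (j - i)" for k using w that ij by (auto simp: walk_def)
    show "(?q k, ?q (Suc k)) \<in> E" if k: "k < m - (j - i)" for k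
    proof (cases "k = i")
      case True
      have "j < m" using k True ij by simp
      then have "(p j, p (Suc j)) \<in> E" using w by (simp add: walk_def)
      then show ?thesis using True eq ij by simp
    next
      case False
      have e: "(p l, p (Suc l)) \<in> E" if "l < m" for l using w that by (simp add: walk_def)
      show ?thesis using False k ij e[of k] e[of "k + (j - i)"] by auto
    qed
  qed
  then show False using mn[of ?q "m - (j - i)"] ij by simp
qed

lemma shortest_walk_chordless:
  assumes w: "walk E K a b p m" and mn: "\<And>q n. walk E K a b q n \<Longrightarrow> m \<le> n"
    and ij: "Suc i < j" "j \<le> m"
  shows "(p i, p j) \<notin> E"
proof
  assume eq: "(p i, p j) \<in> E"
  let ?d = "j - Suc i"
  let ?q = "\<lambda>k. if k \<le> i then p k else p (k + ?d)"
  have "walk E K a b ?q (m - ?d)"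
    unfolding walk_def
  proof (intro conjI allI impI)
    show "?q 0 = a" using w by (simp add: walk_def)
    have "\<not> m - ?d \<le> i" "m - ?d + ?d = m" using ij by linarith+
    then show "?q (m - ?d) = b" using w by (simp add: walk_def)
    show "?q k \<in> K" if "k \<le> m - ?d" for k using w that ij by (auto simp: walk_def)
    show "(?q k, ?q (Suc k)) \<in> E" if k: "k < m - ?d" for k
    proof (cases "k = i")
      case True
      then show ?thesis using eq ij by simp
    next
      case False
      have e: "(p l, p (Suc l)) \<in> E" if "l < m" for l using w that by (simp add: walk_def)
      show ?thesis using False k ij e[of k] e[of "k + ?d"] by auto
    qed
  qed
  then show False using mn[of ?q "m - ?d"] ij by simp
qed

section \<open>Configurations around a vertex of degree three\<close>

context critical
begin

lemma common_nbr:
  assumes u: "u \<in> V" "nbrs E {u} = {a, b, c}" and abc: "a \<noteq> b" "a \<noteq> c" "b \<noteq> c"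
  shows "\<exists>z. z \<noteq> u \<and> (a, z) \<in> E \<and> (b, z) \<in> E"
proof (rule ccontr)
  assume neg: "\<not> ?thesis"
  have ue: "(u, x) \<in> E \<longleftrightarrow> x \<in> {a, b, c}" for x using nbrs_singleton[of x u] u(2) by simp
  then have inV: "a \<in> V" "b \<in> V" "c \<in> V" "a \<noteq> u" "b \<noteq> u" "c \<noteq> u" using sub irr by blast+
  have "card (nbrs E {u}) = 3" using u(2) abc by simp
  then have ab: "(a, b) \<notin> E" using deg3_independent[OF u(1), of a b] u(2) by simp
  have u_nbr: "u \<notin> nbrs E X" if "X \<inter> {a, b, c} = {}" for X
  proof
    assume "u \<in> nbrs E X"
    then have "touch E {u} X" by (rule touch_nbrs)
    then show False using that ue unfolding touch_def by blast
  qed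
  let ?P = "\<lambda>D. conn E D \<and> c \<in> D \<and> D \<subseteq> V - {u, a, b} \<and>
    (\<exists>K. conn E K \<and> K \<subseteq> V - {u} - D \<and> a \<in> K \<and> b \<in> K)"
  \<comment> \<open>By three-connectivity \<open>{u, c}\<close> does not separate \<open>a\<close>
    from \<open>b\<close>, so a candidate for \<open>D\<close> exists.\<close>
  have P0: "?P {c}"
  proof -
    obtain K where K: "conn E K" "{a} \<subseteq> K" "K \<subseteq> V - {u, c}" "nbrs E K \<inter> (V - {u, c}) = {}"
      by (rule component_exists[of "V - {u, c}" E "{a}"]) (use fin symE inV abc in auto)
    have "nbrs E K \<subseteq> {u, c}" using K(4) nbrs_subset[of K] by blast
    then have "card (nbrs E K) \<le> card {u, c}" by (intro card_mono) auto
    then have "card (nbrs E K) \<le> 2" using inV(6) by simp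
    then have "K \<union> nbrs E K = V" using three_connected[of K] K(2,3) by fastforce
    then have "b \<in> K" using \<open>nbrs E K \<subseteq> {u, c}\<close> inV abc by blast
    then show ?thesis using K inV abc by auto
  qed
  obtain D where D: "?P D" and mx: "\<And>D'. ?P D' \<Longrightarrow> D \<subseteq> D' \<Longrightarrow> D' = D"
    by (rule maximal_subset_exists[OF fin, of ?P "{c}"]) (rule P0, blast, rule that)
  have cD: "conn E D" and "c \<in> D" and DV: "D \<subseteq> V - {u, a, b}" using D by blast+
  obtain K1 where K1: "conn E K1" "K1 \<subseteq> V - {u} - D" "a \<in> K1" "b \<in> K1" using D by blast
  obtain K where K: "conn E K" "K1 \<subseteq> K" "K \<subseteq> V - {u} - D" "nbrs E K \<inter> (V - {u} - D) = {}"
    by (rule component_exists[OF _ K1(1,2) symE]) (use fin in auto)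
  have aK: "a \<in> K" "b \<in> K" using K(2) K1 by blast+
  \<comment> \<open>Another component \<open>R\<close> outside \<open>u\<close>, \<open>D\<close>
    and \<open>K\<close> would have all its neighbours in \<open>D\<close>, so
    \<open>D \<union> R\<close> would be a larger candidate.\<close>
  have V_eq: "V = insert u (D \<union> K)"
  proof (rule ccontr)
    assume "V \<noteq> insert u (D \<union> K)"
    moreover have "insert u (D \<union> K) \<subseteq> V" using u(1) DV K(3) by blast
    ultimately have "V - insert u (D \<union> K) \<noteq> {}" by blast
    then obtain R where R: "conn E R" "R \<subseteq> V - insert u (D \<union> K)"
      "nbrs E R \<inter> (V - insert u (D \<union> K)) = {}"
      using component_in[of "V - insert u (D \<union> K)"] by blast
    have "R \<inter> {a, b, c} = {}" using R(2) aK \<open>c \<in> D\<close> by blast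
    then have uR: "u \<notin> nbrs E R" by (rule u_nbr)
    have "nbrs E R \<inter> K = {}"
    proof (rule ccontr)
      assume "nbrs E R \<inter> K \<noteq> {}"
      then obtain k r where kr: "k \<in> K" "r \<in> R" "(k, r) \<in> E"
        using touch_nbrs[of _ R] unfolding touch_def by blast
      then have "r \<in> nbrs E K" using R(2) by (intro nbrsI[of k]) auto
      then show False using K(4) R(2) kr(2) by blast
    qed
    then have RD: "nbrs E R \<subseteq> D" using R(3) uR nbrs_subset[of R] by blast
    have "3 \<le> card (nbrs E R)"
    proof (rule three_connected)
      show "R \<union> nbrs E R \<noteq> V" using u(1) uR R(2) by blast
    qed (use R conn_nonempty in auto)
    then have "nbrs E R \<noteq> {}" by auto
    then obtain d where d: "d \<in> nbrs E R" "d \<in> D" using RD by blast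
    have "touch E {d} R" by (rule touch_nbrs[OF d(1)])
    then have "touch E D R" by (rule touch_superset) (use d(2) in auto)
    then have "conn E (D \<union> R)" by (intro conn_Un[OF cD R(1) symE]) simp
    moreover have "D \<union> R \<subseteq> V - {u, a, b}" using DV R(2) aK by blast
    moreover have "K \<subseteq> V - {u} - (D \<union> R)" using K(3) R(2) by blast
    ultimately have "?P (D \<union> R)" using \<open>c \<in> D\<close> K(1) aK by blast
    then have "D \<union> R = D" by (rule mx) simp
    then show False using R(2) conn_nonempty[OF R(1)] by blast
  qed
  \<comment> \<open>Maximality of \<open>D\<close>: a vertex of \<open>K\<close> next to
    \<open>D\<close> can be moved into \<open>D\<close> if a connected subset of \<open>K\<close>
    containing \<open>a\<close> and \<open>b\<close> avoids it. So such vertices lie on every path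
    from \<open>a\<close> to \<open>b\<close> in \<open>K\<close>.\<close>
  have cut: False if x: "x \<in> K" "x \<notin> {a, b}" "touch E {x} D"
    and Q: "conn E Q" "Q \<subseteq> K - {x}" "a \<in> Q" "b \<in> Q" for x Q
  proof -
    have "conn E (insert x D)" by (rule conn_insert_touch[OF cD symE x(3)])
    moreover have "insert x D \<subseteq> V - {u, a, b}" using DV x(1,2) K(3) by blast
    moreover have "Q \<subseteq> V - {u} - insert x D" using Q(2) K(3) by blast
    ultimately have "?P (insert x D)" using \<open>c \<in> D\<close> Q by blast
    then have "insert x D = D" by (rule mx) blast
    then show False using x(1) K(3) by blast
  qed
  obtain p m where w: "walk E K a b p m" and mn: "\<And>q n. walk E K a b q n \<Longrightarrow> m \<le> n"
    by (rule shortest_walk[OF K(1) aK]) (rule that)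
  have pK: "p i \<in> K" if "i \<le> m" for i using w that by (simp add: walk_def)
  have ends: "p 0 = a" "p m = b" using w by (simp_all add: walk_def)
  have inj_less: "p i \<noteq> p j" if "i < j" "j \<le> m" for i j
    by (rule shortest_walk_inj[OF w _ that]) (rule mn)
  have chordless: "(p i, p j) \<notin> E" if "Suc i < j" "j \<le> m" for i j
    by (rule shortest_walk_chordless[OF w _ that]) (rule mn)
  have inj: "p i = p j \<longleftrightarrow> i = j" if "i \<le> m" "j \<le> m" for i j
  proof
    assume "p i = p j"
    then show "i = j"
      using inj_less[of i j] inj_less[of j i] that
      by (metis linorder_neqE_nat)
  qed simp
  have step: "(p i, p (Suc i)) \<in> E" if "i < m" for i using w that by (simp add: walk_def)
  have edge: "(p i, p j) \<in> E \<longleftrightarrow> j = Suc i \<or> i = Suc j" if ij: "i \<le> m" "j \<le> m" for i j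
  proof
    assume e: "(p i, p j) \<in> E"
    then have "\<not> Suc i < j" using chordless[of i j] ij by blast
    moreover have "\<not> Suc j < i"
      using chordless[of j i] ij edge_sym[OF e] by blast
    moreover have "i \<noteq> j" using e irr by blast
    ultimately show "j = Suc i \<or> i = Suc j" by linarith
  next
    assume "j = Suc i \<or> i = Suc j"
    then show "(p i, p j) \<in> E" using step[of i] step[of j] ij edge_sym by auto
  qed
  have seg: "conn E (p ` {i..j})" if "i \<le> j" "j \<le> m" for i j
    by (rule conn_path_image[OF symE]) (use that edge in auto)
  have on_path: "x \<in> p ` {..m}" if x: "x \<in> K" "x \<notin> {a, b}" "touch E {x} D" for x
  proof (rule ccontr)
    assume "x \<notin> p ` {..m}"
    then have "p ` {0..m} \<subseteq> K - {x}" using pK by auto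
    moreover have "a \<in> p ` {0..m}" "b \<in> p ` {0..m}" using ends by force+
    ultimately show False using cut[OF x seg[of 0 m]] by simp
  qed
  \<comment> \<open>A component \<open>X\<close> of the vertices violating this has all its
    neighbours in \<open>K\<close>, and each of them is an end of the path or is next to
    \<open>D\<close> and so on the path by \<open>on_path\<close>. Three-connectivity yields three
    of them.\<close>
  have inner: "touch E {v} D" if v: "v \<in> K" "v \<notin> {a, b}" for v
  proof (rule ccontr)
    assume nt: "\<not> touch E {v} D"
    define W where "W = {x \<in> K. x \<notin> {a, b} \<and> \<not> touch E {x} D}"
    have vW: "v \<in> W" using v nt by (simp add: W_def)
    have WV: "W \<subseteq> V" using K(3) by (auto simp: W_def)
    obtain X where X: "conn E X" "{v} \<subseteq> X" "X \<subseteq> W" "nbrs E X \<inter> W = {}"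
      by (rule component_exists[of W E "{v}"]) (use vW symE finite_subset[OF WV fin] in auto)
    have XK: "X \<subseteq> K" "a \<notin> X" "b \<notin> X" using X(3) by (auto simp: W_def)
    have "c \<notin> X" using XK(1) K(3) \<open>c \<in> D\<close> by blast
    then have uX: "u \<notin> nbrs E X" using XK by (intro u_nbr) auto
    have DX: "x \<notin> D" if x: "x \<in> nbrs E X" for x
    proof
      assume "x \<in> D"
      obtain y where y: "y \<in> X" "(x, y) \<in> E" using touch_nbrs[OF x] by (auto simp: touch_def)
      then have "touch E {y} D" using \<open>x \<in> D\<close> edge_sym by (auto simp: touch_def)
      then show False using X(3) y(1) by (auto simp: W_def)
    qed
    have nK: "nbrs E X \<subseteq> K" using uX DX nbrs_subset[of X] V_eq by blast
    have nP: "nbrs E X \<subseteq> p ` {..m}"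
    proof
      fix x assume x: "x \<in> nbrs E X"
      then have "x \<notin> W" "x \<in> K" using X(4) nK by blast+
      then consider "x = a" | "x = b" | "x \<notin> {a, b}" "touch E {x} D" by (auto simp: W_def)
      then show "x \<in> p ` {..m}"
      proof cases
        case 3
        then show ?thesis using on_path \<open>x \<in> K\<close> by blast
      qed (use ends in force)+
    qed
    define I where "I = {i. i \<le> m \<and> p i \<in> nbrs E X}"
    have finI: "finite I" unfolding I_def by simp
    have "3 \<le> card (nbrs E X)"
    proof (rule three_connected)
      show "X \<union> nbrs E X \<noteq> V" using u(1) uX XK(1) K(3) by blast
    qed (use X WV in auto)
    also have "\<dots> \<le> card (p ` I)"
      by (rule card_mono) (use finI nP in \<open>auto simp: I_def\<close>)
    also have "\<dots> \<le> card I" by (rule card_image_le[OF finI])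
    finally have I3: "3 \<le> card I" .
    obtain i1 i2 i3 where I: "i1 \<in> I" "i2 \<in> I" "i3 \<in> I" "i1 \<noteq> i2" "i1 \<noteq> i3" "i2 \<noteq> i3"
      by (rule three_distinct[OF I3]) (rule that)
    obtain i l j where ilj: "i < l" "l < j" "i \<in> I" "l \<in> I" "j \<in> I"
    proof -
      consider "i1 < i2 \<and> i2 < i3" | "i1 < i3 \<and> i3 < i2" | "i2 < i1 \<and> i1 < i3"
        | "i2 < i3 \<and> i3 < i1" | "i3 < i1 \<and> i1 < i2" | "i3 < i2 \<and> i2 < i1"
        using I(4-6) by linarith
      then show thesis using I that by cases blast+
    qed
    have le: "i \<le> m" "l \<le> m" "j \<le> m" and nb: "p i \<in> nbrs E X" "p l \<in> nbrs E X" "p j \<in> nbrs E X"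
      using ilj by (auto simp: I_def)
    \<comment> \<open>The path is rerouted through \<open>X\<close> from \<open>p i\<close> to
      \<open>p j\<close>. This bypasses \<open>p l\<close>, which is next to \<open>D\<close>,
      against \<open>cut\<close>.\<close>
    let ?Q = "p ` {0..i} \<union> X \<union> p ` {j..m}"
    have tX: "touch E X {p k}" if "p k \<in> nbrs E X" for k
      using touch_nbrs[OF that] touch_sym[OF symE] by blast
    have "touch E (p ` {0..i}) X"
      using touch_nbrs[OF nb(1)] by (rule touch_superset) auto
    then have c1: "conn E (p ` {0..i} \<union> X)" using seg[of 0 i] le X(1) symE by (intro conn_Un) auto
    have "touch E X (p ` {j..m})"
      using tX[OF nb(3)] by (rule touch_superset) (use le in auto)
    then have "conn E ?Q" by (intro conn_Un[OF c1 seg[OF le(3) order_refl] symE]) simp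
    moreover have "p l \<notin> p ` {0..i}" "p l \<notin> p ` {j..m}" using inj ilj le by auto
    moreover have "p l \<notin> X" using nb(2) by (auto simp: nbrs_def)
    moreover have "?Q \<subseteq> K" using pK le XK(1) by auto
    moreover have "a \<in> ?Q" "b \<in> ?Q" using ends le by force+
    moreover have lab: "p l \<notin> {a, b}"
      using inj[of l 0] inj[of l m] ends le ilj by auto
    moreover have "touch E {p l} D"
      using X(4) nb(2) lab pK[OF le(2)] by (auto simp: W_def)
    ultimately show False using cut[of "p l" ?Q] pK[OF le(2)] by blast
  qed
  have K_eq: "K = p ` {..m}"
  proof
    show "K \<subseteq> p ` {..m}"
    proof
      fix x assume "x \<in> K"
      then show "x \<in> p ` {..m}"
        using on_path[of x] inner[of x] ends by (cases "x \<in> {a, b}") force+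
    qed
  qed (use pK in auto)
  have m3: "3 \<le> m"
  proof (rule ccontr)
    assume "\<not> 3 \<le> m"
    then consider "m = 0" | "m = 1" | "m = 2" by linarith
    then show False
    proof cases
      case 1
      then show False using ends abc(1) by simp
    next
      case 2
      then show False using step[of 0] ends ab by simp
    next
      case 3
      then have "(a, p 1) \<in> E" "(b, p 1) \<in> E" using edge[of 0 1] edge[of 2 1] ends by simp_all
      moreover have "p 1 \<noteq> u" using pK[of 1] K(3) 3 by auto
      ultimately show False using neg by blast
    qed
  qed
  \<comment> \<open>An end of the path has one neighbour on the path and otherwise at most
    \<open>u\<close> outside \<open>D\<close>, so its degree of at least three forces a neighbour in
    \<open>D\<close>.\<close>
  have end_touch: "touch E {p i} D"
    if i: "i \<le> m" and N: "\<And>j. j \<le> m \<Longrightarrow> (p i, p j) \<in> E \<Longrightarrow> j = k" for i k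
  proof (rule ccontr)
    assume nt: "\<not> touch E {p i} D"
    have "nbrs E {p i} \<subseteq> {u, p k}"
    proof
      fix x assume "x \<in> nbrs E {p i}"
      then have x: "(p i, x) \<in> E" by (simp add: nbrs_singleton)
      then have "x \<in> V" "x \<notin> D" using sub nt by (auto simp: touch_def)
      then have "x = u \<or> x \<in> p ` {..m}" using V_eq K_eq by blast
      then show "x \<in> {u, p k}" using N x by blast
    qed
    then have "card (nbrs E {p i}) \<le> card {u, p k}" by (intro card_mono) auto
    also have "\<dots> \<le> 2" by (simp add: card_insert_if)
    finally show False using deg_ge_3[of "p i"] pK[OF i] K(3) by auto
  qed
  have D_touch: "touch E D {p i}" if i: "i \<le> m" for i
  proof -
    consider "0 < i" "i < m" | "i = 0" | "i = m"
      using i by linarith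
    then have "touch E {p i} D"
    proof cases
      case 1
      then have "p i \<notin> {a, b}" using inj[of i 0] inj[of i m] ends i by auto
      then show ?thesis using inner pK[OF i] by blast
    next
      case 2
      show ?thesis by (rule end_touch[of i 1]) (use 2 edge[of 0] in auto)
    next
      case 3
      show ?thesis by (rule end_touch[of i "m - 1"]) (use 3 edge[of m] in auto)
    qed
    then show ?thesis using touch_sym[OF symE] by blast
  qed
  interpret ear V E u a b c D p m
  proof
    show "V = insert u (D \<union> p ` {..m})" using V_eq K_eq by simp
    show "p i \<notin> D" "p i \<noteq> u" if "i \<le> m" for i using pK[OF that] K(3) by auto
    show "u \<notin> D" using DV by blast
  qed (use u cD \<open>c \<in> D\<close> inj ends m3 edge D_touch in auto)
  show False by (rule ear_impossible)
qed

text \<open>If \<open>z\<close> has no further neighbour, it is a twin of \<open>u\<close>.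
  Otherwise let \<open>Y\<close> be a component behind \<open>z\<close>. If it is attached to all of
  \<open>a\<close>, \<open>b\<close>, \<open>c\<close>, then \<open>a\<close> and \<open>c\<close>
  are the nonadjacent pair against \<open>Y\<close>, \<open>z\<close>, \<open>{b, u}\<close>; if
  not, its three attachments contain \<open>z\<close> and a neighbour of \<open>z\<close>, against
  the independence of separators.\<close>

lemma no_triple_common_nbr:
  assumes u: "u \<in> V" "nbrs E {u} = {a, b, c}" and abc: "a \<noteq> b" "a \<noteq> c" "b \<noteq> c"
    and z: "z \<noteq> u" "(a, z) \<in> E" "(b, z) \<in> E" "(c, z) \<in> E"
  shows False
proof -
  have ue: "(u, x) \<in> E \<longleftrightarrow> x \<in> {a, b, c}" for x using nbrs_singleton[of x u] u(2) by simp
  then have inV: "a \<in> V" "b \<in> V" "c \<in> V" "a \<noteq> u" "b \<noteq> u" "c \<noteq> u" using sub irr by blast+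
  have ze: "(z, a) \<in> E" "(z, b) \<in> E" "(z, c) \<in> E" using z(2-4) edge_sym by blast+
  have zV: "z \<in> V" "z \<noteq> a" "z \<noteq> b" "z \<noteq> c" using z(2-4) sub irr by auto
  have card3: "card (nbrs E {u}) = 3" using u(2) abc by simp
  have ind: "(x, y) \<notin> E" if "x \<in> {a, b, c}" "y \<in> {a, b, c}" for x y
    using deg3_independent[OF u(1) card3] u(2) that by blast
  have "(u, z) \<notin> E" using ue zV by simp
  then have zu: "(z, u) \<notin> E" using edge_sym by blast
  have "nbrs E {z} \<subseteq> {a, b, c}"
  proof (rule ccontr)
    assume "\<not> nbrs E {z} \<subseteq> {a, b, c}"
    then obtain w where w: "(z, w) \<in> E" "w \<notin> {a, b, c}" using nbrs_singleton by blast
    let ?W = "V - {u, z, a, b, c}"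
    have wW: "w \<in> ?W" using w zu sub irr by auto
    obtain Y where Y: "conn E Y" "{w} \<subseteq> Y" "Y \<subseteq> ?W" "nbrs E Y \<inter> ?W = {}"
      by (rule component_exists[of ?W E "{w}"]) (use wW fin symE in auto)
    have uY: "\<not> touch E {u} Y" using Y(3) ue unfolding touch_def by blast
    then have "u \<notin> nbrs E Y" using touch_nbrs by blast
    then have NY: "nbrs E Y \<subseteq> {z, a, b, c}" using Y(4) nbrs_subset[of Y] by blast
    have zY: "touch E {z} Y" using w(1) Y(2) by (auto simp: touch_def)
    have "(w, z) \<in> E" by (rule edge_sym[OF w(1)])
    then have zN: "z \<in> nbrs E Y" using Y(2,3) by (intro nbrsI[of w]) auto
    have YV: "Y \<union> nbrs E Y \<noteq> V" using u(1) \<open>u \<notin> nbrs E Y\<close> Y(3) by blast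
    then have 3: "3 \<le> card (nbrs E Y)" using three_connected[OF conn_nonempty[OF Y(1)] _ YV] Y(3) by blast
    show False
    proof (cases "{a, b, c} \<subseteq> nbrs E Y")
      case True
      then have t: "touch E {a} Y" "touch E {b} Y" "touch E {c} Y" by (auto intro: touch_nbrs)
      have ub: "conn E {b, u}" using ue edge_sym by (intro conn_insert_touch[OF conn_singleton symE]) auto
      have au: "(a, u) \<in> E" "(c, u) \<in> E" using ue edge_sym by blast+
      show False
      proof (rule no_model[of "{a}" "{c}" Y "{z}" "{b, u}"])
        show "touch E Y {z}" "touch E Y {b, u}"
          using zY t(2) touch_sym[OF symE, of Y] by (simp_all add: touch_pair)
        show "touch E {a} {b, u}" "touch E {c} {b, u}" "touch E {z} {b, u}"
          using au ze by (simp_all add: touch_pair)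
      qed (use u(1) inV zV z abc t ub ind Y(1,3) in auto)
    next
      case False
      then obtain s where s: "s \<in> {a, b, c}" "s \<notin> nbrs E Y" by blast
      have "nbrs E Y \<subseteq> {z, a, b, c} - {s}" using NY s by blast
      moreover have "card ({z, a, b, c} - {s}) = 3" using s(1) zV abc by auto
      ultimately have eq: "nbrs E Y = {z, a, b, c} - {s}"
        using 3 by (intro card_seteq) auto
      then have "card (nbrs E Y) = 3" using \<open>card ({z, a, b, c} - {s}) = 3\<close> by simp
      moreover obtain t where t: "t \<in> {a, b, c}" "t \<noteq> s" using abc by blast
      then have "t \<in> nbrs E Y" using eq by blast
      moreover have "(z, t) \<in> E" using t(1) ze by blast
      ultimately show False
        using independent_separator[OF conn_nonempty[OF Y(1)] _ YV _ zN, of t] Y(3) by blast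
    qed
  qed
  then have "nbrs E {z} = {a, b, c}" using ze by (auto simp: nbrs_singleton)
  then show False using no_twins[OF u(1) zV(1)] u(2) z(1) card3 by metis
qed

text \<open>The pairwise common neighbours are distinct and close up to a hexagon \<open>a\<close>,
  \<open>w\<close>, \<open>b\<close>, \<open>x\<close>, \<open>c\<close>, \<open>y\<close>. Each of
  its two perfect matchings offers three edges as the triangle of a \<open>K5_minus\<close>, with
  \<open>u\<close> and a component behind the hexagon as the nonadjacent pair.\<close>

lemma impossible: False
proof -
  obtain u where u: "u \<in> V" "card (nbrs E {u}) = 3" using deg3_exists by blast
  then obtain a b c where N: "nbrs E {u} = {a, b, c}" and abc: "a \<noteq> b" "a \<noteq> c" "b \<noteq> c"
    by (auto simp: card_3_iff)
  have ue: "(u, x) \<in> E \<longleftrightarrow> x \<in> {a, b, c}" for x using nbrs_singleton[of x u] N by simp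
  then have inV: "a \<in> V" "b \<in> V" "c \<in> V" "a \<noteq> u" "b \<noteq> u" "c \<noteq> u" using sub irr by blast+
  have ind: "(p, q) \<notin> E" if "p \<in> {a, b, c}" "q \<in> {a, b, c}" for p q
    using deg3_independent[OF u] N that by blast
  have perm: "{a, b, c} = {b, c, a}" "{a, b, c} = {a, c, b}" by auto
  obtain w where w: "w \<noteq> u" "(a, w) \<in> E" "(b, w) \<in> E"
    using common_nbr[OF u(1) N abc] by blast
  obtain x where x: "x \<noteq> u" "(b, x) \<in> E" "(c, x) \<in> E"
    using common_nbr[OF u(1) N[unfolded perm(1)]] abc by metis
  obtain y where y: "y \<noteq> u" "(a, y) \<in> E" "(c, y) \<in> E"
    using common_nbr[OF u(1) N[unfolded perm(2)]] abc by metis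
  have no3: False if "z \<noteq> u" "(a, z) \<in> E" "(b, z) \<in> E" "(c, z) \<in> E" for z
    by (rule no_triple_common_nbr[OF u(1) N abc that])
  have non: "(c, w) \<notin> E" "(a, x) \<notin> E" "(b, y) \<notin> E" using no3 w x y by blast+
  have xyw: "x \<noteq> y" "x \<noteq> w" "y \<noteq> w" using non w x y by auto
  have out: "z \<in> V \<and> z \<notin> {a, b, c}" if "z \<in> {x, y, w}" for z
    using that w x y ind sub by blast
  let ?W = "{a, b, c, x, y, w}"
  have WV: "?W \<subseteq> V" using inV out by blast
  \<comment> \<open>The edges \<open>p1 q1\<close>, \<open>p2 q2\<close>, \<open>p3 q3\<close> are
    the matching, the last three assumptions the other edges of the hexagon. Both matchings are
    instances.\<close>
  have hexagon: False
    if "conn E R" "R \<subseteq> V - {u} - ?W" "touch E R {p1, q1}" "touch E R {p2, q2}" "touch E R {p3, q3}"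
      "{p1, p2, p3} = {a, b, c}" "{q1, q2, q3} = {x, y, w}" "(p1, q1) \<in> E" "(p2, q2) \<in> E" "(p3, q3) \<in> E"
      "(p2, q1) \<in> E" "(p3, q2) \<in> E" "(p1, q3) \<in> E" for R p1 q1 p2 q2 p3 q3
  proof -
    have p: "p1 \<noteq> p2" "p1 \<noteq> p3" "p2 \<noteq> p3"
    proof -
      have "card {p1, p2, p3} = 3" unfolding that(6) using abc by simp
      then show "p1 \<noteq> p2" "p1 \<noteq> p3" "p2 \<noteq> p3" by (auto simp: card_insert_if split: if_splits)
    qed
    have q: "q1 \<noteq> q2" "q1 \<noteq> q3" "q2 \<noteq> q3"
    proof -
      have "card {q1, q2, q3} = 3" unfolding that(7) using xyw by simp
      then show "q1 \<noteq> q2" "q1 \<noteq> q3" "q2 \<noteq> q3" by (auto simp: card_insert_if split: if_splits)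
    qed
    have P: "p \<in> V \<and> p \<noteq> u \<and> (u, p) \<in> E \<and> p \<notin> R \<and> p \<notin> {q1, q2, q3}" if "p \<in> {p1, p2, p3}" for p
      using that inV ue out \<open>R \<subseteq> V - {u} - ?W\<close> unfolding \<open>{p1, p2, p3} = {a, b, c}\<close> \<open>{q1, q2, q3} = {x, y, w}\<close> by blast
    have Q: "q \<in> V \<and> q \<noteq> u \<and> q \<notin> R" if "q \<in> {q1, q2, q3}" for q
      using that out w(1) x(1) y(1) \<open>R \<subseteq> V - {u} - ?W\<close> unfolding \<open>{q1, q2, q3} = {x, y, w}\<close> by blast
    have cc: "conn E {p, q}" if "(p, q) \<in> E" for p q
      using that by (intro conn_insert_touch[OF conn_singleton symE]) simp
    have uR: "\<not> touch E {u} R" using that(2) ue unfolding touch_def by blast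
    show False
    proof (rule no_model[of "{u}" R "{p1, q1}" "{p2, q2}" "{p3, q3}"])
      show "touch E {u} {p1, q1}" "touch E {u} {p2, q2}" "touch E {u} {p3, q3}"
        using P by (simp_all add: touch_pair)
      show "touch E {p1, q1} {p2, q2}" "touch E {p2, q2} {p3, q3}" "touch E {p1, q1} {p3, q3}"
        using that(11-13) edge_sym[OF that(11)] edge_sym[OF that(12)] by (simp_all add: touch_pair)
      show "conn E {p1, q1}" "conn E {p2, q2}" "conn E {p3, q3}" using cc that(8-10) by blast+
      show "{p1, q1} \<subseteq> V" "{p2, q2} \<subseteq> V" "{p3, q3} \<subseteq> V" using P Q by simp_all
      show "{u} \<inter> {p1, q1} = {}" "{u} \<inter> {p2, q2} = {}" "{u} \<inter> {p3, q3} = {}"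
        using P[of p1] P[of p2] P[of p3] Q[of q1] Q[of q2] Q[of q3] by auto
      show "R \<inter> {p1, q1} = {}" "R \<inter> {p2, q2} = {}" "R \<inter> {p3, q3} = {}"
        using P[of p1] P[of p2] P[of p3] Q[of q1] Q[of q2] Q[of q3] by auto
      show "{p1, q1} \<inter> {p2, q2} = {}" "{p1, q1} \<inter> {p3, q3} = {}" "{p2, q2} \<inter> {p3, q3} = {}"
        using p q P[of p1] P[of p2] P[of p3] by auto
    qed (use that(1-5) u(1) uR in auto)
  qed
  show False
  proof (cases "{u} \<union> ?W = V")
    case False
    obtain R where R: "conn E R" "R \<subseteq> V - {u} - ?W" "nbrs E R \<subseteq> ?W" "3 \<le> card (nbrs E R)"
      by (rule component_outside[of "{u}" ?W]) (use u(1) False WV N that in auto)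
    have RV: "R \<union> nbrs E R \<noteq> V" using R(2,3) u(1) out inV w(1) x(1) y(1) by blast
    \<comment> \<open>\<open>R\<close> has at least three attachments, so three possible ones all
      occur and form a separator, which has to be independent.\<close>
    have sep: False if "nbrs E R \<subseteq> {s, t, r}" "(s, t) \<in> E" for s t r
    proof -
      have "card {s, t, r} \<le> 3" by (simp add: card_insert_if)
      then have "nbrs E R = {s, t, r}" using that(1) R(4) by (intro card_seteq) auto
      moreover have "card (nbrs E R) = 3"
        using R(4) \<open>card {s, t, r} \<le> 3\<close> unfolding calculation by simp
      ultimately show False
        using independent_separator[OF conn_nonempty[OF R(1)] _ RV, of s t] R(2) that(2) by blast
    qed
    have tR: "\<not> touch E R {s, t} \<Longrightarrow> s \<notin> nbrs E R \<and> t \<notin> nbrs E R" for s t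
      using touch_nbrs[of s R] touch_nbrs[of t R] touch_sym[OF symE, of R] by (auto simp: touch_pair)
    have "\<not> (touch E R {a, w} \<and> touch E R {b, x} \<and> touch E R {c, y})"
    proof
      assume "touch E R {a, w} \<and> touch E R {b, x} \<and> touch E R {c, y}"
      then show False using hexagon[OF R(1,2), of a w b x c y] w x y by auto
    qed
    moreover have "\<not> (touch E R {a, y} \<and> touch E R {c, x} \<and> touch E R {b, w})"
    proof
      assume "touch E R {a, y} \<and> touch E R {c, x} \<and> touch E R {b, w}"
      then show False using hexagon[OF R(1,2), of a y c x b w] w x y by auto
    qed
    \<comment> \<open>\<open>R\<close> misses an edge of each matching entirely. Whichever two these
      are, three missed vertices can be chosen, and the other three contain an edge of the
      hexagon.\<close>
    ultimately consider
        "a \<notin> nbrs E R" "w \<notin> nbrs E R" "y \<notin> nbrs E R"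
      | "a \<notin> nbrs E R" "w \<notin> nbrs E R" "b \<notin> nbrs E R"
      | "a \<notin> nbrs E R" "w \<notin> nbrs E R" "c \<notin> nbrs E R"
      | "b \<notin> nbrs E R" "x \<notin> nbrs E R" "a \<notin> nbrs E R"
      | "b \<notin> nbrs E R" "x \<notin> nbrs E R" "w \<notin> nbrs E R"
      | "b \<notin> nbrs E R" "x \<notin> nbrs E R" "c \<notin> nbrs E R"
      | "c \<notin> nbrs E R" "y \<notin> nbrs E R" "a \<notin> nbrs E R"
      | "c \<notin> nbrs E R" "y \<notin> nbrs E R" "b \<notin> nbrs E R"
      | "c \<notin> nbrs E R" "y \<notin> nbrs E R" "x \<notin> nbrs E R"
      using tR by metis
    then show False
    proof cases
      case 1
      then show ?thesis using sep[of b x c] R(3) x by blast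
    next
      case 2
      then show ?thesis using sep[of c x y] R(3) x by blast
    next
      case 3
      then show ?thesis using sep[of b x y] R(3) x by blast
    next
      case 4
      then show ?thesis using sep[of c y w] R(3) y by blast
    next
      case 5
      then show ?thesis using sep[of a y c] R(3) y by blast
    next
      case 6
      then show ?thesis using sep[of a y w] R(3) y by blast
    next
      case 7
      then show ?thesis using sep[of b x w] R(3) x by blast
    next
      case 8
      then show ?thesis using sep[of a w x] R(3) w by blast
    next
      case 9
      then show ?thesis using sep[of a w b] R(3) w by blast
    qed
  next
    \<comment> \<open>With only seven vertices, \<open>a\<close> and \<open>b\<close> have degree
      three, so \<open>w\<close> is adjacent to neither \<open>x\<close> nor \<open>y\<close> and is
      left with degree two.\<close>
    case True
    have V7: "z \<in> {u, a, b, c, x, y, w}" if "(s, z) \<in> E" for s z using that sub True by blast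
    have sym_u: "(a, u) \<in> E" "(b, u) \<in> E" using ue edge_sym by blast+
    have "nbrs E {a} = {u, y, w}"
    proof (intro equalityI subsetI)
      fix z assume "z \<in> nbrs E {a}"
      then have "(a, z) \<in> E" by (simp add: nbrs_singleton)
      then show "z \<in> {u, y, w}" using V7 ind non(2) by blast
    qed (use sym_u w y in \<open>auto simp: nbrs_singleton\<close>)
    moreover have "card {u, y, w} = 3" using w(1) y(1) xyw by simp
    ultimately have yw: "(y, w) \<notin> E" using deg3_independent[OF inV(1), of y w] by simp
    have "nbrs E {b} = {u, x, w}"
    proof (intro equalityI subsetI)
      fix z assume "z \<in> nbrs E {b}"
      then have "(b, z) \<in> E" by (simp add: nbrs_singleton)
      then show "z \<in> {u, x, w}" using V7 ind non(3) by blast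
    qed (use sym_u w x in \<open>auto simp: nbrs_singleton\<close>)
    moreover have "card {u, x, w} = 3" using w(1) x(1) xyw by simp
    ultimately have xw: "(x, w) \<notin> E" using deg3_independent[OF inV(2), of x w] by simp
    have "nbrs E {w} \<subseteq> {a, b}"
    proof
      fix z assume "z \<in> nbrs E {w}"
      then have wz: "(w, z) \<in> E" by (simp add: nbrs_singleton)
      then have "(z, w) \<in> E" by (rule edge_sym)
      moreover have "(u, w) \<notin> E" using ue out by blast
      ultimately show "z \<in> {a, b}" using V7[OF wz] non(1) yw xw irr by blast
    qed
    then have "card (nbrs E {w}) \<le> card {a, b}" by (intro card_mono) auto
    then show False using deg_ge_3[of w] out[of w] abc(1) by simp
  qed
qed

end

theorem model_free_good:
  assumes "fgraph V E" "model_free V E"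
  shows "good V E"
  using assms
proof (induction "card V" arbitrary: V E rule: less_induct)
  case less
  show ?case
  proof (rule ccontr)
    assume neg: "\<not> good V E"
    interpret fgraph V E by fact
    interpret critical V E
      by unfold_locales (use less neg in auto)
    show False by (rule impossible)
  qed
qed

section \<open>From minor models to induced minors\<close>

lemma contract_edge_parcs:
  "parcs (contract_edge G x y) = map_prod (id(y := x)) (id(y := x)) ` parcs G - Id"
proof -
  have "(\<lambda>(a, b). (if a = y then x else a, if b = y then x else b)) = map_prod (id(y := x)) (id(y := x))"
    by (auto simp: fun_eq_iff)
  then show ?thesis by (simp add: contract_edge_def)
qed

lemma pair_graph_iff_fgraph: "pair_graph G \<longleftrightarrow> fgraph (pverts G) (parcs G)"
proof
  assume "pair_graph G"
  then interpret pair_graph G .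
  show "fgraph (pverts G) (parcs G)"
    using arcs_symmetric no_loops' in_arcsD1 in_arcsD2
    by unfold_locales (auto simp: sym_def)
next
  assume "fgraph (pverts G) (parcs G)"
  then interpret fgraph "pverts G" "parcs G" .
  have "finite (parcs G)" using finite_subset[OF sub] fin by simp
  then show "pair_graph G"
    using fin sub symE irr by unfold_locales (auto simp: symmetric_def)
qed

lemma fgraph_delete_vertex:
  assumes "fgraph (pverts G) (parcs G)"
  shows "fgraph (pverts (delete_vertex G v)) (parcs (delete_vertex G v))"
proof -
  interpret fgraph "pverts G" "parcs G" by fact
  show ?thesis
    using fin sub irr by unfold_locales (auto simp: delete_vertex_def sym_def dest: edge_sym)
qed

lemma fgraph_contract_edge:
  assumes "fgraph (pverts G) (parcs G)" "(x, y) \<in> parcs G"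
  shows "fgraph (pverts (contract_edge G x y)) (parcs (contract_edge G x y))"
proof -
  interpret fgraph "pverts G" "parcs G" by fact
  have pv: "pverts (contract_edge G x y) = pverts G - {y}" by (simp add: contract_edge_def)
  have xy: "x \<in> pverts G" "x \<noteq> y" using assms(2) sub irr by auto
  show ?thesis
  proof
    show "finite (pverts (contract_edge G x y))" using fin by (simp add: pv)
    show "parcs (contract_edge G x y) \<subseteq> pverts (contract_edge G x y) \<times> pverts (contract_edge G x y)"
      using sub xy unfolding contract_edge_parcs pv by (auto simp: fun_upd_def split: if_splits)
    show "sym (parcs (contract_edge G x y))"
    proof (rule symI)
      fix a b assume "(a, b) \<in> parcs (contract_edge G x y)"
      then obtain a' b' where ab: "(a', b') \<in> parcs G" "a = (id(y := x)) a'" "b = (id(y := x)) b'" "a \<noteq> b"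
        unfolding contract_edge_parcs by auto
      have "(b, a) = map_prod (id(y := x)) (id(y := x)) (b', a')" using ab(2,3) by simp
      then have "(b, a) \<in> map_prod (id(y := x)) (id(y := x)) ` parcs G" using edge_sym[OF ab(1)] by (rule image_eqI)
      then show "(b, a) \<in> parcs (contract_edge G x y)" using ab(4) unfolding contract_edge_parcs by simp
    qed
  qed (simp add: contract_edge_parcs)
qed

lemma minor_model_delete_vertex:
  assumes M: "minor_model W H (pverts G) (parcs G) M" and v: "v \<notin> \<Union>(M ` W)"
  shows "minor_model W H (pverts (delete_vertex G v)) (parcs (delete_vertex G v)) M"
proof -
  have nv: "v \<notin> M i" if "i \<in> W" for i using v that by blast
  have t: "touch (parcs (delete_vertex G v)) (M i) (M j) \<longleftrightarrow> touch (parcs G) (M i) (M j)"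
    if "i \<in> W" "j \<in> W" for i j
    using nv[OF that(1)] nv[OF that(2)] by (auto simp: touch_def delete_vertex_def)
  have c: "conn (parcs (delete_vertex G v)) (M i)" if "i \<in> W" for i
    by (rule conn_mono[of "parcs G"]) (use M that nv[OF that] in \<open>auto simp: minor_model_def delete_vertex_def\<close>)
  show ?thesis
    using M nv t c unfolding minor_model_def by (auto simp: delete_vertex_def)
qed

text \<open>Both ends lie in one branch set, so the renaming \<open>f\<close> keeps every vertex in
  or out of each branch set. Hence adjacency between different branch sets neither appears nor
  vanishes.\<close>

lemma minor_model_contract_edge:
  assumes M: "minor_model W H (pverts G) (parcs G) M"
    and xy: "x \<in> M i" "y \<in> M i" "i \<in> W" "x \<noteq> y"
  shows "minor_model W H (pverts (contract_edge G x y)) (parcs (contract_edge G x y))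
    (\<lambda>j. (id(y := x)) ` M j)"
proof -
  define f where f: "f = id(y := x)"
  let ?E = "map_prod f f ` parcs G - Id"
  have dis: "M j \<inter> M k = {}" "touch (parcs G) (M j) (M k) \<longleftrightarrow> (j, k) \<in> H"
    if "j \<in> W" "k \<in> W" "j \<noteq> k" for j k
    using M that unfolding minor_model_def by blast+
  have M': "M j \<subseteq> pverts G" "conn (parcs G) (M j)" if "j \<in> W" for j
    using M that unfolding minor_model_def by blast+
  have sat: "f z \<in> M j \<longleftrightarrow> z \<in> M j" if "j \<in> W" for j z
  proof (cases "j = i")
    case True
    then show ?thesis using xy by (auto simp: f)
  next
    case False
    then show ?thesis using dis(1)[OF that xy(3)] xy by (auto simp: f)
  qed
  have sub: "f ` M j \<subseteq> M j" if "j \<in> W" for j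
    by (rule image_subsetI) (simp only: sat[OF that])
  show ?thesis
    unfolding minor_model_def contract_edge_parcs f[symmetric]
  proof (intro conjI ballI impI)
    fix j assume j: "j \<in> W"
    show "f ` M j \<subseteq> pverts (contract_edge G x y)"
      using sub[OF j] M'(1)[OF j] xy(4) by (auto simp: contract_edge_def f)
    show "conn ?E (f ` M j)"
      by (rule conn_image[OF M'(2)[OF j]])
  next
    fix j k assume jk: "j \<in> W" "k \<in> W" "j \<noteq> k"
    show dis': "f ` M j \<inter> f ` M k = {}" using dis(1)[OF jk] sub jk(1,2) by blast
    have "touch ?E (f ` M j) (f ` M k) \<longleftrightarrow> touch (parcs G) (M j) (M k)"
    proof
      assume "touch ?E (f ` M j) (f ` M k)"
      then obtain a' b' where ab': "a' \<in> f ` M j" "b' \<in> f ` M k" "(a', b') \<in> ?E"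
        by (rule touchE)
      obtain a b where ab: "(a, b) \<in> parcs G" "a' = f a" "b' = f b" using ab'(3) by auto
      have "f a \<in> M j" "f b \<in> M k"
        using subsetD[OF sub[OF jk(1)] ab'(1)] subsetD[OF sub[OF jk(2)] ab'(2)] ab(2,3) by simp_all
      then have "a \<in> M j" "b \<in> M k" by (simp_all only: sat[OF jk(1)] sat[OF jk(2)])
      then show "touch (parcs G) (M j) (M k)" using ab(1) by (rule touchI)
    next
      assume "touch (parcs G) (M j) (M k)"
      then obtain a b where ab: "a \<in> M j" "b \<in> M k" "(a, b) \<in> parcs G" by (rule touchE)
      have fab: "f a \<in> f ` M j" "f b \<in> f ` M k" using ab(1,2) by simp_all
      then have "f a \<noteq> f b" using dis' by (metis disjoint_iff)
      then have "(f a, f b) \<in> ?E" using ab(3) by force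
      then show "touch ?E (f ` M j) (f ` M k)" by (rule touchI[OF fab])
    qed
    then show "touch ?E (f ` M j) (f ` M k) \<longleftrightarrow> (j, k) \<in> H" using dis(2)[OF jk] by simp
  qed
qed

lemma singleton_model_iso:
  assumes G: "fgraph (pverts G) (parcs G)" and H: "fgraph (pverts H) (parcs H)"
    and M: "minor_model (pverts H) (parcs H) (pverts G) (parcs G) (\<lambda>i. {g i})"
    and cover: "pverts G = g ` pverts H"
  shows "digraph_iso (with_proj G) (with_proj H)"
proof -
  interpret G: fgraph "pverts G" "parcs G" by fact
  interpret H: fgraph "pverts H" "parcs H" by fact
  have edge: "g i \<noteq> g j \<and> ((g i, g j) \<in> parcs G \<longleftrightarrow> (i, j) \<in> parcs H)"
    if "i \<in> pverts H" "j \<in> pverts H" "i \<noteq> j" for i j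
    using M that unfolding minor_model_def by (auto simp: touch_def)
  then have inj: "inj_on g (pverts H)" by (auto simp: inj_on_def)
  define h where "h = the_inv_into (pverts H) g"
  have hg: "h (g i) = i" if "i \<in> pverts H" for i
    unfolding h_def by (rule the_inv_into_f_f[OF inj that])
  have hH: "h ` pverts G = pverts H" using hg cover by force
  have inj_h: "inj_on h (pverts G)" unfolding cover by (rule inj_onI) (auto simp: hg)
  have arcs: "map_prod h h ` parcs G = parcs H"
  proof (intro equalityI subrelI)
    fix i j assume "(i, j) \<in> map_prod h h ` parcs G"
    then obtain v w where vw: "(v, w) \<in> parcs G" "i = h v" "j = h w" by auto
    then obtain k l where kl: "k \<in> pverts H" "l \<in> pverts H" "v = g k" "w = g l"
      using G.sub cover by blast
    then have "k \<noteq> l" using vw(1) G.irr by auto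
    then show "(i, j) \<in> parcs H" using edge[OF kl(1,2)] kl vw hg by auto
  next
    fix i j assume ij: "(i, j) \<in> parcs H"
    then have "i \<in> pverts H" "j \<in> pverts H" "i \<noteq> j" using H.sub H.irr by auto
    then have "(g i, g j) \<in> parcs G" "(i, j) = map_prod h h (g i, g j)" using edge ij hg by auto
    then show "(i, j) \<in> map_prod h h ` parcs G" by blast
  qed
  have "inj_on (map_prod h h) (parcs G)"
    by (rule inj_on_subset[OF map_prod_inj_on[OF inj_h inj_h] G.sub])
  moreover have "wf_digraph (with_proj G)" using G.sub by unfold_locales auto
  ultimately have "pre_digraph.digraph_isomorphism (with_proj G)
      \<lparr> iso_verts = h, iso_arcs = map_prod h h, iso_head = snd, iso_tail = fst \<rparr>"
    using inj_h by (simp add: pre_digraph.digraph_isomorphism_def)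
  moreover have "with_proj H = app_iso
      \<lparr> iso_verts = h, iso_arcs = map_prod h h, iso_head = snd, iso_tail = fst \<rparr> (with_proj G)"
    using hH arcs by (simp add: app_iso_def with_proj_def)
  ultimately show ?thesis unfolding digraph_iso_def by blast
qed

text \<open>A vertex outside all branch sets is deleted, and an edge inside a branch set with
  several vertices is contracted. When neither exists, the branch sets are singletons covering the
  graph.\<close>

lemma minor_model_induced_minor:
  assumes H: "fgraph (pverts H) (parcs H)"
  shows "fgraph (pverts G) (parcs G) \<Longrightarrow> minor_model (pverts H) (parcs H) (pverts G) (parcs G) M \<Longrightarrow>
    \<exists>G'. induced_minor_step\<^sup>*\<^sup>* G G' \<and> digraph_iso (with_proj G') (with_proj H)"
proof (induction "card (pverts G)" arbitrary: G M rule: less_induct)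
  case less
  let ?W = "pverts H"
  interpret G: fgraph "pverts G" "parcs G" by (rule less.prems(1))
  have M: "M i \<subseteq> pverts G" "conn (parcs G) (M i)" if "i \<in> ?W" for i
    using less.prems(2) that unfolding minor_model_def by blast+
  have reduce: ?case
    if step: "induced_minor_step G G1" and g: "fgraph (pverts G1) (parcs G1)"
      and m: "minor_model (pverts H) (parcs H) (pverts G1) (parcs G1) M1"
      and v: "v \<in> pverts G" "pverts G1 = pverts G - {v}" for G1 M1 v
  proof -
    have "card (pverts G1) < card (pverts G)"
      using v G.fin by (intro psubset_card_mono) auto
    then obtain G' where "induced_minor_step\<^sup>*\<^sup>* G1 G'" "digraph_iso (with_proj G') (with_proj H)"
      using less.hyps[OF _ g m] by blast
    then show ?thesis using step by (meson converse_rtranclp_into_rtranclp)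
  qed
  show ?case
  proof (cases "pverts G \<subseteq> \<Union>(M ` ?W)")
    case False
    then obtain v where v: "v \<in> pverts G" "v \<notin> \<Union>(M ` ?W)" by blast
    show ?thesis
      by (rule reduce[OF induced_minor_step.delete[OF v(1)] fgraph_delete_vertex[OF less.prems(1)]
            minor_model_delete_vertex[OF less.prems(2) v(2)] v(1)]) (simp add: delete_vertex_def)
  next
    case cover: True
    show ?thesis
    proof (cases "\<exists>i\<in>?W. \<exists>x\<in>M i. M i \<noteq> {x}")
      case True
      then obtain i x where i: "i \<in> ?W" "x \<in> M i" "M i \<noteq> {x}" by blast
      have "touch (parcs G) {x} (M i - {x})"
        by (rule conn_cut[OF M(2)[OF i(1)]]) (use i in auto)
      then obtain y where y: "y \<in> M i" "y \<noteq> x" "(x, y) \<in> parcs G" by (auto simp: touch_def)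
      have "y \<in> pverts G" using y(1) M(1)[OF i(1)] by blast
      then show ?thesis
        by (rule reduce[OF induced_minor_step.contract[OF y(3)]
              fgraph_contract_edge[OF less.prems(1) y(3)]
              minor_model_contract_edge[OF less.prems(2) i(2) y(1) i(1) y(2)[symmetric]]])
          (simp add: contract_edge_def)
    next
      case False
      define g where "g i = (SOME x. x \<in> M i)" for i
      have gM: "M i = {g i}" if "i \<in> ?W" for i
      proof -
        have "g i \<in> M i" unfolding g_def
          using conn_nonempty[OF M(2)[OF that]] by (simp add: some_in_eq)
        then show ?thesis using False that by blast
      qed
      have "minor_model (pverts H) (parcs H) (pverts G) (parcs G) (\<lambda>i. {g i})"
        using less.prems(2) unfolding minor_model_def by (simp add: gM)
      moreover have "pverts G = g ` ?W" using cover M(1) gM by auto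
      ultimately have "digraph_iso (with_proj G) (with_proj H)"
        using singleton_model_iso[OF less.prems(1) H] by blast
      then show ?thesis by blast
    qed
  qed
qed

lemma induced_minor_free_model_free:
  assumes "pair_graph G" "induced_minor_free K5_minus G"
  shows "model_free (pverts G) (parcs G)"
proof -
  have "fgraph (pverts K5_minus) (parcs K5_minus)"
    by unfold_locales (auto simp: K5_minus_def sym_def)
  then show ?thesis
    using assms minor_model_induced_minor[of K5_minus G]
    unfolding model_free_def induced_minor_free_def pair_graph_iff_fgraph by blast
qed

section \<open>Tree decompositions of chordal graphs\<close>

lemma pcas_append: "pcas u (p @ q) v \<longleftrightarrow> (\<exists>w. pcas u p w \<and> pcas w q v)"
  by (induction p arbitrary: u) auto

lemma pcas_last: "pcas u p v \<Longrightarrow> p \<noteq> [] \<Longrightarrow> snd (last p) = v"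
  by (induction p arbitrary: u) (auto split: if_splits)

lemma pawalk_verts_pcas: "pcas u p v \<Longrightarrow> pawalk_verts u p = u # map snd p"
  by (induction p arbitrary: u) auto

text \<open>On a closed walk the heads \<open>map snd p\<close> run once through the visited
  positions, so distinct heads describe a cycle. Going forth and back along one edge has length two
  and stays allowed.\<close>

definition no_cycle :: "'a rel \<Rightarrow> bool" where
  "no_cycle A \<longleftrightarrow> (\<forall>u p. pcas u p u \<and> set p \<subseteq> A \<and> distinct (map snd p) \<longrightarrow> length p < 3)"

text \<open>A closed walk using the leaf \<open>n\<close> enters it by \<open>(t, n)\<close> and
  leaves it by \<open>(n, t)\<close>. So \<open>t\<close> is a head both when left for
  \<open>n\<close> and when reached again, and these coincide only on the walk of length
  two.\<close>

lemma no_cycle_leaf: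
  assumes A: "no_cycle A" and n: "\<And>x. (x, n) \<notin> A" "\<And>x. (n, x) \<notin> A" "t \<noteq> n"
  shows "no_cycle (A \<union> {(n, t), (t, n)})"
  unfolding no_cycle_def
proof (intro allI impI)
  fix u p assume p: "pcas u p u \<and> set p \<subseteq> A \<union> {(n, t), (t, n)} \<and> distinct (map snd p)"
  then have cas: "pcas u p u" and sub: "set p \<subseteq> A \<union> {(n, t), (t, n)}" and dist: "distinct (map snd p)"
    by auto
  have new: "e = (n, t) \<or> e = (t, n) \<or> fst e \<noteq> n \<and> snd e \<noteq> n" if "e \<in> set p" for e
  proof -
    have "e \<in> A \<union> {(n, t), (t, n)}" using that sub by blast
    then show ?thesis using n by (cases e) auto
  qed
  have out: "e = (n, t)" if "e \<in> set p" "fst e = n" for e using new[OF that(1)] that(2) n(3) by (cases e) auto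
  have into: "e = (t, n)" if "e \<in> set p" "snd e = n" for e using new[OF that(1)] that(2) n(3) by (cases e) auto
  show "length p < 3"
  proof (rule ccontr)
    assume len: "\<not> length p < 3"
    have "(t, n) \<in> set p"
    proof (rule ccontr)
      assume tn: "(t, n) \<notin> set p"
      have "(n, t) \<notin> set p"
      proof
        assume "(n, t) \<in> set p"
        then obtain p1 p2 where p12: "p = p1 @ (n, t) # p2" by (auto simp: in_set_conv_decomp)
        show False
        proof (cases "p1 = []")
          case True
          then have "u = n" using cas p12 by simp
          then have "snd (last p) = n" using pcas_last[OF cas] p12 by simp
          moreover have "last p \<in> set p" using p12 by simp
          ultimately show False using into[of "last p"] tn by simp
        next
          case False
          obtain w where "pcas u p1 w" "w = n" using cas p12 by (auto simp: pcas_append)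
          then have "snd (last p1) = n" using pcas_last[of u p1 w] False by simp
          moreover have "last p1 \<in> set p" using False p12 by simp
          ultimately show False using into[of "last p1"] tn by simp
        qed
      qed
      then have "set p \<subseteq> A" using sub tn by auto
      then show False using A cas dist len unfolding no_cycle_def by blast
    qed
    then obtain p1 p2 where p12: "p = p1 @ (t, n) # p2" by (auto simp: in_set_conv_decomp)
    have c1: "pcas u p1 t" and c2: "pcas n p2 u" using cas p12 by (auto simp: pcas_append)
    show False
    proof (cases p2)
      case Nil
      then have un: "u = n" using c2 by simp
      then have "p1 \<noteq> []" using c1 n(3) by auto
      then obtain e p3 where p3: "p1 = e # p3" by (cases p1) auto
      then have "e = (n, t)" using out[of e] c1 un p12 by auto
      moreover have "p3 \<noteq> []" using len p12 Nil p3 by auto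
      moreover have "snd (last p3) = t" using c1 p3 calculation pcas_last[of "snd e" p3 t] by auto
      ultimately have "t \<in> set (map snd p3)" using last_in_set[of p3] by force
      then show False using dist p12 p3 \<open>e = (n, t)\<close> by auto
    next
      case (Cons e p3)
      then have e: "e = (n, t)" using out[of e] c2 p12 by auto
      show False
      proof (cases "p1 = []")
        case True
        then have "u = t" using c1 by simp
        moreover have "p3 \<noteq> []" using len p12 Cons True by auto
        ultimately have "snd (last p3) = t" using c2 Cons e pcas_last[of t p3 t] by auto
        then have "t \<in> set (map snd p3)" using last_in_set[OF \<open>p3 \<noteq> []\<close>] by force
        then show False using dist p12 Cons e by auto
      next
        case False
        then have "snd (last p1) = t" using pcas_last[OF c1] by simp
        then have "t \<in> set (map snd p1)" using last_in_set[OF False] by force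
        then show False using dist p12 Cons e by auto
      qed
    qed
  qed
qed

lemma no_cycle_undirected:
  assumes "no_cycle (parcs T)"
  shows "\<not> (\<exists>p. pre_digraph.cycle (with_proj T) p \<and> 3 \<le> length p)"
proof
  assume "\<exists>p. pre_digraph.cycle (with_proj T) p \<and> 3 \<le> length p"
  then obtain p u where p: "3 \<le> length p" "pre_digraph.awalk (with_proj T) u p u"
    "distinct (tl (pawalk_verts u p))"
    unfolding pre_digraph.cycle_def awalk_verts_with_proj_eq by blast
  then have "set p \<subseteq> parcs T" "pcas u p u"
    unfolding pre_digraph.awalk_def cas_with_proj_eq by auto
  moreover have "distinct (map snd p)" using p(3) pawalk_verts_pcas[OF \<open>pcas u p u\<close>] by simp
  ultimately show False using assms p(1) unfolding no_cycle_def by force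
qed

text \<open>A bag for every clique, not only for every edge, is what the induction requires: the
  clique neighbourhood of the next vertex must fit into an existing bag.\<close>

definition clique_tree :: "'a set \<Rightarrow> 'a rel \<Rightarrow> 't set \<Rightarrow> 't rel \<Rightarrow> ('t \<Rightarrow> 'a set) \<Rightarrow> bool" where
  "clique_tree V F N A X \<longleftrightarrow> fgraph N A \<and> conn A N \<and> no_cycle A \<and>
     (\<forall>t\<in>N. X t \<subseteq> V \<and> clique F (X t)) \<and>
     (\<forall>K. K \<subseteq> V \<and> clique F K \<longrightarrow> (\<exists>t\<in>N. K \<subseteq> X t)) \<and>
     (\<forall>v\<in>V. conn A {t \<in> N. v \<in> X t})"

lemma clique_treeD:
  assumes "clique_tree V F N A X"
  shows "fgraph N A" "conn A N" "no_cycle A"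
    and "t \<in> N \<Longrightarrow> X t \<subseteq> V" "t \<in> N \<Longrightarrow> clique F (X t)"
    and "K \<subseteq> V \<Longrightarrow> clique F K \<Longrightarrow> \<exists>t\<in>N. K \<subseteq> X t"
    and "v \<in> V \<Longrightarrow> conn A {t \<in> N. v \<in> X t}"
  using assms by (simp_all add: clique_tree_def)

text \<open>The new node with bag \<open>insert v S\<close> becomes a leaf at a node
  \<open>t\<close> whose bag contains \<open>S\<close>. The subtrees of the vertices in
  \<open>S\<close> grow through \<open>t\<close>, and all other old ones stay as they are.\<close>

lemma chordal_clique_tree:
  "chordal V F \<Longrightarrow> \<exists>(N :: nat set) A X. clique_tree V F N A X"
proof (induction rule: chordal.induct)
  case empty
  \<comment> \<open>Even the empty graph gets one node, with an empty bag, because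
    \<open>conn\<close> demands a nonempty tree.\<close>
  have "clique_tree {} {} {0 :: nat} {} (\<lambda>_. {})"
    unfolding clique_tree_def
    by (auto simp: no_cycle_def clique_def sym_def intro!: fgraph.intro)
  then show ?case by blast
next
  case (add V F v S)
  obtain N :: "nat set" and A X where ct: "clique_tree V F N A X" using add.IH by blast
  note N = clique_treeD(1-3)[OF ct] and X = clique_treeD(4,5)[OF ct]
    and K = clique_treeD(6)[OF ct] and C = clique_treeD(7)[OF ct]
  interpret fgraph N A by (rule N(1))
  obtain n where n: "n \<notin> N" using fin ex_new_if_finite[OF infinite_UNIV_nat] by blast
  obtain t where t: "t \<in> N" "S \<subseteq> X t" using K add.hyps(3,4) by blast
  let ?A = "A \<union> {(n, t), (t, n)}" and ?F = "F \<union> {v} \<times> S \<union> S \<times> {v}"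
  have nA: "(x, n) \<notin> A" "(n, x) \<notin> A" for x using sub n by blast+
  have tn: "t \<noteq> n" using t(1) n by blast
  have g: "fgraph (insert n N) ?A"
    using fin sub irr t(1) tn by unfold_locales (auto simp: sym_def dest: edge_sym)
  have symA: "sym ?A" by (rule fgraph.symE[OF g])
  have mono: "conn ?A Y" if "conn A Y" for Y by (rule conn_mono[OF that]) auto
  have attach: "conn ?A (insert n Y)" if "conn A Y" "t \<in> Y" for Y
    by (rule conn_insert_touch[OF mono[OF that(1)] symA]) (use that(2) in \<open>auto simp: touch_def\<close>)
  let ?X = "X(n := insert v S)"
  have XN: "?X s = X s" if "s \<in> N" for s using that n by auto
  have "clique_tree (insert v V) ?F (insert n N) ?A ?X"
    unfolding clique_tree_def
  proof (intro conjI ballI allI impI)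
    show "fgraph (insert n N) ?A" by (rule g)
    show "conn ?A (insert n N)" by (rule attach[OF N(2) t(1)])
    show "no_cycle ?A" by (rule no_cycle_leaf[OF N(3) nA tn])
    fix s assume s: "s \<in> insert n N"
    show "?X s \<subseteq> insert v V" using s X add.hyps(3) by auto
    show "clique ?F (?X s)"
    proof (cases "s = n")
      case True
      then show ?thesis using add.hyps(4) by (auto simp: clique_def)
    next
      case False
      then have "clique F (?X s)" using s X by simp
      then show ?thesis by (rule clique_mono) auto
    qed
  next
    fix L assume L: "L \<subseteq> insert v V \<and> clique ?F L"
    show "\<exists>s\<in>insert n N. L \<subseteq> ?X s"
    proof (cases "v \<in> L")
      case True
      have Fv: "(v, w) \<notin> F" for w using fgraph.sub[OF chordal_fgraph[OF add.hyps(1)]] add.hyps(2) by blast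
      have "L \<subseteq> insert v S"
      proof
        fix w assume w: "w \<in> L"
        show "w \<in> insert v S"
        proof (cases "w = v")
          case False
          then have "(v, w) \<in> ?F" using L True w by (auto simp: clique_def)
          then show ?thesis using Fv add.hyps(2,3) by auto
        qed simp
      qed
      then show ?thesis by (intro bexI[of _ n]) auto
    next
      case False
      have "clique F L"
        unfolding clique_def
      proof (intro ballI impI)
        fix x y assume xy: "x \<in> L" "y \<in> L" "x \<noteq> y"
        then have "(x, y) \<in> ?F" using L by (auto simp: clique_def)
        then show "(x, y) \<in> F" using xy False by auto
      qed
      then obtain s where "s \<in> N" "L \<subseteq> X s" using K[of L] L False by blast
      then show ?thesis using XN by (intro bexI[of _ s]) auto
    qed
  next
    fix w assume w: "w \<in> insert v V"
    show "conn ?A {s \<in> insert n N. w \<in> ?X s}"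
    proof (cases "w = v")
      case True
      then have "{s \<in> insert n N. w \<in> ?X s} = {n}" using X add.hyps(2) n by auto
      then show ?thesis by simp
    next
      case False
      then have wV: "w \<in> V" using w by simp
      show ?thesis
      proof (cases "w \<in> S")
        case True
        then have "{s \<in> insert n N. w \<in> ?X s} = insert n {s \<in> N. w \<in> X s}" using n by auto
        then show ?thesis using attach[OF C[OF wV]] t True by auto
      next
        case wS: False
        then have "{s \<in> insert n N. w \<in> ?X s} = {s \<in> N. w \<in> X s}" using n False by auto
        then show ?thesis using mono[OF C[OF wV]] by simp
      qed
    qed
  qed
  then show ?case by blast
qed

section \<open>From clique trees to the tree-independence number\<close>

lemma conn_reachable:
  assumes "conn A S" "u \<in> S" "v \<in> S"
  shows "(u, v) \<in> rtrancl_on S A"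
proof (rule ccontr)
  assume neg: "(u, v) \<notin> rtrancl_on S A"
  let ?R = "{w \<in> S. (u, w) \<in> rtrancl_on S A}"
  have "u \<in> ?R" using assms(2) by (simp add: rtrancl_on_refl)
  then have "?R \<subset> S" "?R \<noteq> {}" using neg assms(3) by blast+
  then obtain x where x: "x \<in> S - ?R" "x \<in> A `` ?R" by (rule conn_grow[OF assms(1)])
  then obtain w where "w \<in> ?R" "(w, x) \<in> A" by blast
  then have "(u, x) \<in> rtrancl_on S A" using x(1) by (auto intro: rtrancl_on_into_rtrancl_on)
  then show False using x(1) by blast
qed

lemma conn_connected:
  assumes "conn (parcs T) S"
  shows "connected (with_proj T \<restriction> S)"
proof -
  let ?G = "mk_symmetric (with_proj T \<restriction> S)"
  have "conn (parcs ?G) S"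
    by (rule conn_mono[OF assms]) (auto simp: mk_symmetric_def induce_subgraph_def)
  then have "(v, w) \<in> rtrancl_on S (parcs ?G)" if "v \<in> S" "w \<in> S" for v w
    using that by (rule conn_reachable)
  moreover have "pverts ?G = S" by (simp add: mk_symmetric_def)
  ultimately show ?thesis
    using conn_nonempty[OF assms] by (simp add: connected_def strongly_connected_def reachable_def)
qed

lemma independence_number_le_4:
  assumes "finite Y" "card Y \<le> 4 \<or> clique (parcs G) Y"
  shows "independence_number (with_proj G \<restriction> Y) \<le> 4"
proof -
  let ?I = "{S. independent_set (with_proj G \<restriction> Y) S}"
  have I: "S \<subseteq> Y \<and> (\<forall>u\<in>S. \<forall>v\<in>S. (u, v) \<notin> parcs G)" if "S \<in> ?I" for S
    using that by (auto simp: independent_set_def induce_subgraph_def arcs_ends_conv)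
  have "finite ?I" using I assms(1) by (auto intro: finite_subset[of _ "Pow Y"])
  moreover have "{} \<in> ?I" by (simp add: independent_set_def)
  moreover have "card S \<le> 4" if S: "S \<in> ?I" for S
  proof (cases "card Y \<le> 4")
    case True
    then show ?thesis using card_mono[OF assms(1)] I[OF S] le_trans by blast
  next
    case False
    then have "\<forall>x\<in>S. \<forall>y\<in>S. x = y" using assms(2) I[OF S] unfolding clique_def by blast
    moreover have "finite S" using I[OF S] assms(1) finite_subset by blast
    ultimately have "card S \<le> 1" by (simp add: card_le_Suc0_iff_eq)
    then show ?thesis by simp
  qed
  ultimately show ?thesis
    unfolding independence_number_def by (subst Max_le_iff) auto
qed

theorem corollary6p7:
  fixes G :: "'a pair_pre_digraph"
  assumes "pair_graph G"
    and "induced_minor_free K5_minus G"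
  shows "tree_independence_number G \<le> 4"
proof -
  interpret fgraph "pverts G" "parcs G" using assms(1) by (simp add: pair_graph_iff_fgraph)
  have "good (pverts G) (parcs G)"
    by (rule model_free_good[OF _ induced_minor_free_model_free[OF assms]]) unfold_locales
  then obtain F where F: "chordal (pverts G) F" "parcs G \<subseteq> F"
    and K: "\<And>K. K \<subseteq> pverts G \<Longrightarrow> clique F K \<Longrightarrow> card K \<le> 4 \<or> clique (parcs G) K"
    by (rule goodE) (rule that)
  obtain N :: "nat set" and A X where ct: "clique_tree (pverts G) F N A X"
    using chordal_clique_tree[OF F(1)] by blast
  note N = clique_treeD(1-3)[OF ct] and X = clique_treeD(4,5)[OF ct]
    and cl = clique_treeD(6)[OF ct] and C = clique_treeD(7)[OF ct]
  let ?T = "\<lparr> pverts = N, parcs = A \<rparr>"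
  have "tree_decomposition G ?T X"
    unfolding tree_decomposition_def
  proof (intro conjI ballI)
    have "connected (with_proj ?T \<restriction> N)" by (rule conn_connected) (simp add: N(2))
    moreover have "with_proj ?T \<restriction> N = with_proj ?T"
      using fgraph.sub[OF N(1)] by (auto simp: induce_subgraph_def with_proj_def)
    ultimately show "undirected_tree ?T"
      using N(1) no_cycle_undirected[of ?T] N(3)
      by (auto simp: undirected_tree_def pair_graph_iff_fgraph)
    show "X t \<subseteq> pverts G" if "t \<in> pverts ?T" for t using X that by simp
    show "\<exists>t\<in>pverts ?T. v \<in> X t" if "v \<in> pverts G" for v
      using cl[of "{v}"] that by (auto simp: clique_def)
    show "case e of (u, v) \<Rightarrow> \<exists>t\<in>pverts ?T. u \<in> X t \<and> v \<in> X t" if "e \<in> parcs G" for e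
    proof -
      obtain u v where e: "e = (u, v)" by (cases e)
      have "clique F {u, v}" using that F(2) edge_sym[of u v] by (auto simp: e clique_def)
      then show ?thesis using cl[of "{u, v}"] that sub by (auto simp: e)
    qed
    show "connected (with_proj ?T \<restriction> {t \<in> pverts ?T. v \<in> X t})" if "v \<in> pverts G" for v
      by (rule conn_connected) (simp add: C[OF that])
  qed
  then have "tree_independence_number G \<le> decomposition_independence_number G ?T X"
    unfolding tree_independence_number_def by (intro Least_le) blast
  also have "\<dots> \<le> 4"
  proof -
    have "independence_number (with_proj G \<restriction> X t) \<le> 4" if "t \<in> N" for t
      using X[OF that] K fin by (intro independence_number_le_4) (auto intro: finite_subset)
    moreover have "finite N" "N \<noteq> {}" using fgraph.fin[OF N(1)] conn_nonempty[OF N(2)] by auto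
    ultimately show ?thesis
      unfolding decomposition_independence_number_def by simp
  qed
  finally show ?thesis .
qed

end
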